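(* Let $\lambda>0$ and let $(m_{1,0},m_{2,0})$ be such that $(m_{1,0},m_{2,0})\in (C^{\alpha}(\mathbb{R}))^2$ for every $\alpha>0$. Then the system $$m_{1,t} = H_t m_{1,0} - \int_0^t H_{t-s}\big[V'(m_{1,s}) + \lambda(m_{1,s}-m_{2,s})\big]\,ds + Z_{1,t},$$ $$m_{2,t} = H_t m_{2,0} - \int_0^t H_{t-s}\big[V'(m_{2,s}) + \lambda(m_{2,s}-m_{1,s})\big]\,ds + Z_{2,t},$$ for $t\ge 0$, has a unique $\mathcal{F}_t$-adapted solution process $(m_{1,t},m_{2,t})_{t\ge 0}$ with $(m_1,m_2)\in \big(C^{\alpha}(\mathbb{R}\times\mathbb{R}^+)\big)^2$ for every $\alpha>0$.
   Context: $V(m)=\tfrac14 m^4-\tfrac12 m^2$, so $V'(m)=m^3-m$. $\mathbb{R}^+=[0,\infty)$. $H_t$ is the heat kernel/semigroup of the operator $\partial_t-\tfrac12\partial_{xx}$ on $\mathbb{R}$: $H_t(x,y)=(2\pi t)^{-1/2}e^{-(x-y)^2/(2t)}$, $(H_tf)(x)=\int_{\mathbb{R}}H_t(x,y)f(y)\,dy$ for $t>0$ and $H_0f=f$. $\dot\alpha_1,\dot\alpha_2$ are two independent space-time white noises on $\mathbb{R}\times\mathbb{R}^+$, and $Z_{i,t}=\int_0^tH_{t-s}\dot\alpha_{i,s}\,ds$, i.e. $Z_i(x,t)=\int_0^t\int_{\mathbb{R}}H_{t-s}(x,y)\,\dot\alpha_i(y,s)\,dy\,ds$ (stochastic convolution,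 taken in its continuous version), $i=1,2$. The filtration is $\mathcal{F}_t=\sigma\{Z_{i}(x,s):x\in\mathbb{R},\,s\le t,\,i=1,2\}$. Subscript $t$ denotes evaluation at time $t$. The system is the mild form of $\partial_tm_1=\tfrac12\partial_{xx}m_1-V'(m_1)+\lambda(m_2-m_1)+\dot\alpha_1$, $\partial_tm_2=\tfrac12\partial_{xx}m_2-V'(m_2)+\lambda(m_1-m_2)+\dot\alpha_2$. As usual, existence and uniqueness are understood almost surely. For $\alpha>0$, $C^{\alpha}(\mathbb{R})$ is the Banach space of continuous functions $f$ on $\mathbb{R}$ with finite norm $\|f\|_{C^\alpha(\mathbb{R})}=\sup_{x\in\mathbb{R}}e^{-\alpha|x|}|f(x)|$, and $C^{\alpha}(\mathbb{R}\times\mathbb{R}^+)$ is the Banach space of continuous functions $f$ on $\mathbb{R}\times\mathbb{R}^+$ with finite norm $\|f\|_{C^\alpha(\mathbb{R}\times\mathbb{R}^+)}=\sup_{t\ge0}\sup_{x\in\mathbb{R}}\exp\big(-\tfrac{\alpha^2}{2}t-\alpha|x|\big)|f(x,t)|$. (These are weighted spaces, not Hölder spaces.) *)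

theory Defs
  imports "HOL-Probability.Probability"
begin

section \<open>Potential and heat semigroup\<close>

definition V :: "real \<Rightarrow> real" where
  "V m = m ^ 4 / 4 - m\<^sup>2 / 2"

definition V' :: "real \<Rightarrow> real" where
  "V' m = m ^ 3 - m"

lemma V_has_derivative: "(V has_real_derivative V' m) (at m)"
  unfolding V_def V'_def by (auto intro!: derivative_eq_intros)

definition heat_kernel :: "real \<Rightarrow> real \<Rightarrow> real \<Rightarrow> real" where
  "heat_kernel t x y = (2 * pi * t) powr (- 1 / 2) * exp (- (x - y)\<^sup>2 / (2 * t))"

definition heat_semigroup :: "real \<Rightarrow> (real \<Rightarrow> real) \<Rightarrow> real \<Rightarrow> real" where
  "heat_semigroup t f x = (if t = 0 then f x else (LBINT y. heat_kernel t x y * f y))"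

section \<open>Weighted spaces\<close>

definition space_norm :: "real \<Rightarrow> (real \<Rightarrow> real) \<Rightarrow> ennreal" where
  "space_norm \<alpha> f = (SUP x. ennreal (exp (- \<alpha> * \<bar>x\<bar>) * \<bar>f x\<bar>))"

definition C_space :: "real \<Rightarrow> (real \<Rightarrow> real) set" where
  "C_space \<alpha> = {f. continuous_on UNIV f \<and> space_norm \<alpha> f < \<infinity>}"

text \<open>
  A function on \<open>\<real> \<times> \<real>\<^sup>+\<close> is represented by a function of pairs \<open>(x, t)\<close> whose
  values at \<open>t < 0\<close> are irrelevant.
\<close>

definition spacetime :: "(real \<times> real) set" where
  "spacetime = UNIV \<times> {0..}"

definition spacetime_norm :: "real \<Rightarrow> (real \<times> real \<Rightarrow> real) \<Rightarrow> ennreal" where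
  "spacetime_norm \<alpha> f =
     (SUP t\<in>{0..}. SUP x. ennreal (exp (- (\<alpha>\<^sup>2 / 2) * t - \<alpha> * \<bar>x\<bar>) * \<bar>f (x, t)\<bar>))"

definition C_spacetime :: "real \<Rightarrow> (real \<times> real \<Rightarrow> real) set" where
  "C_spacetime \<alpha> = {f. continuous_on spacetime f \<and> spacetime_norm \<alpha> f < \<infinity>}"

section \<open>Space-time white noise and stochastic convolution\<close>

definition spacetime_measure :: "(real \<times> real) measure" where
  "spacetime_measure = restrict_space lborel spacetime"

definition L2 :: "(real \<times> real \<Rightarrow> real) set" where
  "L2 = {f \<in> borel_measurable spacetime_measure. integrable spacetime_measure (\<lambda>z. (f z)\<^sup>2)}"

text \<open>The law \<open>N(0, v)\<close>, where \<open>v = 0\<close> gives the Dirac mass at 0.\<close>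

definition centred_gaussian :: "real \<Rightarrow> real measure" where
  "centred_gaussian v =
     (if v = 0 then return borel 0 else density lborel (\<lambda>x. ennreal (normal_density 0 (sqrt v) x)))"

text \<open>
  White noise is the centred Gaussian process indexed by \<open>L2\<close> whose covariance is the
  \<open>L2\<close> inner product; \<open>W f\<close> is the integral of \<open>f\<close> against the noise.  The elements of
  \<open>L2\<close> are functions rather than classes; the covariance condition forces
  \<open>W f = W g\<close> almost surely when \<open>f = g\<close> almost everywhere, and \<open>W\<close> to be almost surely linear.
\<close>

definition white_noise ::
  "'w measure \<Rightarrow> ((real \<times> real \<Rightarrow> real) \<Rightarrow> 'w \<Rightarrow> real) \<Rightarrow> bool" where
  "white_noise M W \<longleftrightarrow>
     (\<forall>f\<in>L2. W f \<in> borel_measurable M) \<and>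
     (\<forall>F c. finite F \<and> F \<subseteq> L2 \<longrightarrow>
        (\<exists>v\<ge>0. distr M borel (\<lambda>\<omega>. \<Sum>f\<in>F. c f * W f \<omega>) = centred_gaussian v)) \<and>
     (\<forall>f\<in>L2. \<forall>g\<in>L2. (\<integral>\<omega>. W f \<omega> * W g \<omega> \<partial>M) = (\<integral>z. f z * g z \<partial>spacetime_measure))"

definition independent_noises ::
  "'w measure \<Rightarrow> ((real \<times> real \<Rightarrow> real) \<Rightarrow> 'w \<Rightarrow> real) \<Rightarrow>
   ((real \<times> real \<Rightarrow> real) \<Rightarrow> 'w \<Rightarrow> real) \<Rightarrow> bool" where
  "independent_noises M W1 W2 \<longleftrightarrow>
     prob_space.indep_var M
       (Pi\<^sub>M L2 (\<lambda>_. borel)) (\<lambda>\<omega>. \<lambda>f\<in>L2. W1 f \<omega>)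
       (Pi\<^sub>M L2 (\<lambda>_. borel)) (\<lambda>\<omega>. \<lambda>f\<in>L2. W2 f \<omega>)"

text \<open>Random fields are written \<open>Z \<omega> (x, t)\<close>.\<close>

definition continuous_stochastic_convolution ::
  "'w measure \<Rightarrow> ((real \<times> real \<Rightarrow> real) \<Rightarrow> 'w \<Rightarrow> real) \<Rightarrow>
   ('w \<Rightarrow> real \<times> real \<Rightarrow> real) \<Rightarrow> bool" where
  "continuous_stochastic_convolution M W Z \<longleftrightarrow>
     (\<forall>\<omega>\<in>space M. continuous_on spacetime (Z \<omega>)) \<and>
     (\<forall>x. \<forall>t\<ge>0. (\<lambda>\<omega>. Z \<omega> (x, t)) \<in> borel_measurable M \<and>
        (AE \<omega> in M. Z \<omega> (x, t) =
           W (\<lambda>(y, s). if 0 \<le> s \<and> s < t then heat_kernel (t - s) x y else 0) \<omega>))"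

definition noise_filtration ::
  "'w measure \<Rightarrow> ('w \<Rightarrow> real \<times> real \<Rightarrow> real) \<Rightarrow> ('w \<Rightarrow> real \<times> real \<Rightarrow> real) \<Rightarrow>
   real \<Rightarrow> 'w measure" where
  "noise_filtration M Z1 Z2 t = sigma (space M)
     {(\<lambda>\<omega>. Z \<omega> (x, s)) -` B \<inter> space M | Z x s B.
        Z \<in> {Z1, Z2} \<and> 0 \<le> s \<and> s \<le> t \<and> B \<in> sets borel}"

section \<open>Solutions of the coupled system\<close>

definition adapted ::
  "(real \<Rightarrow> 'w measure) \<Rightarrow> ('w \<Rightarrow> real \<times> real \<Rightarrow> real) \<Rightarrow> bool" where
  "adapted \<F> m \<longleftrightarrow> (\<forall>t\<ge>0. \<forall>x. (\<lambda>\<omega>. m \<omega> (x, t)) \<in> borel_measurable (\<F> t))"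

text \<open>
  One line of the mild system, for the component \<open>u\<close> coupled to \<open>v\<close>, with forcing \<open>z\<close>.
  For \<open>u\<close> and \<open>v\<close> in \<open>C_spacetime \<alpha>\<close> for every \<open>\<alpha> > 0\<close> all integrals converge
  absolutely, so the convention that a divergent integral is 0 plays no role in
  \<open>is_solution\<close> below.
\<close>

definition mild_equation ::
  "real \<Rightarrow> (real \<Rightarrow> real) \<Rightarrow> (real \<times> real \<Rightarrow> real) \<Rightarrow> (real \<times> real \<Rightarrow> real) \<Rightarrow>
   (real \<times> real \<Rightarrow> real) \<Rightarrow> bool" where
  "mild_equation lam u0 z u v \<longleftrightarrow>
     (\<forall>t\<ge>0. \<forall>x. u (x, t) =
        heat_semigroup t u0 x
        - (LBINT s:{0..t}.
             heat_semigroup (t - s) (\<lambda>y. V' (u (y, s)) + lam * (u (y, s) - v (y, s))) x)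
        + z (x, t))"

definition is_solution ::
  "'w measure \<Rightarrow> real \<Rightarrow> (real \<Rightarrow> real) \<Rightarrow> (real \<Rightarrow> real) \<Rightarrow>
   ('w \<Rightarrow> real \<times> real \<Rightarrow> real) \<Rightarrow> ('w \<Rightarrow> real \<times> real \<Rightarrow> real) \<Rightarrow>
   ('w \<Rightarrow> real \<times> real \<Rightarrow> real) \<Rightarrow> ('w \<Rightarrow> real \<times> real \<Rightarrow> real) \<Rightarrow> bool" where
  "is_solution M lam m10 m20 Z1 Z2 m1 m2 \<longleftrightarrow>
     adapted (noise_filtration M Z1 Z2) m1 \<and> adapted (noise_filtration M Z1 Z2) m2 \<and>
     (AE \<omega> in M.
        (\<forall>\<alpha>>0. m1 \<omega> \<in> C_spacetime \<alpha> \<and> m2 \<omega> \<in> C_spacetime \<alpha>) \<and>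
        mild_equation lam m10 (Z1 \<omega>) (m1 \<omega>) (m2 \<omega>) \<and>
        mild_equation lam m20 (Z2 \<omega>) (m2 \<omega>) (m1 \<omega>))"

end

theory Submission
  imports Defs
begin

text \<open>
  Put \<open>g\<^sub>i = H\<^sub>t m\<^sub>i\<^sub>0 + Z\<^sub>i\<close> and \<open>D q = \<integral>\<^sub>0\<^sup>t H\<^sub>t\<^sub>-\<^sub>s q\<^sub>s ds\<close>.  The argument is pathwise.
  Almost surely \<open>g\<^sub>i\<close> is continuous and grows more slowly than every exponential of
  \<open>\<bar>x\<bar> + t\<close> (\<open>subexp\<close>), which is the same as lying in \<open>C_spacetime \<alpha>\<close> for every \<open>\<alpha> > 0\<close>; and for
  every such \<open>g\<close> the system \<open>u\<^sub>i = g\<^sub>i - D (V'(u\<^sub>i) + lam (u\<^sub>i - u\<^sub>j))\<close> has exactly one continuous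
  solution of this growth.

  The cubic is not Lipschitz, and the coefficient \<open>c\<close> in \<open>V'(u) - V'(v) = c (u - v)\<close> is unbounded
  along the line, so a Gronwall argument fails.  What helps is \<open>c \<ge> -1\<close>.  In the mild
  formulation this sign is used through a discount: \<open>d = D q\<close> implies
  \<open>d = D\<^sub>K (q + K d)\<close>, where \<open>D\<^sub>K\<close> has the additional factor \<open>exp (- K (t - s))\<close>
  (\<open>duhamel_discount\<close>).  If \<open>q = f - c d\<close> with \<open>-1 \<le> c \<le> K\<close>, then
  \<open>\<bar>d\<bar> \<le> D\<^sub>K ((K + 1) \<bar>d\<bar> + \<bar>f\<bar>)\<close>, and the bound on \<open>d\<close> that follows does not depend on \<open>K\<close>
  (\<open>duhamel_comparison\<close>).  Norms are taken with the weight \<open>exp (\<alpha>\<^sup>2 t / 2) cosh (\<alpha> x)\<close>.  It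
  solves the heat equation, so \<open>D\<^sub>K\<close> merely multiplies it by a function of \<open>t\<close>, and the comparison
  becomes an inequality for one constant.

  Since \<open>c\<close> has to be bounded by some \<open>K\<close>, \<open>V'\<close> is first truncated at height \<open>R\<close>.  The truncated
  system is solved by Picard iteration.  Its solutions satisfy a bound uniform in \<open>R\<close>
  (\<open>apriori_bound\<close>), in which the confining sign of \<open>V'\<close> keeps the growth in time
  subexponential.  They differ by \<open>O (1 / R)\<close> from each other and from every solution of the full
  system (\<open>truncation_stability\<close>).  The first comparison gives existence, the second uniqueness.
  The solution so obtained is an explicit iterated limit of Picard iterates, and this makes it
  adapted without any completion of the filtration: the iterates at time \<open>t\<close> depend on the noise up
  to time \<open>t\<close> only and are defined for every outcome, and \<open>lim\<close> preserves measurability also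
  across the null set where \<open>Z\<close> grows too fast and the iteration may diverge.

  The growth of \<open>Z\<close> comes from its increments.  They are Gaussian, with variance at most
  \<open>4 \<bar>x - x'\<bar>\<close> in space and \<open>\<bar>t - t'\<bar>\<^sup>1\<^sup>/\<^sup>2\<close> in time, so the 32nd powers of the increments over all
  dyadic neighbours have a finite weighted sum in expectation, and a chaining argument
  turns this into a polynomial bound for \<open>Z\<close>.
\<close>

section \<open>Gaussian averages and the caloric weight\<close>

definition gauss :: "real measure" where
  "gauss = density lborel (\<lambda>z. ennreal (std_normal_density z))"

lemma sets_gauss [measurable_cong, simp]: "sets gauss = sets borel"
  by (simp add: gauss_def)

lemma space_gauss [simp]: "space gauss = UNIV"
  by (simp add: gauss_def)

interpretation gauss: prob_space gauss
  unfolding gauss_def by (rule prob_space_normal_density) simp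

text \<open>
  The time integral in Duhamel's formula is rescaled to the unit interval, so that all values of
  the Duhamel integral are integrals over one fixed probability space.  A restricted measure, rather than a
  density, makes the elapsed time lie in \<open>[0, 1]\<close> for every point of the space and not merely
  almost everywhere.
\<close>

definition unit_time :: "real measure" where
  "unit_time = restrict_space lborel {0..1}"

lemma space_unit_time [simp]: "space unit_time = {0..1}"
  by (simp add: unit_time_def space_restrict_space)

interpretation unit_time: prob_space unit_time
  by (rule prob_spaceI) (simp add: unit_time_def emeasure_restrict_space space_restrict_space)

lemma id_unit_time: "(\<lambda>r. r) \<in> borel_measurable unit_time"
  unfolding unit_time_def by (rule measurable_restrict_space1) simp

text \<open>
  The joint law of a uniformly distributed fraction of the elapsed time and a standard Gaussian
  variable.
\<close>

definition lookback_law :: "(real \<times> real) measure" where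
  "lookback_law = unit_time \<Otimes>\<^sub>M gauss"

lemma space_lookback_law [simp]: "space lookback_law = {0..1} \<times> UNIV"
  by (simp add: lookback_law_def space_pair_measure)

interpretation lookback_law_pair: pair_prob_space unit_time gauss ..

interpretation lookback_law: prob_space lookback_law
  unfolding lookback_law_def by (rule lookback_law_pair.prob_space_axioms)

lemma fst_lookback_law [measurable]: "fst \<in> borel_measurable lookback_law"
  unfolding lookback_law_def by (rule measurable_compose[OF measurable_fst id_unit_time])

lemma snd_lookback_law [measurable]: "snd \<in> borel_measurable lookback_law"
  unfolding lookback_law_def by measurable

lemma id_lookback_law: "(\<lambda>w. w) \<in> lookback_law \<rightarrow>\<^sub>M borel"
proof -
  have "(\<lambda>w. (fst w, snd w)) \<in> lookback_law \<rightarrow>\<^sub>M borel \<Otimes>\<^sub>M borel"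
    by measurable
  then show ?thesis by (simp add: borel_prod)
qed

lemma gauss_exp:
  "integrable gauss (\<lambda>z. exp (c * z))" "(\<integral>z. exp (c * z) \<partial>gauss) = exp (c\<^sup>2 / 2)"
proof -
  have *: "std_normal_density z * exp (c * z) = exp (c\<^sup>2 / 2) * normal_density c 1 z" for z
    by (simp add: normal_density_def mult_exp_exp power2_eq_square field_simps
        flip: exp_add exp_minus)
  have "integrable lborel (\<lambda>z. exp (c\<^sup>2 / 2) * normal_density c 1 z)" by simp
  then show "integrable gauss (\<lambda>z. exp (c * z))"
    unfolding gauss_def by (subst integrable_density) (simp_all add: *)
  have "(\<integral>z. exp (c * z) \<partial>gauss) = (\<integral>z. exp (c\<^sup>2 / 2) * normal_density c 1 z \<partial>lborel)"
    unfolding gauss_def by (subst integral_density) (simp_all add: *)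
  then show "(\<integral>z. exp (c * z) \<partial>gauss) = exp (c\<^sup>2 / 2)" by simp
qed

text \<open>
  \<open>exp (\<alpha>\<^sup>2 t / 2) cosh (\<alpha> x)\<close> solves the heat equation \<open>\<partial>\<^sub>t = \<partial>\<^sub>x\<^sub>x / 2\<close>.  In probabilistic
  terms this is the moment generating function of the Gaussian law.
\<close>

lemma gauss_cosh:
  assumes "0 \<le> t"
  shows "integrable gauss (\<lambda>z. cosh (\<alpha> * (x + sqrt t * z)))"
    and "(\<integral>z. cosh (\<alpha> * (x + sqrt t * z)) \<partial>gauss) = exp (\<alpha>\<^sup>2 / 2 * t) * cosh (\<alpha> * x)"
proof -
  have *: "cosh (\<alpha> * (x + sqrt t * z)) =
      exp (\<alpha> * x) / 2 * exp ((\<alpha> * sqrt t) * z) + exp (- \<alpha> * x) / 2 * exp ((- \<alpha> * sqrt t) * z)" for z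
    by (simp add: cosh_field_def algebra_simps add_divide_distrib flip: exp_add)
  show "integrable gauss (\<lambda>z. cosh (\<alpha> * (x + sqrt t * z)))"
    unfolding * by (intro Bochner_Integration.integrable_add integrable_mult_right gauss_exp)
  have "(\<integral>z. cosh (\<alpha> * (x + sqrt t * z)) \<partial>gauss) =
      exp (\<alpha> * x) / 2 * exp ((\<alpha> * sqrt t)\<^sup>2 / 2) + exp (- \<alpha> * x) / 2 * exp ((- \<alpha> * sqrt t)\<^sup>2 / 2)"
    unfolding *
    by (subst Bochner_Integration.integral_add)
       (simp_all only: gauss_exp integrable_mult_right integral_mult_right_zero)
  also have "\<dots> = exp (\<alpha>\<^sup>2 / 2 * t) * cosh (\<alpha> * x)"
    using assms by (simp add: cosh_field_def power_mult_distrib algebra_simps add_divide_distrib flip: exp_add)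
  finally show "(\<integral>z. cosh (\<alpha> * (x + sqrt t * z)) \<partial>gauss) = exp (\<alpha>\<^sup>2 / 2 * t) * cosh (\<alpha> * x)" .
qed

text \<open>
  The solution \<open>exp (\<alpha>\<^sup>2 t / 2) cosh (\<alpha> x)\<close> of the heat equation, which is comparable to the weight
  \<open>exp (\<alpha>\<^sup>2 t / 2 + \<alpha> \<bar>x\<bar>)\<close> of the spacetime norm, times an additional growth \<open>exp (B t)\<close>.
  Functions on spacetime are extended to negative times by their value at time 0, here and
  below; continuity and measurability can then be stated on the whole plane.
\<close>

definition caloric :: "real \<Rightarrow> real \<Rightarrow> real \<times> real \<Rightarrow> real" where
  "caloric \<alpha> B = (\<lambda>(x, t). exp ((\<alpha>\<^sup>2 / 2 + B) * max t 0) * cosh (\<alpha> * x))"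

lemma caloric_pos [simp]: "0 < caloric \<alpha> B p"
  by (cases p) (simp add: caloric_def cosh_real_pos)

lemma caloric_nonneg [simp]: "0 \<le> caloric \<alpha> B p"
  using caloric_pos[of \<alpha> B p] by linarith

lemma caloric_scalar_nonneg: "0 \<le> C * caloric \<alpha> B p \<Longrightarrow> 0 \<le> C"
  using caloric_pos[of \<alpha> B p] by (metis mult_neg_pos not_le)

lemma caloric_continuous [continuous_intros]: "continuous_on A (caloric \<alpha> B)"
  unfolding caloric_def case_prod_beta by (intro continuous_intros)

lemma caloric_measurable [measurable]: "caloric \<alpha> B \<in> borel_measurable borel"
  by (rule borel_measurable_continuous_onI) (rule caloric_continuous)

text \<open>
  The position of a Brownian path that runs backwards from \<open>(x, t)\<close>, after the fraction \<open>r\<close> of the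
  time \<open>t\<close>.
\<close>

definition lookback :: "real \<times> real \<Rightarrow> real \<times> real \<Rightarrow> real \<times> real" where
  "lookback = (\<lambda>(x, t) (r, z). (x + sqrt (max t 0 * r) * z, max t 0 * (1 - r)))"

lemma lookback_measurable [measurable]: "lookback p \<in> lookback_law \<rightarrow>\<^sub>M borel"
proof -
  have "continuous_on UNIV (lookback p)"
    unfolding lookback_def case_prod_beta by (intro continuous_intros)
  then have "lookback p \<in> borel \<rightarrow>\<^sub>M borel" by (rule borel_measurable_continuous_onI)
  from measurable_compose[OF id_lookback_law this] show ?thesis by simp
qed

text \<open>
  With \<open>s = t (1 - r)\<close> this is \<open>\<integral>\<^sub>0\<^sup>t exp (- K (t - s)) H\<^sub>t\<^sub>-\<^sub>s q\<^sub>s ds\<close>; see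
  \<open>duhamel_eq_set_integral\<close>.
\<close>

definition duhamel :: "real \<Rightarrow> (real \<times> real \<Rightarrow> real) \<Rightarrow> real \<times> real \<Rightarrow> real" where
  "duhamel K q p =
     max (snd p) 0 * (\<integral>w. exp (- K * max (snd p) 0 * fst w) * q (lookback p w) \<partial>lookback_law)"

lemma caloric_lookback:
  assumes "w \<in> {0..1} \<times> UNIV"
  shows "caloric \<alpha> B (lookback (x, t) w) =
    exp ((\<alpha>\<^sup>2 / 2 + B) * (max t 0 * (1 - fst w))) * cosh (\<alpha> * (x + sqrt (max t 0 * fst w) * snd w))"
proof -
  have "max (max t 0 * (1 - fst w)) 0 = max t 0 * (1 - fst w)" using assms by auto
  then show ?thesis by (simp add: caloric_def lookback_def case_prod_beta)
qed

text \<open>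
  The caloric part of the weight is invariant under the backward path, so only the factor
  \<open>exp (B t)\<close> changes.
\<close>

lemma caloric_average:
  assumes "r \<in> {0..1}"
  shows "integrable gauss (\<lambda>z. caloric \<alpha> B (lookback (x, t) (r, z)))"
    and "(\<integral>z. caloric \<alpha> B (lookback (x, t) (r, z)) \<partial>gauss) = exp (- B * max t 0 * r) * caloric \<alpha> B (x, t)"
proof -
  have "0 \<le> max t 0 * r" using assms by simp
  note c = gauss_cosh[OF this, of \<alpha> x]
  have *: "caloric \<alpha> B (lookback (x, t) (r, z)) =
    exp ((\<alpha>\<^sup>2 / 2 + B) * (max t 0 * (1 - r))) * cosh (\<alpha> * (x + sqrt (max t 0 * r) * z))" for z
    using assms by (subst caloric_lookback) auto
  show "integrable gauss (\<lambda>z. caloric \<alpha> B (lookback (x, t) (r, z)))"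
    unfolding * by (intro integrable_mult_right c)
  show "(\<integral>z. caloric \<alpha> B (lookback (x, t) (r, z)) \<partial>gauss) = exp (- B * max t 0 * r) * caloric \<alpha> B (x, t)"
    unfolding * integral_mult_right_zero c(2)
    by (simp add: caloric_def algebra_simps diff_divide_distrib flip: exp_add)
qed

lemma exp_unit_time:
  assumes "c > 0"
  shows "integrable unit_time (\<lambda>r. exp (- c * r))" "(\<integral>r. exp (- c * r) \<partial>unit_time) = (1 - exp (- c)) / c"
proof -
  have 1: "((\<lambda>r. exp (- c * r)) has_integral (- exp (- c * 1) / c - (- exp (- c * 0) / c))) {0..1}"
    using assms
    by (intro fundamental_theorem_of_calculus)
       (auto intro!: derivative_eq_intros simp flip: has_real_derivative_iff_has_vector_derivative)
  have si: "set_integrable lborel {0..1} (\<lambda>r. exp (- c * r))"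
    by (intro borel_integrable_atLeastAtMost') (intro continuous_intros)
  then show "integrable unit_time (\<lambda>r. exp (- c * r))"
    by (simp add: unit_time_def integrable_restrict_space set_integrable_def)
  have "(\<integral>r. exp (- c * r) \<partial>unit_time) = (LBINT r:{0..1}. exp (- c * r))"
    by (simp add: unit_time_def integral_restrict_space set_lebesgue_integral_def)
  also have "\<dots> = integral {0..1} (\<lambda>r. exp (- c * r))"
    by (rule set_borel_integral_eq_integral(2)[OF si])
  finally show "(\<integral>r. exp (- c * r) \<partial>unit_time) = (1 - exp (- c)) / c"
    using integral_unique[OF 1] by (simp add: diff_divide_distrib)
qed

lemma nn_integral_caloric_lookback_law:
  "(\<integral>\<^sup>+w. ennreal (caloric \<alpha> B (lookback (x, t) w)) \<partial>lookback_law) \<le> ennreal (exp (\<bar>B\<bar> * max t 0) * caloric \<alpha> B (x, t))"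
proof -
  have "(\<integral>\<^sup>+w. ennreal (caloric \<alpha> B (lookback (x, t) w)) \<partial>lookback_law)
      = (\<integral>\<^sup>+r. \<integral>\<^sup>+z. ennreal (caloric \<alpha> B (lookback (x, t) (r, z))) \<partial>gauss \<partial>unit_time)"
    unfolding lookback_law_def
  proof (subst gauss.nn_integral_fst[symmetric])
    have "(\<lambda>w. ennreal (caloric \<alpha> B (lookback (x, t) w))) \<in> borel_measurable lookback_law" by measurable
    then show "(\<lambda>w. ennreal (caloric \<alpha> B (lookback (x, t) w))) \<in> borel_measurable (unit_time \<Otimes>\<^sub>M gauss)"
      by (simp add: lookback_law_def)
  qed simp
  also have "\<dots> \<le> (\<integral>\<^sup>+r. ennreal (exp (\<bar>B\<bar> * max t 0) * caloric \<alpha> B (x, t)) \<partial>unit_time)"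
  proof (rule nn_integral_mono)
    fix r assume "r \<in> space unit_time"
    then have r: "r \<in> {0..1}" by simp
    have "(\<integral>\<^sup>+z. ennreal (caloric \<alpha> B (lookback (x, t) (r, z))) \<partial>gauss) = ennreal (exp (- B * max t 0 * r) * caloric \<alpha> B (x, t))"
      using caloric_average[OF r, of \<alpha> B x t] by (simp add: nn_integral_eq_integral)
    moreover have "- B * max t 0 * r \<le> \<bar>B\<bar> * max t 0"
    proof -
      have "- B * max t 0 * r \<le> \<bar>B * max t 0\<bar> * \<bar>r\<bar>"
        by (metis abs_ge_minus_self abs_mult minus_mult_left)
      also have "\<dots> \<le> \<bar>B * max t 0\<bar> * 1" using r by (intro mult_left_mono) auto
      finally show ?thesis by (simp add: abs_mult)
    qed
    ultimately show "(\<integral>\<^sup>+z. ennreal (caloric \<alpha> B (lookback (x, t) (r, z))) \<partial>gauss)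
        \<le> ennreal (exp (\<bar>B\<bar> * max t 0) * caloric \<alpha> B (x, t))"
      by (auto intro!: ennreal_leI mult_right_mono)
  qed
  also have "\<dots> = ennreal (exp (\<bar>B\<bar> * max t 0) * caloric \<alpha> B (x, t))"
    by (simp add: unit_time.emeasure_space_1[simplified])
  finally show ?thesis .
qed

lemma caloric_integrable_lookback_law: "integrable lookback_law (\<lambda>w. caloric \<alpha> B (lookback p w))"
  using nn_integral_caloric_lookback_law[of \<alpha> B "fst p" "snd p"]
  by (intro integrableI_nonneg) (auto intro: le_less_trans)

lemma discount_le_1:
  assumes "w \<in> space lookback_law" "K \<ge> 0"
  shows "exp (- K * max t 0 * fst w) \<le> 1"
  using assms by auto

lemma duhamel_integrable:
  assumes [measurable]: "q \<in> borel_measurable borel" and K: "K \<ge> 0"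
    and q: "\<And>y s. s \<le> max t 0 \<Longrightarrow> \<bar>q (y, s)\<bar> \<le> C * caloric \<alpha> B (y, s)"
  shows "integrable lookback_law (\<lambda>w. exp (- K * max t 0 * fst w) * q (lookback (x, t) w))"
proof (rule Bochner_Integration.integrable_bound)
  show "integrable lookback_law (\<lambda>w. C * caloric \<alpha> B (lookback (x, t) w))"
    by (intro integrable_mult_right caloric_integrable_lookback_law)
  show "AE w in lookback_law. norm (exp (- K * max t 0 * fst w) * q (lookback (x, t) w)) \<le> norm (C * caloric \<alpha> B (lookback (x, t) w))"
  proof (rule AE_I2)
    fix w assume w: "w \<in> space lookback_law"
    then have "snd (lookback (x, t) w) \<le> max t 0"
      by (auto simp: lookback_def mult_left_le)
    with q[of "snd (lookback (x, t) w)" "fst (lookback (x, t) w)"]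
    have "\<bar>q (lookback (x, t) w)\<bar> \<le> C * caloric \<alpha> B (lookback (x, t) w)" by simp
    moreover have "exp (- K * max t 0 * fst w) * \<bar>q (lookback (x, t) w)\<bar> \<le> \<bar>q (lookback (x, t) w)\<bar>"
      using discount_le_1[OF w K] by (intro mult_left_le_one_le) auto
    moreover have "C * caloric \<alpha> B (lookback (x, t) w) \<le> \<bar>C\<bar> * caloric \<alpha> B (lookback (x, t) w)"
      by (rule mult_right_mono) simp_all
    ultimately have "exp (- K * max t 0 * fst w) * \<bar>q (lookback (x, t) w)\<bar> \<le> \<bar>C\<bar> * caloric \<alpha> B (lookback (x, t) w)"
      by linarith
    then show "norm (exp (- K * max t 0 * fst w) * q (lookback (x, t) w)) \<le> norm (C * caloric \<alpha> B (lookback (x, t) w))"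
      by (simp add: abs_mult)
  qed
qed measurable

text \<open>
  This inequality replaces all kernel estimates: on a caloric weight the Duhamel operator is
  multiplication by \<open>\<integral>\<^sub>0\<^sup>t exp (- (K + B) (t - s)) ds \<le> 1 / (K + B)\<close>.
\<close>

lemma duhamel_caloric:
  assumes "K \<ge> 0" "K + B > 0"
  shows "duhamel K (caloric \<alpha> B) p \<le> caloric \<alpha> B p / (K + B)"
proof -
  obtain x t where p: "p = (x, t)" by fastforce
  let ?T = "max t 0"
  show ?thesis
  proof (cases "t \<le> 0")
    case True
    then show ?thesis using assms by (simp add: duhamel_def p)
  next
    case False
    then have T: "?T = t" "t > 0" by auto
    have int: "integrable lookback_law (\<lambda>w. exp (- K * ?T * fst w) * caloric \<alpha> B (lookback (x, t) w))"
      using assms by (intro duhamel_integrable[where C=1 and \<alpha>=\<alpha> and B=B]) auto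
    then have "(\<integral>w. exp (- K * ?T * fst w) * caloric \<alpha> B (lookback (x, t) w) \<partial>lookback_law) =
        (\<integral>r. \<integral>z. exp (- K * ?T * r) * caloric \<alpha> B (lookback (x, t) (r, z)) \<partial>gauss \<partial>unit_time)"
      unfolding lookback_law_def by (subst lookback_law_pair.integral_fst'[symmetric]) simp_all
    also have "\<dots> = (\<integral>r. caloric \<alpha> B p * exp (- ((K + B) * t) * r) \<partial>unit_time)"
      by (intro Bochner_Integration.integral_cong)
         (simp_all add: caloric_average(2) p T algebra_simps flip: exp_add)
    also have "\<dots> = caloric \<alpha> B p * ((1 - exp (- ((K + B) * t))) / ((K + B) * t))"
      using exp_unit_time[of "(K + B) * t"] T assms by simp
    finally have "duhamel K (caloric \<alpha> B) p = caloric \<alpha> B p * ((1 - exp (- ((K + B) * t))) / (K + B))"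
      using T assms by (simp add: duhamel_def p)
    also have "\<dots> \<le> caloric \<alpha> B p * (1 / (K + B))"
      using assms by (intro mult_left_mono divide_right_mono) auto
    finally show ?thesis by simp
  qed
qed

section \<open>The Duhamel operator on weighted functions\<close>

lemma snd_lookback_le: "w \<in> space lookback_law \<Longrightarrow> snd (lookback p w) \<le> max (snd p) 0"
  by (cases p; cases w) (auto simp: lookback_def mult_left_le)

lemma duhamel_mono:
  assumes [measurable]: "q \<in> borel_measurable borel" "q' \<in> borel_measurable borel" and K: "K \<ge> 0"
    and q: "\<And>y s. s \<le> max (snd p) 0 \<Longrightarrow> \<bar>q (y, s)\<bar> \<le> C * caloric \<alpha> B (y, s)"
    and q': "\<And>y s. s \<le> max (snd p) 0 \<Longrightarrow> \<bar>q' (y, s)\<bar> \<le> C' * caloric \<alpha>' B' (y, s)"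
    and le: "\<And>y s. s \<le> max (snd p) 0 \<Longrightarrow> q (y, s) \<le> q' (y, s)"
  shows "duhamel K q p \<le> duhamel K q' p"
  unfolding duhamel_def
proof (intro mult_left_mono integral_mono)
  obtain x t where p: "p = (x, t)" by fastforce
  show "integrable lookback_law (\<lambda>w. exp (- K * max (snd p) 0 * fst w) * q (lookback p w))"
    using duhamel_integrable[of q K t C \<alpha> B x] assms by (simp add: p)
  show "integrable lookback_law (\<lambda>w. exp (- K * max (snd p) 0 * fst w) * q' (lookback p w))"
    using duhamel_integrable[of q' K t C' \<alpha>' B' x] assms by (simp add: p)
  fix w assume "w \<in> space lookback_law"
  then have "snd (lookback p w) \<le> max (snd p) 0" by (rule snd_lookback_le)
  then show "q (lookback p w) \<le> q' (lookback p w)"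
    using le[of "snd (lookback p w)" "fst (lookback p w)"] by simp
qed auto

lemma duhamel_uminus: "duhamel K (\<lambda>p. - q p) p = - duhamel K q p"
  by (simp add: duhamel_def)

lemma duhamel_cmult: "duhamel K (\<lambda>p. c * q p) p = c * duhamel K q p"
  unfolding duhamel_def mult.left_commute[of _ c] integral_mult_right_zero ..

lemma abs_duhamel_le:
  assumes [measurable]: "q \<in> borel_measurable borel" "q' \<in> borel_measurable borel" and K: "K \<ge> 0"
    and q': "\<And>y s. s \<le> max (snd p) 0 \<Longrightarrow> \<bar>q' (y, s)\<bar> \<le> C' * caloric \<alpha>' B' (y, s)"
    and le: "\<And>y s. s \<le> max (snd p) 0 \<Longrightarrow> \<bar>q (y, s)\<bar> \<le> q' (y, s)"
  shows "\<bar>duhamel K q p\<bar> \<le> duhamel K q' p"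
proof -
  have q: "\<bar>q (y, s)\<bar> \<le> C' * caloric \<alpha>' B' (y, s)" if "s \<le> max (snd p) 0" for y s
    using q'[OF that, of y] le[OF that, of y] by linarith
  have "duhamel K q p \<le> duhamel K q' p"
    using le by (intro duhamel_mono[OF _ _ K q q']) (auto simp: abs_le_iff)
  moreover have "duhamel K (\<lambda>p. - q p) p \<le> duhamel K q' p"
    using q le by (intro duhamel_mono[OF _ _ K _ q', where C=C' and \<alpha>=\<alpha>' and B=B']) (auto simp: abs_le_iff)
  ultimately show ?thesis by (simp add: duhamel_uminus abs_le_iff)
qed

lemma abs_duhamel_le_caloric:
  assumes "q \<in> borel_measurable borel" "K \<ge> 0" "K + B > 0" "0 \<le> C"
    and "\<And>y s. s \<le> max (snd p) 0 \<Longrightarrow> \<bar>q (y, s)\<bar> \<le> C * caloric \<alpha> B (y, s)"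
  shows "\<bar>duhamel K q p\<bar> \<le> C / (K + B) * caloric \<alpha> B p"
proof -
  have "\<bar>duhamel K q p\<bar> \<le> duhamel K (\<lambda>p. C * caloric \<alpha> B p) p"
    using assms by (intro abs_duhamel_le[where C'=C and \<alpha>'=\<alpha> and B'=B]) (auto simp: abs_mult)
  also have "\<dots> = C * duhamel K (caloric \<alpha> B) p" by (rule duhamel_cmult)
  also have "\<dots> \<le> C * (caloric \<alpha> B p / (K + B))"
    using assms by (intro mult_left_mono duhamel_caloric)
  finally show ?thesis by simp
qed

definition weighted :: "real \<Rightarrow> real \<Rightarrow> (real \<times> real \<Rightarrow> real) set" where
  "weighted \<alpha> B = {q. continuous_on UNIV q \<and> (\<exists>C. \<forall>p. \<bar>q p\<bar> \<le> C * caloric \<alpha> B p)}"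

lemma weightedI:
  "continuous_on UNIV q \<Longrightarrow> (\<And>p. \<bar>q p\<bar> \<le> C * caloric \<alpha> B p) \<Longrightarrow> q \<in> weighted \<alpha> B"
  by (auto simp: weighted_def)

lemma weighted_continuous: "q \<in> weighted \<alpha> B \<Longrightarrow> continuous_on UNIV q"
  by (simp add: weighted_def)

lemma weighted_measurable: "q \<in> weighted \<alpha> B \<Longrightarrow> q \<in> borel_measurable borel"
  by (intro borel_measurable_continuous_onI weighted_continuous)

lemma weightedE:
  assumes "q \<in> weighted \<alpha> B"
  obtains C where "0 \<le> C" "\<And>p. \<bar>q p\<bar> \<le> C * caloric \<alpha> B p"
proof -
  from assms obtain C where C: "\<And>p. \<bar>q p\<bar> \<le> C * caloric \<alpha> B p" by (auto simp: weighted_def)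
  have "0 \<le> C" by (rule caloric_scalar_nonneg[OF order_trans[OF abs_ge_zero C]])
  with C that show thesis by blast
qed

lemma weighted_add:
  assumes "q \<in> weighted \<alpha> B" "q' \<in> weighted \<alpha> B"
  shows "(\<lambda>p. q p + q' p) \<in> weighted \<alpha> B"
proof -
  obtain C where C: "\<And>p. \<bar>q p\<bar> \<le> C * caloric \<alpha> B p" using weightedE[OF assms(1)] by blast
  obtain C' where C': "\<And>p. \<bar>q' p\<bar> \<le> C' * caloric \<alpha> B p" using weightedE[OF assms(2)] by blast
  show ?thesis
  proof (rule weightedI)
    show "continuous_on UNIV (\<lambda>p. q p + q' p)"
      using assms by (intro continuous_intros weighted_continuous)
    show "\<bar>q p + q' p\<bar> \<le> (C + C') * caloric \<alpha> B p" for p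
      using C[of p] C'[of p] by (simp add: distrib_right)
  qed
qed

lemma weighted_cmult:
  assumes "q \<in> weighted \<alpha> B"
  shows "(\<lambda>p. c * q p) \<in> weighted \<alpha> B"
proof -
  obtain C where C: "\<And>p. \<bar>q p\<bar> \<le> C * caloric \<alpha> B p" using weightedE[OF assms(1)] by blast
  show ?thesis
  proof (rule weightedI)
    show "continuous_on UNIV (\<lambda>p. c * q p)"
      using assms by (intro continuous_intros weighted_continuous)
    show "\<bar>c * q p\<bar> \<le> (\<bar>c\<bar> * C) * caloric \<alpha> B p" for p
      using mult_left_mono[OF C[of p], of "\<bar>c\<bar>"] by (simp add: abs_mult mult.assoc)
  qed
qed

lemma weighted_diff:
  assumes "q \<in> weighted \<alpha> B" "q' \<in> weighted \<alpha> B"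
  shows "(\<lambda>p. q p - q' p) \<in> weighted \<alpha> B"
  using weighted_add[OF assms(1) weighted_cmult[OF assms(2), of "-1"]] by simp

text \<open>
  Used for Lipschitz functions of a weighted function.
\<close>

lemma weighted_dominated:
  assumes "q \<in> weighted \<alpha> B" "continuous_on UNIV q'" "\<And>p. \<bar>q' p\<bar> \<le> c * \<bar>q p\<bar>" 
  shows "q' \<in> weighted \<alpha> B"
proof -
  obtain C where C: "\<And>p. \<bar>q p\<bar> \<le> C * caloric \<alpha> B p" using weightedE[OF assms(1)] by blast
  show ?thesis
  proof (rule weightedI[OF assms(2)])
    fix p
    have "\<bar>q' p\<bar> \<le> \<bar>c\<bar> * \<bar>q p\<bar>"
      using assms(3)[of p] mult_right_mono[of c "\<bar>c\<bar>" "\<bar>q p\<bar>"] by linarith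
    also have "\<dots> \<le> \<bar>c\<bar> * (C * caloric \<alpha> B p)" by (intro mult_left_mono C) simp
    finally show "\<bar>q' p\<bar> \<le> (\<bar>c\<bar> * C) * caloric \<alpha> B p" by simp
  qed
qed

lemma weighted_abs:
  assumes "q \<in> weighted \<alpha> B" shows "(\<lambda>p. \<bar>q p\<bar>) \<in> weighted \<alpha> B"
  by (rule weighted_dominated[OF assms, where c=1])
     (auto intro!: continuous_intros weighted_continuous[OF assms])

lemma weighted_caloric: "caloric \<alpha> B \<in> weighted \<alpha> B"
  by (rule weightedI[where C=1]) (auto intro: continuous_intros)

lemma caloric_mono: "B \<le> B' \<Longrightarrow> caloric \<alpha> B p \<le> caloric \<alpha> B' p"
  by (cases p) (auto simp: caloric_def intro!: mult_right_mono)

lemma weighted_mono: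
  assumes "q \<in> weighted \<alpha> B" "B \<le> B'"
  shows "q \<in> weighted \<alpha> B'"
proof -
  obtain C where C: "0 \<le> C" "\<And>p. \<bar>q p\<bar> \<le> C * caloric \<alpha> B p" using weightedE[OF assms(1)] by blast
  show ?thesis
    by (rule weightedI[OF weighted_continuous[OF assms(1)]])
       (rule order_trans[OF C(2) mult_left_mono[OF caloric_mono[OF assms(2)] C(1)]])
qed

lemma weighted_integrable:
  assumes "q \<in> weighted \<alpha> B" "K \<ge> 0"
  shows "integrable lookback_law (\<lambda>w. exp (- K * max (snd p) 0 * fst w) * q (lookback p w))"
proof -
  obtain C where C: "\<And>p. \<bar>q p\<bar> \<le> C * caloric \<alpha> B p" using weightedE[OF assms(1)] by blast
  show ?thesis
    using duhamel_integrable[OF weighted_measurable[OF assms(1)] assms(2) C, of "snd p" "fst p"] by simp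
qed

lemma duhamel_add:
  assumes "q \<in> weighted \<alpha> B" "q' \<in> weighted \<alpha> B" "K \<ge> 0"
  shows "duhamel K (\<lambda>p. q p + q' p) p = duhamel K q p + duhamel K q' p"
  using assms weighted_integrable[of _ \<alpha> B K p]
  by (simp add: duhamel_def distrib_left)

lemma duhamel_diff:
  assumes "q \<in> weighted \<alpha> B" "q' \<in> weighted \<alpha> B" "K \<ge> 0"
  shows "duhamel K (\<lambda>p. q p - q' p) p = duhamel K q p - duhamel K q' p"
  using duhamel_add[OF assms(1) weighted_cmult[OF assms(2), of "-1"] assms(3)] duhamel_uminus[of K q' p] by simp

lemma duhamel_tendsto:
  assumes q: "\<And>n. q n \<in> borel_measurable borel" "K \<ge> 0"
    and bound: "\<And>n p. \<bar>q n p\<bar> \<le> C * caloric \<alpha> B p"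
    and lim: "\<And>p. (\<lambda>n. q n p) \<longlonglongrightarrow> q' p"
  shows "(\<lambda>n. duhamel K (q n) p) \<longlonglongrightarrow> duhamel K q' p"
  unfolding duhamel_def
proof (intro tendsto_mult_left integral_dominated_convergence[where w="\<lambda>w. C * caloric \<alpha> B (lookback p w)"])
  note [measurable] = q(1)
  have [measurable]: "q' \<in> borel_measurable borel"
    by (rule borel_measurable_LIMSEQ_real[OF lim q(1)])
  show "(\<lambda>w. exp (- K * max (snd p) 0 * fst w) * q' (lookback p w)) \<in> borel_measurable lookback_law"
    by measurable
  show "(\<lambda>w. exp (- K * max (snd p) 0 * fst w) * q n (lookback p w)) \<in> borel_measurable lookback_law" for n
    by measurable
  show "integrable lookback_law (\<lambda>w. C * caloric \<alpha> B (lookback p w))"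
    by (intro integrable_mult_right caloric_integrable_lookback_law)
  show "AE w in lookback_law. (\<lambda>n. exp (- K * max (snd p) 0 * fst w) * q n (lookback p w))
      \<longlonglongrightarrow> exp (- K * max (snd p) 0 * fst w) * q' (lookback p w)"
    by (intro AE_I2 tendsto_intros lim)
  show "AE w in lookback_law. norm (exp (- K * max (snd p) 0 * fst w) * q n (lookback p w)) \<le> C * caloric \<alpha> B (lookback p w)" for n
  proof (rule AE_I2)
    fix w assume w: "w \<in> space lookback_law"
    have "exp (- K * max (snd p) 0 * fst w) * \<bar>q n (lookback p w)\<bar> \<le> \<bar>q n (lookback p w)\<bar>"
      using discount_le_1[OF w q(2)] by (intro mult_left_le_one_le) auto
    with bound[of n "lookback p w"]
    show "norm (exp (- K * max (snd p) 0 * fst w) * q n (lookback p w)) \<le> C * caloric \<alpha> B (lookback p w)"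
      by (simp add: abs_mult)
  qed
qed

section \<open>Continuity of the heat semigroup and of the Duhamel operator\<close>

text \<open>
  The heat semigroup as a Gaussian average.  Unlike the formula with the kernel, it needs no case
  distinction at time 0, and its dependence on time is continuous under the integral sign.
\<close>

definition heat :: "real \<Rightarrow> (real \<Rightarrow> real) \<Rightarrow> real \<Rightarrow> real" where
  "heat a f x = (\<integral>z. f (x + sqrt (max a 0) * z) \<partial>gauss)"

lemma cosh_le_exp_abs: "cosh (c::real) \<le> exp \<bar>c\<bar>"
  by (cases "c \<ge> 0") (auto simp: cosh_def)

text \<open>
  Dominated convergence along a sequence: on a bounded set of parameters, the integrand is
  dominated by a multiple of \<open>exp (c z) + exp (- c z)\<close>, which is integrable for the Gaussian law.
\<close>

lemma continuous_on_heat: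
  assumes c: "continuous_on UNIV q"
    and bound: "\<And>p. \<bar>q p\<bar> \<le> C * caloric \<alpha> B p"
  shows "continuous_on UNIV (\<lambda>(a, s, x). heat a (\<lambda>y. q (y, s)) x)"
proof (rule continuous_on_sequentiallyI)
  fix u :: "nat \<Rightarrow> real \<times> real \<times> real" and p
  assume u: "u \<longlonglongrightarrow> p"
  have [measurable]: "q \<in> borel_measurable borel" by (rule borel_measurable_continuous_onI[OF c])
  have C0: "0 \<le> C"
    by (rule caloric_scalar_nonneg[OF order_trans[OF abs_ge_zero bound]])
  obtain R where R: "R > 0" "\<And>n. norm (u n) \<le> R"
    using convergent_imp_Bseq[OF convergentI[OF u]] by (auto elim: BseqE)
  let ?h = "\<lambda>(a, s, x) z. q (x + sqrt (max a 0) * z, s)"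
  let ?G = "\<lambda>z. C * (exp ((\<alpha>\<^sup>2 / 2 + \<bar>B\<bar>) * R) * exp (\<bar>\<alpha>\<bar> * R)) *
     (exp ((\<bar>\<alpha>\<bar> * sqrt R) * z) + exp ((- (\<bar>\<alpha>\<bar> * sqrt R)) * z))"
  have "(\<lambda>n. \<integral>z. ?h (u n) z \<partial>gauss) \<longlonglongrightarrow> (\<integral>z. ?h p z \<partial>gauss)"
  proof (rule integral_dominated_convergence[where w="?G"])
    show "integrable gauss ?G"
      by (intro integrable_mult_right Bochner_Integration.integrable_add gauss_exp)
    have "continuous_on UNIV (\<lambda>p. ?h p z)" for z
      unfolding case_prod_beta by (intro continuous_intros continuous_on_compose2[OF c]) auto
    then show "AE z in gauss. (\<lambda>n. ?h (u n) z) \<longlonglongrightarrow> ?h p z"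
      using u unfolding continuous_on_sequentially o_def by (intro AE_I2) blast
    show "AE z in gauss. norm (?h (u n) z) \<le> ?G z" for n
    proof (rule AE_I2)
      fix z :: real
      obtain a s x where un: "u n = (a, s, x)" by (cases "u n") auto
      have R': "\<bar>a\<bar> \<le> R" "\<bar>s\<bar> \<le> R" "\<bar>x\<bar> \<le> R"
        using R(2)[of n] norm_fst_le[of a "(s, x)"] norm_snd_le[of "(s, x)" a]
          norm_fst_le[of s x] norm_snd_le[of x s] by (auto simp: un)
      then have T: "0 \<le> max a 0" "max a 0 \<le> R" "0 \<le> max s 0" "max s 0 \<le> R" using R(1) by auto
      let ?y = "x + sqrt (max a 0) * z"
      have "(\<alpha>\<^sup>2 / 2 + B) * max s 0 \<le> (\<alpha>\<^sup>2 / 2 + \<bar>B\<bar>) * R"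
        using T by (intro mult_mono) auto
      then have e2: "exp ((\<alpha>\<^sup>2 / 2 + B) * max s 0) \<le> exp ((\<alpha>\<^sup>2 / 2 + \<bar>B\<bar>) * R)" by simp
      have "\<bar>\<alpha> * ?y\<bar> \<le> \<bar>\<alpha>\<bar> * (R + sqrt R * \<bar>z\<bar>)"
      proof -
        have "\<bar>sqrt (max a 0) * z\<bar> \<le> sqrt R * \<bar>z\<bar>"
          using T by (simp add: abs_mult mult_right_mono)
        then have "\<bar>?y\<bar> \<le> R + sqrt R * \<bar>z\<bar>"
          using R'(3) abs_triangle_ineq[of x "sqrt (max a 0) * z"] by linarith
        then show ?thesis
          unfolding abs_mult by (intro mult_left_mono) auto
      qed
      then have "cosh (\<alpha> * ?y) \<le> exp (\<bar>\<alpha>\<bar> * (R + sqrt R * \<bar>z\<bar>))"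
        by (intro order_trans[OF cosh_le_exp_abs]) simp
      also have "\<dots> = exp (\<bar>\<alpha>\<bar> * R) * exp ((\<bar>\<alpha>\<bar> * sqrt R) * \<bar>z\<bar>)"
        by (simp add: algebra_simps flip: exp_add)
      also have "\<dots> \<le> exp (\<bar>\<alpha>\<bar> * R) * (exp ((\<bar>\<alpha>\<bar> * sqrt R) * z) + exp ((- (\<bar>\<alpha>\<bar> * sqrt R)) * z))"
        by (intro mult_left_mono) (cases "z \<ge> 0"; simp)+
      finally have e3: "cosh (\<alpha> * ?y) \<le> \<dots>" .
      have "\<bar>?h (u n) z\<bar> \<le> C * (exp ((\<alpha>\<^sup>2 / 2 + B) * max s 0) * cosh (\<alpha> * ?y))"
        using bound[of "(?y, s)"] by (simp add: caloric_def un)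
      also have "\<dots> \<le> C * (exp ((\<alpha>\<^sup>2 / 2 + \<bar>B\<bar>) * R) * (exp (\<bar>\<alpha>\<bar> * R) *
          (exp ((\<bar>\<alpha>\<bar> * sqrt R) * z) + exp ((- (\<bar>\<alpha>\<bar> * sqrt R)) * z))))"
        using C0 e2 e3 by (intro mult_left_mono mult_mono) auto
      finally show "norm (?h (u n) z) \<le> ?G z" by (simp only: mult.assoc real_norm_def)
    qed
    show "?h p \<in> borel_measurable gauss"
      unfolding case_prod_beta by measurable
    show "?h (u n) \<in> borel_measurable gauss" for n
      unfolding case_prod_beta by measurable
  qed
  then show "(\<lambda>n. case u n of (a, s, x) \<Rightarrow> heat a (\<lambda>y. q (y, s)) x)
      \<longlonglongrightarrow> (case p of (a, s, x) \<Rightarrow> heat a (\<lambda>y. q (y, s)) x)"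
    by (simp add: heat_def case_prod_beta)
qed

lemma continuous_on_heat_compose:
  assumes "q \<in> weighted \<alpha> B" "continuous_on S a" "continuous_on S s" "continuous_on S x"
  shows "continuous_on S (\<lambda>p. heat (a p) (\<lambda>y. q (y, s p)) (x p))"
proof -
  obtain C where C: "\<And>p. \<bar>q p\<bar> \<le> C * caloric \<alpha> B p" using weightedE[OF assms(1)] by blast
  from continuous_on_compose2[OF continuous_on_heat[OF weighted_continuous[OF assms(1)] C],
      of S "\<lambda>p. (a p, s p, x p)"] assms(2-4)
  show ?thesis by (simp add: continuous_on_Pair)
qed

text \<open>
  Fubini's theorem separates the elapsed time from the Gaussian variable; what remains is an
  integral over a compact interval of a jointly continuous function.
\<close>

lemma duhamel_iterated:
  assumes "q \<in> weighted \<alpha> B" "K \<ge> 0"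
  shows "duhamel K q (x, t) = max t 0 *
    (\<integral>r. exp (- K * max t 0 * r) * heat (max t 0 * r) (\<lambda>y. q (y, max t 0 * (1 - r))) x \<partial>unit_time)"
proof -
  have "(\<integral>w. exp (- K * max t 0 * fst w) * q (lookback (x, t) w) \<partial>lookback_law) =
      (\<integral>r. \<integral>z. exp (- K * max t 0 * r) * q (lookback (x, t) (r, z)) \<partial>gauss \<partial>unit_time)"
    using weighted_integrable[OF assms, of "(x, t)"]
    unfolding lookback_law_def by (subst lookback_law_pair.integral_fst'[symmetric]) simp_all
  also have "\<dots> = (\<integral>r. exp (- K * max t 0 * r) * heat (max t 0 * r) (\<lambda>y. q (y, max t 0 * (1 - r))) x \<partial>unit_time)"
  proof (intro Bochner_Integration.integral_cong refl)
    fix r assume "r \<in> space unit_time"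
    then have "max (max t 0 * r) 0 = max t 0 * r" by auto
    then show "(\<integral>z. exp (- K * max t 0 * r) * q (lookback (x, t) (r, z)) \<partial>gauss) =
        exp (- K * max t 0 * r) * heat (max t 0 * r) (\<lambda>y. q (y, max t 0 * (1 - r))) x"
      by (simp add: heat_def lookback_def)
  qed
  finally show ?thesis by (simp add: duhamel_def)
qed

lemma integral_unit_time:
  fixes g :: "real \<Rightarrow> real"
  assumes "continuous_on {0..1} g"
  shows "(\<integral>r. g r \<partial>unit_time) = integral {0..1} g"
  using set_borel_integral_eq_integral(2)[OF borel_integrable_atLeastAtMost'[OF assms]]
  by (simp add: unit_time_def integral_restrict_space set_lebesgue_integral_def)

lemma duhamel_continuous:
  assumes "q \<in> weighted \<alpha> B" "K \<ge> 0"
  shows "continuous_on UNIV (duhamel K q)"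
proof -
  let ?g = "\<lambda>(x, t) r. exp (- K * max t 0 * r) * heat (max t 0 * r) (\<lambda>y. q (y, max t 0 * (1 - r))) x"
  have "duhamel K q p = max (snd p) 0 * integral (cbox 0 1) (?g p)" for p
  proof -
    have "continuous_on {0..1} (?g p)"
      unfolding case_prod_beta by (intro continuous_intros continuous_on_heat_compose[OF assms(1)])
    from integral_unit_time[OF this] duhamel_iterated[OF assms, of "fst p" "snd p"]
    show ?thesis by (simp add: case_prod_beta cbox_interval)
  qed
  moreover have "continuous_on UNIV (\<lambda>p. integral (cbox 0 1) (?g p))"
  proof (rule integral_continuous_on_param)
    show "continuous_on (UNIV \<times> cbox 0 1) (\<lambda>(p, r). ?g p r)"
      unfolding case_prod_beta by (intro continuous_intros continuous_on_heat_compose[OF assms(1)])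
  qed
  ultimately show ?thesis by (simp add: continuous_intros)
qed

lemma duhamel_weighted:
  assumes "q \<in> weighted \<alpha> B" "K \<ge> 0" "K + B > 0"
  shows "duhamel K q \<in> weighted \<alpha> B"
proof -
  obtain C where C: "0 \<le> C" "\<And>p. \<bar>q p\<bar> \<le> C * caloric \<alpha> B p" using weightedE[OF assms(1)] by blast
  show ?thesis
    using abs_duhamel_le_caloric[OF weighted_measurable[OF assms(1)] assms(2,3) C]
    by (intro weightedI[OF duhamel_continuous[OF assms(1,2)], where C="C / (K + B)"])
qed

section \<open>A comparison principle for discounted inequalities\<close>

text \<open>
  Let \<open>M\<close> be the smallest constant with \<open>U \<le> M\<close> times the weight up to a fixed time.  Inserting
  this bound on the right improves it to \<open>((K + A) M + F) / (K + B)\<close>, and since \<open>M\<close> is smallest,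
  \<open>M \<le> F / (B - A)\<close>.  The growth \<open>B0\<close> makes \<open>M\<close> finite on bounded time
  intervals, and neither it nor \<open>K\<close> enters the result.
\<close>

lemma duhamel_comparison:
  assumes U: "U \<in> weighted \<alpha> B0" "\<And>p. 0 \<le> U p"
    and F0: "0 \<le> F" and AB: "0 \<le> K" "0 \<le> A" "A < B"
    and sub: "\<And>p. U p \<le> duhamel K (\<lambda>p. (K + A) * U p + F * caloric \<alpha> B p) p"
  shows "U p \<le> F / (B - A) * caloric \<alpha> B p"
proof -
  obtain C where C: "0 \<le> C" "\<And>p. \<bar>U p\<bar> \<le> C * caloric \<alpha> B0 p" using weightedE[OF U(1)] by blast
  have [measurable]: "U \<in> borel_measurable borel"
    by (rule weighted_measurable[OF U(1)])
  define T where "T = max (snd p) 0"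
  define S where "S = {p :: real \<times> real. snd p \<le> T}"
  \<comment> \<open>The supremum is taken over bounded times, where all rates \<open>B\<close> give equivalent weights.\<close>
  define M where "M = (SUP p\<in>S. U p / caloric \<alpha> B p)"
  have bdd: "bdd_above ((\<lambda>p. U p / caloric \<alpha> B p) ` S)"
  proof (rule bdd_aboveI2)
    fix p' assume "p' \<in> S"
    then obtain x t where p': "p' = (x, t)" "t \<le> T" by (cases p') (auto simp: S_def)
    have "caloric \<alpha> B0 p' = exp ((B0 - B) * max t 0) * caloric \<alpha> B p'"
      by (simp add: p' caloric_def algebra_simps flip: exp_add)
    also have "\<dots> \<le> exp (\<bar>B0 - B\<bar> * T) * caloric \<alpha> B p'"
    proof -
      have "(B0 - B) * max t 0 \<le> \<bar>B0 - B\<bar> * T"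
        using p' by (intro mult_mono) (auto simp: T_def)
      then show ?thesis by (intro mult_right_mono) auto
    qed
    finally have "U p' \<le> C * (exp (\<bar>B0 - B\<bar> * T) * caloric \<alpha> B p')"
      using C(2)[of p'] mult_left_mono[OF _ C(1)] by (meson abs_ge_self order_trans)
    then show "U p' / caloric \<alpha> B p' \<le> C * exp (\<bar>B0 - B\<bar> * T)"
      by (simp add: divide_le_eq mult.assoc)
  qed
  have pS: "p \<in> S" by (simp add: S_def T_def)
  have UM: "U p' \<le> M * caloric \<alpha> B p'" if "p' \<in> S" for p'
    using cSUP_upper[OF that bdd] by (simp add: M_def divide_le_eq)
  have M0: "0 \<le> M"
    using UM[OF pS] U(2)[of p] by (metis mult_le_0_iff not_le order_trans caloric_pos le_less_trans mult_neg_pos)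
  have step: "U p' / caloric \<alpha> B p' \<le> ((K + A) * M + F) / (K + B)" if "p' \<in> S" for p'
  proof -
    have "U p' \<le> duhamel K (\<lambda>p. (K + A) * U p + F * caloric \<alpha> B p) p'" by (rule sub)
    also have "\<dots> \<le> \<bar>duhamel K (\<lambda>p. (K + A) * U p + F * caloric \<alpha> B p) p'\<bar>" by simp
    also have "\<dots> \<le> ((K + A) * M + F) / (K + B) * caloric \<alpha> B p'"
    proof (rule abs_duhamel_le_caloric)
      fix y s assume "s \<le> max (snd p') 0"
      then have "(y, s) \<in> S" using that by (auto simp: S_def T_def)
      from UM[OF this] have "(K + A) * U (y, s) \<le> (K + A) * (M * caloric \<alpha> B (y, s))"
        using AB by (intro mult_left_mono) auto
      with F0 U(2)[of "(y, s)"] AB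
      show "\<bar>(K + A) * U (y, s) + F * caloric \<alpha> B (y, s)\<bar> \<le> ((K + A) * M + F) * caloric \<alpha> B (y, s)"
        by (simp add: distrib_right mult.assoc)
    qed (use AB M0 F0 in auto)
    finally show ?thesis by (simp add: divide_le_eq)
  qed
  have "M \<le> ((K + A) * M + F) / (K + B)"
    unfolding M_def by (rule cSUP_least) (use pS step in \<open>auto simp: M_def\<close>)
  then have "M * (K + B) \<le> (K + A) * M + F" using AB by (simp add: le_divide_eq)
  then have "M \<le> F / (B - A)" using AB by (simp add: le_divide_eq algebra_simps)
  then show ?thesis
    using UM[OF pS] mult_right_mono[OF _ caloric_nonneg[of \<alpha> B p], of M "F / (B - A)"] by linarith
qed

section \<open>The semigroup property and the discount formula\<close>

text \<open>
  Substitution \<open>y = x + sqrt t z\<close> in the integral against the heat kernel.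
\<close>

lemma heat_semigroup_eq_heat:
  assumes [measurable]: "f \<in> borel_measurable borel" and "t \<ge> 0"
  shows "heat_semigroup t f x = heat t f x"
proof (cases "t = 0")
  case True
  then show ?thesis
    using gauss.prob_space by (simp add: heat_semigroup_def heat_def)
next
  case False
  with assms have t: "t > 0" by simp
  have "(LBINT y. heat_kernel t x y * f y)
      = sqrt t * (LBINT z. heat_kernel t x (x + sqrt t * z) * f (x + sqrt t * z))"
    using t by (subst lborel_integral_real_affine[where t=x and c="sqrt t"]) auto
  also have "\<dots> = (LBINT z. std_normal_density z * f (x + sqrt t * z))"
  proof (subst integral_mult_right_zero[symmetric], rule Bochner_Integration.integral_cong[OF refl])
    fix z
    have "(2 * pi * t) powr (- 1 / 2) = inverse ((2 * pi * t) powr (1 / 2))"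
      by (metis minus_divide_left powr_minus)
    also have "\<dots> = inverse (sqrt (2 * pi * t))" using t by (subst powr_half_sqrt) auto
    also have "\<dots> = 1 / (sqrt (2 * pi) * sqrt t)" by (simp only: real_sqrt_mult inverse_eq_divide)
    finally have c: "(2 * pi * t) powr (- 1 / 2) = 1 / (sqrt (2 * pi) * sqrt t)" .
    have "(x - (x + sqrt t * z))\<^sup>2 = t * z\<^sup>2" using t by (simp add: power_mult_distrib)
    then have e: "sqrt t * heat_kernel t x (x + sqrt t * z) = std_normal_density z"
      using t unfolding heat_kernel_def c by (simp add: normal_density_def)
    show "sqrt t * (heat_kernel t x (x + sqrt t * z) * f (x + sqrt t * z)) =
        std_normal_density z * f (x + sqrt t * z)"
      unfolding e[symmetric] by (rule mult.assoc[symmetric])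
  qed
  also have "\<dots> = integral\<^sup>L gauss (\<lambda>z. f (x + sqrt t * z))"
    unfolding gauss_def by (subst integral_density) auto
  finally show ?thesis
    using t by (simp add: heat_semigroup_def heat_def)
qed

lemma set_integral_unit_time:
  fixes g :: "real \<Rightarrow> real"
  assumes "0 \<le> t"
  shows "(LBINT s:{0..t}. g s) = t * (\<integral>r. g (t * (1 - r)) \<partial>unit_time)"
proof (cases "t = 0")
  case True
  have "(LBINT s:{0..0}. g s) = 0"
    unfolding set_lebesgue_integral_def
    by (rule integral_eq_zero_AE, rule AE_mp[OF AE_lborel_singleton[of 0]]) (auto simp: indicator_def)
  with True show ?thesis by simp
next
  case False
  with assms have t: "t > 0" by simp
  have "(LBINT s:{0..t}. g s) = t * (LBINT r. indicator {0..t} (t + (- t) * r) *\<^sub>R g (t + (- t) * r))"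
    unfolding set_lebesgue_integral_def
    using t by (subst lborel_integral_real_affine[where t=t and c="-t"]) auto
  also have "\<dots> = t * (LBINT r:{0..1}. g (t + (- t) * r))"
  proof -
    have "t + (- t) * r \<in> {0..t} \<longleftrightarrow> r \<in> {0..1}" for r
      using t by (auto simp: zero_le_mult_iff)
    then show ?thesis by (simp add: set_lebesgue_integral_def indicator_def)
  qed
  also have "(LBINT r:{0..1}. g (t + (- t) * r)) = (\<integral>r. g (t * (1 - r)) \<partial>unit_time)"
    by (simp add: unit_time_def integral_restrict_space set_lebesgue_integral_def algebra_simps)
  finally show ?thesis .
qed

lemma duhamel_eq_set_integral:
  assumes "q \<in> weighted \<alpha> B" "K \<ge> 0" "t \<ge> 0"
  shows "duhamel K q (x, t) = (LBINT s:{0..t}. exp (- K * (t - s)) * heat (t - s) (\<lambda>y. q (y, s)) x)"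
  unfolding set_integral_unit_time[OF assms(3)] duhamel_iterated[OF assms(1,2)]
  using assms(3) by (simp add: algebra_simps)

lemma distr_gauss_scale:
  assumes "a > 0"
  shows "distr gauss borel (\<lambda>z. sqrt a * z) = density lborel (\<lambda>z. ennreal (normal_density 0 (sqrt a) z))"
proof -
  have "distributed gauss lborel (\<lambda>z. z) (\<lambda>z. ennreal (std_normal_density z))"
    using distr_id2[of borel gauss] by (simp add: distributed_def gauss_def cong: distr_cong)
  from gauss.normal_density_affine[OF this, of "sqrt a" 0] assms
  have "distributed gauss lborel (\<lambda>z. sqrt a * z) (\<lambda>z. ennreal (normal_density 0 (sqrt a) z))"
    by simp
  then show ?thesis
    by (simp add: distributed_def cong: distr_cong)
qed

text \<open>
  A sum of independent centred Gaussian variables is Gaussian and the variances add up.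
\<close>

lemma distr_gauss_sum:
  assumes "0 \<le> a" "0 \<le> b"
  shows "distr (gauss \<Otimes>\<^sub>M gauss) borel (\<lambda>(z, z'). sqrt a * z + sqrt b * z') =
    distr gauss borel (\<lambda>z. sqrt (a + b) * z)"
proof -
  interpret gg: pair_prob_space gauss gauss ..
  \<comment> \<open>A vanishing variance is a Dirac mass, which has no density and is treated apart.\<close>
  consider "a = 0" | "b = 0" | "a > 0" "b > 0" using assms by force
  then show ?thesis
  proof cases
    case 1
    have "distr (gauss \<Otimes>\<^sub>M gauss) borel (\<lambda>(z, z'). sqrt a * z + sqrt b * z')
      = distr (distr (gauss \<Otimes>\<^sub>M gauss) gauss snd) borel (\<lambda>z. sqrt b * z)"
      using 1 by (subst distr_distr) (auto simp: comp_def case_prod_unfold)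
    also have "distr (gauss \<Otimes>\<^sub>M gauss) gauss snd = gauss"
    proof (rule measure_eqI)
      fix A assume "A \<in> sets (distr (gauss \<Otimes>\<^sub>M gauss) gauss snd)"
      then have A: "A \<in> sets gauss" by simp
      have "snd -` A \<inter> space (gauss \<Otimes>\<^sub>M gauss) = space gauss \<times> A"
        by (auto simp: space_pair_measure)
      with A show "emeasure (distr (gauss \<Otimes>\<^sub>M gauss) gauss snd) A = emeasure gauss A"
        by (simp only: emeasure_distr[OF measurable_snd A] gauss.emeasure_pair_measure_Times
            sets.top gauss.emeasure_space_1 mult_1)
    qed simp
    finally show ?thesis using 1 by simp
  next
    case 2
    have "distr (gauss \<Otimes>\<^sub>M gauss) borel (\<lambda>(z, z'). sqrt a * z + sqrt b * z')
      = distr (distr (gauss \<Otimes>\<^sub>M gauss) gauss fst) borel (\<lambda>z. sqrt a * z)"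
      using 2 by (subst distr_distr) (auto simp: comp_def case_prod_unfold)
    also have "distr (gauss \<Otimes>\<^sub>M gauss) gauss fst = gauss"
      by (rule gauss.distr_pair_fst)
    finally show ?thesis using 2 by simp
  next
    case 3
    let ?n = "\<lambda>a. density lborel (\<lambda>z. ennreal (normal_density 0 (sqrt a) z))"
    have "distr (gauss \<Otimes>\<^sub>M gauss) borel (\<lambda>(z, z'). sqrt a * z + sqrt b * z')
      = distr (distr gauss borel (\<lambda>z. sqrt a * z) \<Otimes>\<^sub>M distr gauss borel (\<lambda>z. sqrt b * z)) borel (\<lambda>(u, v). u + v)"
      by (subst pair_measure_distr)
         (auto simp: distr_distr comp_def case_prod_unfold intro!: finite_measure.sigma_finite_measure gauss.finite_measure_distr)
    also have "\<dots> = convolution (?n a) (?n b)"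
      using 3 by (simp add: distr_gauss_scale convolution_def)
    also have "\<dots> = density lborel (\<lambda>x. \<integral>\<^sup>+y. ennreal (normal_density 0 (sqrt a) (x - y)) * ennreal (normal_density 0 (sqrt b) y) \<partial>lborel)"
      using 3 by (intro convolution_density)
        (auto intro!: prob_space.finite_measure prob_space_normal_density)
    also have "\<dots> = ?n (a + b)"
      using conv_normal_density_zero_mean[of "sqrt a" "sqrt b"] 3
      by (simp add: ennreal_mult'[symmetric] fun_eq_iff)
    also have "\<dots> = distr gauss borel (\<lambda>z. sqrt (a + b) * z)"
      using 3 by (simp add: distr_gauss_scale)
    finally show ?thesis .
  qed
qed

lemma heat_semigroup_property:
  assumes f[measurable]: "f \<in> borel_measurable borel" and a: "0 \<le> a" and b: "0 \<le> b"
    and bound: "\<And>y. \<bar>f y\<bar> \<le> C * cosh (\<alpha> * y)"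
  shows "heat b (heat a f) x = heat (a + b) f x"
proof -
  have C: "0 \<le> C"
    using order_trans[OF abs_ge_zero bound[of 0]] by simp
  interpret gg: pair_prob_space gauss gauss ..
  have "integrable gauss (\<lambda>z. f (x + sqrt (a + b) * z))"
  proof (rule Bochner_Integration.integrable_bound)
    show "integrable gauss (\<lambda>z. C * cosh (\<alpha> * (x + sqrt (a + b) * z)))"
      using a b by (intro integrable_mult_right gauss_cosh) simp
    show "AE z in gauss. norm (f (x + sqrt (a + b) * z)) \<le> norm (C * cosh (\<alpha> * (x + sqrt (a + b) * z)))"
    proof (rule AE_I2)
      fix z show "norm (f (x + sqrt (a + b) * z)) \<le> norm (C * cosh (\<alpha> * (x + sqrt (a + b) * z)))"
        unfolding real_norm_def by (rule order_trans[OF bound abs_ge_self])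
    qed
  qed measurable
  then have "integrable (distr gauss borel (\<lambda>z. sqrt (b + a) * z)) (\<lambda>u. f (x + u))"
    by (subst integrable_distr_eq) (simp_all add: add.commute)
  then have int: "integrable (gauss \<Otimes>\<^sub>M gauss) (\<lambda>(z, z'). f (x + (sqrt b * z + sqrt a * z')))"
    unfolding distr_gauss_sum[OF b a, symmetric]
    by (subst (asm) integrable_distr_eq) (simp_all add: case_prod_unfold)
  have "heat b (heat a f) x = (\<integral>z. \<integral>z'. f (x + (sqrt b * z + sqrt a * z')) \<partial>gauss \<partial>gauss)"
    using a b by (simp add: heat_def add.assoc)
  also have "\<dots> = (\<integral>(z, z'). f (x + (sqrt b * z + sqrt a * z')) \<partial>(gauss \<Otimes>\<^sub>M gauss))"
    using gg.integral_fst[OF int] by simp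
  also have "\<dots> = (\<integral>u. f (x + u) \<partial>distr (gauss \<Otimes>\<^sub>M gauss) borel (\<lambda>(z, z'). sqrt b * z + sqrt a * z'))"
    by (subst integral_distr) (simp_all add: case_prod_unfold)
  also have "\<dots> = heat (a + b) f x"
    unfolding distr_gauss_sum[OF b a]
    using a b by (subst integral_distr) (simp_all add: heat_def add.commute)
  finally show ?thesis .
qed

text \<open>
  By Fubini's theorem and the semigroup property, running the heat flow up to time \<open>t\<close> on the
  Duhamel integral up to time \<open>s\<close> gives the part of the Duhamel integral for time \<open>t\<close> that comes
  from sources before \<open>s\<close>.
\<close>

lemma heat_duhamel:
  assumes q: "q \<in> weighted \<alpha> B" and "0 \<le> s" "s \<le> t"
  shows "heat (t - s) (\<lambda>y. duhamel 0 q (y, s)) x = (LBINT \<tau>:{0..s}. heat (t - \<tau>) (\<lambda>y. q (y, \<tau>)) x)"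
proof -
  obtain C where C: "0 \<le> C" "\<And>p. \<bar>q p\<bar> \<le> C * caloric \<alpha> B p" using weightedE[OF q] by blast
  have [measurable]: "q \<in> borel_measurable borel" by (rule weighted_measurable[OF q])
  define y where "y = (\<lambda>z. x + sqrt (t - s) * z)"
  have [measurable]: "y \<in> borel_measurable borel" unfolding y_def by measurable
  interpret ga: pair_prob_space gauss lookback_law ..
  let ?f = "\<lambda>z w. q (lookback (y z, s) w)"
  have lb: "(\<lambda>(z, w). lookback (y z, s) w) \<in> gauss \<Otimes>\<^sub>M lookback_law \<rightarrow>\<^sub>M borel"
  proof -
    have "(\<lambda>(z, w). (y z, w)) \<in> gauss \<Otimes>\<^sub>M lookback_law \<rightarrow>\<^sub>M borel \<Otimes>\<^sub>M borel"
      using id_lookback_law by measurable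
    then have 1: "(\<lambda>(z, w). (y z, w)) \<in> gauss \<Otimes>\<^sub>M lookback_law \<rightarrow>\<^sub>M borel" by (simp add: borel_prod)
    have "continuous_on UNIV (\<lambda>(u, w). lookback (u, s) w)"
      unfolding lookback_def case_prod_unfold by (intro continuous_intros)
    from measurable_compose[OF 1 borel_measurable_continuous_onI[OF this]]
    show ?thesis by (simp add: case_prod_unfold)
  qed
  have [measurable]: "(\<lambda>(z, w). ?f z w) \<in> borel_measurable (gauss \<Otimes>\<^sub>M lookback_law)"
    using measurable_compose[OF lb, of q borel] by (simp add: case_prod_unfold)
  have "(\<integral>\<^sup>+v. ennreal (norm (case v of (z, w) \<Rightarrow> ?f z w)) \<partial>(gauss \<Otimes>\<^sub>M lookback_law)) =
      (\<integral>\<^sup>+z. \<integral>\<^sup>+w. ennreal (norm (?f z w)) \<partial>lookback_law \<partial>gauss)"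
    by (subst lookback_law.nn_integral_fst[symmetric]) (simp_all add: case_prod_unfold)
  also have "\<dots> \<le> (\<integral>\<^sup>+z. \<integral>\<^sup>+w. ennreal C * ennreal (caloric \<alpha> B (lookback (y z, s) w)) \<partial>lookback_law \<partial>gauss)"
    using C by (intro nn_integral_mono) (simp flip: ennreal_mult add: ennreal_leI)
  also have "\<dots> = (\<integral>\<^sup>+z. ennreal C * (\<integral>\<^sup>+w. ennreal (caloric \<alpha> B (lookback (y z, s) w)) \<partial>lookback_law) \<partial>gauss)"
    by (intro nn_integral_cong nn_integral_cmult) measurable
  also have "\<dots> \<le> (\<integral>\<^sup>+z. ennreal C * ennreal (exp (\<bar>B\<bar> * max s 0) * caloric \<alpha> B (y z, s)) \<partial>gauss)"
    by (intro nn_integral_mono mult_left_mono nn_integral_caloric_lookback_law) simp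
  also have "\<dots> = (\<integral>\<^sup>+z. ennreal (C * exp (\<bar>B\<bar> * max s 0) * exp ((\<alpha>\<^sup>2 / 2 + B) * max s 0) * cosh (\<alpha> * (x + sqrt (t - s) * z))) \<partial>gauss)"
    using C by (intro nn_integral_cong) (simp add: caloric_def y_def mult.assoc flip: ennreal_mult)
  also have "\<dots> < \<infinity>"
    using gauss_cosh(1)[of "t - s" \<alpha> x] assms(2,3) C
    by (subst nn_integral_eq_integral) (auto intro!: integrable_mult_right)
  finally have int: "integrable (gauss \<Otimes>\<^sub>M lookback_law) (\<lambda>(z, w). ?f z w)"
    by (intro integrableI_bounded) simp_all
  have "heat (t - s) (\<lambda>y. duhamel 0 q (y, s)) x = (\<integral>z. s * (\<integral>w. ?f z w \<partial>lookback_law) \<partial>gauss)"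
    using assms by (simp add: heat_def duhamel_def y_def)
  also have "\<dots> = s * (\<integral>z. \<integral>w. ?f z w \<partial>lookback_law \<partial>gauss)" by simp
  also have "(\<integral>z. \<integral>w. ?f z w \<partial>lookback_law \<partial>gauss) = (\<integral>w. \<integral>z. ?f z w \<partial>gauss \<partial>lookback_law)"
    by (rule ga.Fubini_integral[OF int, symmetric])
  also have "\<dots> = (\<integral>r. \<integral>z'. \<integral>z. ?f z (r, z') \<partial>gauss \<partial>gauss \<partial>unit_time)"
    using ga.integrable_snd[OF int] unfolding lookback_law_def
    by (subst lookback_law_pair.integral_fst'[symmetric]) simp_all
  also have "\<dots> = (\<integral>r. heat (t - s * (1 - r)) (\<lambda>y. q (y, s * (1 - r))) x \<partial>unit_time)"
  proof (intro Bochner_Integration.integral_cong refl)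
    fix r assume "r \<in> space unit_time"
    then have r: "0 \<le> r" "r \<le> 1" by auto
    let ?q = "\<lambda>y. q (y, s * (1 - r))"
    have "(\<integral>z'. \<integral>z. ?f z (r, z') \<partial>gauss \<partial>gauss) = heat (s * r) (heat (t - s) ?q) x"
      using assms r by (simp add: heat_def lookback_def y_def algebra_simps)
    also have "\<dots> = heat (t - s + s * r) ?q x"
    proof (rule heat_semigroup_property)
      show "\<bar>?q y\<bar> \<le> C * exp ((\<alpha>\<^sup>2 / 2 + B) * max (s * (1 - r)) 0) * cosh (\<alpha> * y)" for y
        using C(2)[of "(y, s * (1 - r))"] by (simp add: caloric_def)
    qed (use assms r in auto)
    finally show "(\<integral>z'. \<integral>z. ?f z (r, z') \<partial>gauss \<partial>gauss) = heat (t - s * (1 - r)) ?q x"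
      by (simp add: algebra_simps)
  qed
  also have "s * \<dots> = (LBINT \<tau>:{0..s}. heat (t - \<tau>) (\<lambda>y. q (y, \<tau>)) x)"
    by (rule set_integral_unit_time[OF \<open>0 \<le> s\<close>, symmetric])
  finally show ?thesis .
qed

text \<open>
  For fixed \<open>(x, t)\<close> let \<open>h s\<close> be the contribution to \<open>duhamel 0 q\<close> of the source at time \<open>s\<close>
  and \<open>G\<close> its integral.  By \<open>heat_duhamel\<close>, \<open>G s\<close> is also the heat flow over time \<open>t - s\<close> of
  \<open>duhamel 0 q\<close> at time \<open>s\<close>.  Integration of
  \<open>(exp (- K (t - s)) G s)' = exp (- K (t - s)) (h s + K G s)\<close> over \<open>[0, t]\<close> gives the claim.
  For smooth functions this is the remark that
  \<open>\<partial>\<^sub>t d = \<partial>\<^sub>x\<^sub>x d / 2 + q\<close> is the same as \<open>\<partial>\<^sub>t d = \<partial>\<^sub>x\<^sub>x d / 2 - K d + (q + K d)\<close>.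
\<close>

lemma duhamel_discount:
  assumes q: "q \<in> weighted \<alpha> B" and K: "0 \<le> K" and B: "0 < B"
  shows "duhamel 0 q p = duhamel K (\<lambda>p. q p + K * duhamel 0 q p) p"
proof -
  obtain x t0 where p: "p = (x, t0)" by fastforce
  define t where "t = max t0 0"
  have t: "0 \<le> t" and pt: "duhamel K' q' p = duhamel K' q' (x, t)" for K' q'
    by (auto simp: t_def p duhamel_def lookback_def)
  have D: "duhamel 0 q \<in> weighted \<alpha> B" using duhamel_weighted[OF q] B by simp
  define h where "h s = heat (t - s) (\<lambda>y. q (y, s)) x" for s
  define G where "G s = integral {0..s} h" for s
  have ch: "continuous_on S h" for S
    unfolding h_def by (intro continuous_on_heat_compose[OF q] continuous_intros)
  have ce: "continuous_on S (\<lambda>s. exp (- K * (t - s)))" for S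
    by (intro continuous_intros)
  note ceh = continuous_on_mult[OF ce ch]
  have set_int: "(LBINT s:{0..u}. g s) = integral {0..u} g" if "continuous_on {0..u} g" for g :: "real \<Rightarrow> real" and u
    using set_borel_integral_eq_integral(2)[OF borel_integrable_atLeastAtMost'[OF that]] .
  have G: "heat (t - s) (\<lambda>y. duhamel 0 q (y, s)) x = G s" if "0 \<le> s" "s \<le> t" for s
    using heat_duhamel[OF q that, of x] set_int[OF ch] by (simp add: G_def h_def)
  have dG: "(G has_real_derivative h s) (at s within {0..t})" if "s \<in> {0..t}" for s
    unfolding G_def by (rule integral_has_real_derivative[OF ch that])
  then have cG: "continuous_on {0..t} G"
    by (rule DERIV_continuous_on)
  note ceG = continuous_on_mult[OF ce cG]
  have 1: "duhamel 0 q (x, t) = G t"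
    using duhamel_eq_set_integral[OF q _ t, of 0 x] set_int[OF ch] by (simp add: G_def h_def)
  have "duhamel K (\<lambda>p. q p + K * duhamel 0 q p) (x, t) =
     duhamel K q (x, t) + K * duhamel K (duhamel 0 q) (x, t)"
    using duhamel_add[OF q weighted_cmult[OF D] K] by (simp add: duhamel_cmult)
  also have "duhamel K q (x, t) = integral {0..t} (\<lambda>s. exp (- K * (t - s)) * h s)"
    using duhamel_eq_set_integral[OF q K t, of x]
    unfolding h_def[symmetric] by (simp only: set_int[OF ceh])
  also have "duhamel K (duhamel 0 q) (x, t) = (LBINT s:{0..t}. exp (- K * (t - s)) * G s)"
    unfolding duhamel_eq_set_integral[OF D K t] set_lebesgue_integral_def
    by (intro Bochner_Integration.integral_cong) (auto simp: indicator_def G)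
  also have "\<dots> = integral {0..t} (\<lambda>s. exp (- K * (t - s)) * G s)"
    by (rule set_int[OF ceG])
  also have "integral {0..t} (\<lambda>s. exp (- K * (t - s)) * h s) + K * integral {0..t} (\<lambda>s. exp (- K * (t - s)) * G s)
     = integral {0..t} (\<lambda>s. exp (- K * (t - s)) * h s + K * (exp (- K * (t - s)) * G s))"
    using integral_add[OF integrable_continuous_interval[OF ceh]
        integrable_continuous_interval[OF continuous_on_mult_left[OF ceG, of K]], symmetric]
    by simp
  also have "\<dots> = G t"
  proof (rule integral_unique)
    have "((\<lambda>s. exp (- K * (t - s)) * h s + K * (exp (- K * (t - s)) * G s)) has_integral
        exp (- K * (t - t)) * G t - exp (- K * (t - 0)) * G 0) {0..t}"
    proof (rule fundamental_theorem_of_calculus[OF t])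
      fix s assume s: "s \<in> {0..t}"
      have "((\<lambda>s. exp (- K * (t - s))) has_real_derivative exp (- K * (t - s)) * K) (at s within {0..t})"
        by (auto intro!: derivative_eq_intros)
      from DERIV_mult[OF this dG[OF s]]
      show "((\<lambda>s. exp (- K * (t - s)) * G s) has_vector_derivative
          exp (- K * (t - s)) * h s + K * (exp (- K * (t - s)) * G s)) (at s within {0..t})"
        unfolding has_real_derivative_iff_has_vector_derivative by (simp add: ac_simps)
    qed
    then show "((\<lambda>s. exp (- K * (t - s)) * h s + K * (exp (- K * (t - s)) * G s)) has_integral G t) {0..t}"
      by (simp add: G_def)
  qed
  finally show ?thesis using 1 pt by simp
qed

section \<open>The truncated nonlinearity\<close>

definition trunc :: "real \<Rightarrow> real \<Rightarrow> real" where
  "trunc R m = max (- R) (min R m)"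

text \<open>
  The whole of \<open>V'\<close> is truncated and not only its cubic part: the result is bounded and Lipschitz
  and its slope is still at least \<open>-1\<close>.  For \<open>R \<ge> 1\<close> it also keeps the sign of its argument
  outside \<open>[-1, 1]\<close>.
\<close>

definition cut_V' :: "real \<Rightarrow> real \<Rightarrow> real" where
  "cut_V' R m = V' (trunc R m)"

lemma V'_diff: "V' b - V' a = (b - a) * (a\<^sup>2 + a * b + b\<^sup>2 - 1)"
  by (simp add: V'_def algebra_simps power2_eq_square power3_eq_cube)

lemma cubic_form_nonneg: "0 \<le> a\<^sup>2 + a * b + (b::real)\<^sup>2"
proof -
  have "a\<^sup>2 + a * b + b\<^sup>2 = (a + b / 2)\<^sup>2 + 3 / 4 * b\<^sup>2"
    by (simp add: power2_eq_square algebra_simps)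
  then show ?thesis by simp
qed

lemma V'_diff_bounds:
  assumes "a \<le> b" "\<bar>a\<bar> \<le> R" "\<bar>b\<bar> \<le> R"
  shows "- (b - a) \<le> V' b - V' a" "V' b - V' a \<le> 3 * R\<^sup>2 * (b - a)"
proof -
  have sq: "a\<^sup>2 \<le> R\<^sup>2" "b\<^sup>2 \<le> R\<^sup>2"
    using power_mono[OF assms(2), of 2] power_mono[OF assms(3), of 2] by auto
  have "a * b \<le> \<bar>a\<bar> * \<bar>b\<bar>" by (simp flip: abs_mult)
  also have "\<dots> \<le> R * R" using assms by (intro mult_mono) auto
  finally have ab: "a * b \<le> R\<^sup>2" by (simp add: power2_eq_square)
  have "(b - a) * (- 1) \<le> (b - a) * (a\<^sup>2 + a * b + b\<^sup>2 - 1)"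
    using assms(1) cubic_form_nonneg[of a b] by (intro mult_left_mono) auto
  then show "- (b - a) \<le> V' b - V' a" by (simp add: V'_diff)
  have "(b - a) * (a\<^sup>2 + a * b + b\<^sup>2 - 1) \<le> (b - a) * (3 * R\<^sup>2)"
    using assms(1) sq ab by (intro mult_left_mono) auto
  then show "V' b - V' a \<le> 3 * R\<^sup>2 * (b - a)" by (simp add: V'_diff mult.commute)
qed

lemma trunc_mono: "a \<le> b \<Longrightarrow> trunc R a \<le> trunc R b"
  and trunc_diff: "a \<le> b \<Longrightarrow> trunc R b - trunc R a \<le> b - a"
  and abs_trunc_le: "0 \<le> R \<Longrightarrow> \<bar>trunc R a\<bar> \<le> R"
  and abs_trunc_le_abs: "0 \<le> R \<Longrightarrow> \<bar>trunc R a\<bar> \<le> \<bar>a\<bar>"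
  and trunc_eq: "\<bar>a\<bar> \<le> R \<Longrightarrow> trunc R a = a"
  and trunc_clamp: "0 \<le> R \<Longrightarrow> R \<le> S \<Longrightarrow> trunc R (trunc S a) = trunc R a"
  by (auto simp: trunc_def)

lemma cut_V'_diff_bounds:
  assumes "a \<le> b" "0 \<le> R"
  shows "- (b - a) \<le> cut_V' R b - cut_V' R a" "cut_V' R b - cut_V' R a \<le> 3 * R\<^sup>2 * (b - a)"
proof -
  note * = V'_diff_bounds[OF trunc_mono[OF assms(1), of R] abs_trunc_le abs_trunc_le]
  have d: "trunc R b - trunc R a \<le> b - a" by (rule trunc_diff[OF assms(1)])
  show "- (b - a) \<le> cut_V' R b - cut_V' R a"
    using *(1) d assms(2) by (simp add: cut_V'_def)
  have "cut_V' R b - cut_V' R a \<le> 3 * R\<^sup>2 * (trunc R b - trunc R a)"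
    using *(2) assms(2) by (simp add: cut_V'_def)
  also have "\<dots> \<le> 3 * R\<^sup>2 * (b - a)"
    using d by (intro mult_left_mono) auto
  finally show "cut_V' R b - cut_V' R a \<le> 3 * R\<^sup>2 * (b - a)" .
qed

text \<open>
  The slope of the truncated nonlinearity lies between \<open>-1\<close> and \<open>3 R\<^sup>2 \<le> c\<close>.  The bound does not
  depend on the upper end of this range other than through \<open>c\<close>, which \<open>duhamel_comparison\<close> cancels.
\<close>

lemma damping:
  assumes "0 \<le> R" "3 * R\<^sup>2 \<le> c"
  shows "\<bar>c * (a - b) - (cut_V' R a - cut_V' R b)\<bar> \<le> (c + 1) * \<bar>a - b\<bar>"
proof -
  have *: "\<bar>c * (a - b) - (cut_V' R a - cut_V' R b)\<bar> \<le> (c + 1) * \<bar>a - b\<bar>" if "b \<le> a" for a b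
  proof -
    have "3 * R\<^sup>2 * (a - b) \<le> c * (a - b)"
      using that assms by (intro mult_right_mono) auto
    then show ?thesis
      using cut_V'_diff_bounds[OF that assms(1)] that by (simp add: abs_le_iff algebra_simps)
  qed
  show ?thesis
  proof (cases "b \<le> a")
    case False
    then have "\<bar>c * (b - a) - (cut_V' R b - cut_V' R a)\<bar> \<le> (c + 1) * \<bar>b - a\<bar>" by (intro *) simp
    moreover have "c * (b - a) - (cut_V' R b - cut_V' R a) = - (c * (a - b) - (cut_V' R a - cut_V' R b))"
      by (simp add: algebra_simps)
    ultimately show ?thesis by (simp add: abs_minus_commute)
  qed (rule *)
qed

lemma cut_V'_lipschitz:
  assumes "1 \<le> R"
  shows "\<bar>cut_V' R a - cut_V' R b\<bar> \<le> 3 * R\<^sup>2 * \<bar>a - b\<bar>"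
proof -
  have R: "1 \<le> 3 * R\<^sup>2" using one_le_power[OF assms, of 2] by linarith
  have *: "\<bar>cut_V' R a - cut_V' R b\<bar> \<le> 3 * R\<^sup>2 * \<bar>a - b\<bar>" if "b \<le> a" for a b
    using cut_V'_diff_bounds[OF that, of R] assms that mult_right_mono[OF R, of "a - b"]
    by (simp add: abs_le_iff)
  show ?thesis using *[of a b] *[of b a] by (cases "b \<le> a") (auto simp: abs_minus_commute)
qed

lemma cut_V'_0 [simp]: "0 \<le> R \<Longrightarrow> cut_V' R 0 = 0"
  by (simp add: cut_V'_def V'_def trunc_def)

lemma cut_V'_uminus:
  assumes "0 \<le> R" shows "cut_V' R (- a) = - cut_V' R a"
proof -
  have "trunc R (- a) = - trunc R a" using assms by (auto simp: trunc_def)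
  then show ?thesis by (simp add: cut_V'_def V'_def)
qed

lemma abs_V'_le: "\<bar>V' a\<bar> \<le> \<bar>a\<bar> ^ 3 + \<bar>a\<bar>"
  unfolding V'_def by (rule order_trans[OF abs_triangle_ineq4]) (simp add: power_abs)

lemma abs_cut_V'_le: "0 \<le> R \<Longrightarrow> \<bar>cut_V' R a\<bar> \<le> \<bar>a\<bar> ^ 3 + \<bar>a\<bar>"
  unfolding cut_V'_def using abs_trunc_le_abs[of R a]
  by (intro order_trans[OF abs_V'_le] add_mono power_mono) auto

text \<open>
  \<open>V'\<close> is at least \<open>-1\<close> on the positive half-line and at least \<open>-\<bar>g\<bar>\<^sup>3\<close> on \<open>[-\<bar>g\<bar>, 0]\<close>; so large
  positive values of \<open>v\<close> do no harm.
\<close>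

lemma one_sided_bound: "- \<bar>g\<bar> \<le> v \<Longrightarrow> 0 \<le> R \<Longrightarrow> - cut_V' R v \<le> 1 + \<bar>g\<bar> ^ 3"
proof -
  assume v: "- \<bar>g\<bar> \<le> v" and R: "0 \<le> R"
  define c where "c = trunc R v"
  have c: "- \<bar>g\<bar> \<le> c" using v R by (auto simp: c_def trunc_def)
  show "- cut_V' R v \<le> 1 + \<bar>g\<bar> ^ 3"
  proof (cases "c \<ge> 0")
    case True
    have "c - c ^ 3 \<le> 1"
    proof (cases "c \<le> 1")
      case True then show ?thesis using \<open>c \<ge> 0\<close> zero_le_power[of c 3] by linarith
    next
      case False then have "c ^ 1 \<le> c ^ 3" by (intro power_increasing) auto
      then show ?thesis by simp
    qed
    then show ?thesis by (simp add: cut_V'_def V'_def c_def[symmetric] add_increasing2)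
  next
    case False
    then have "(- c) ^ 3 \<le> \<bar>g\<bar> ^ 3" using c by (intro power_mono) auto
    then show ?thesis using False by (simp add: cut_V'_def V'_def c_def[symmetric])
  qed
qed

text \<open>
  The variant of \<open>damping\<close> without the summand \<open>1\<close> in the factor \<open>c + 1\<close>, at the price of a source
  term that depends on \<open>g\<close> only.  With that summand the a priori bound would grow like \<open>exp t\<close>, which
  is not admissible in \<open>C_spacetime \<alpha>\<close> for small \<open>\<alpha>\<close>.
\<close>

lemma confinement:
  assumes "0 \<le> R" "3 * R\<^sup>2 \<le> c"
  shows "\<bar>c * u - cut_V' R (u + g)\<bar> \<le> c * \<bar>u\<bar> + (1 + \<bar>g\<bar> + \<bar>g\<bar> ^ 3)"
proof -
  have *: "\<bar>c * u - cut_V' R (u + g)\<bar> \<le> c * \<bar>u\<bar> + (1 + \<bar>g\<bar> + \<bar>g\<bar> ^ 3)" if "0 \<le> u" for u g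
  proof -
    have "- cut_V' R (u + g) \<le> 1 + \<bar>g\<bar> ^ 3" using that assms by (intro one_sided_bound) auto
    moreover have "cut_V' R (u + g) - cut_V' R g \<le> 3 * R\<^sup>2 * u"
      using cut_V'_diff_bounds(2)[of g "u + g" R] that assms by simp
    moreover have "3 * R\<^sup>2 * u \<le> c * u" using that assms by (intro mult_right_mono) auto
    moreover have "\<bar>cut_V' R g\<bar> \<le> \<bar>g\<bar> ^ 3 + \<bar>g\<bar>" using assms(1) by (rule abs_cut_V'_le)
    moreover have "0 \<le> c" using order_trans[OF _ assms(2), of 0] by simp
    then have "0 \<le> c * u" using that by simp
    ultimately show ?thesis using that by (simp add: abs_le_iff)
  qed
  show ?thesis
  proof (cases "0 \<le> u")
    case False
    then have "\<bar>c * (- u) - cut_V' R (- u + - g)\<bar> \<le> c * \<bar>- u\<bar> + (1 + \<bar>- g\<bar> + \<bar>- g\<bar> ^ 3)" by (intro *) simp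
    moreover have "cut_V' R (- u + - g) = - cut_V' R (u + g)" using cut_V'_uminus[OF assms(1), of "u + g"] by simp
    then have "c * (- u) - cut_V' R (- u + - g) = - (c * u - cut_V' R (u + g))" by simp
    ultimately show ?thesis by (metis abs_minus_cancel)
  qed (rule *)
qed

text \<open>
  The error vanishes on \<open>[-R, R]\<close>.  Elsewhere it is at most \<open>\<bar>a\<bar>\<^sup>3\<close>, and \<open>\<bar>a\<bar> / R \<ge> 1\<close>: the price for
  the factor \<open>1 / R\<close> is one more power of \<open>a\<close>.
\<close>

lemma V'_truncation_error:
  assumes "1 \<le> R"
  shows "\<bar>V' a - cut_V' R a\<bar> \<le> \<bar>a\<bar> ^ 4 / R"
proof (cases "\<bar>a\<bar> \<le> R")
  case True
  then show ?thesis using assms by (simp add: cut_V'_def trunc_eq)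
next
  case False
  have *: "\<bar>V' b - V' R\<bar> \<le> b ^ 4 / R" if "R < b" for b
  proof -
    have 0: "0 \<le> V' R" using assms power_increasing[of 1 3 R] by (simp add: V'_def)
    have "0 \<le> (b - R) * (R\<^sup>2 + R * b + b\<^sup>2 - 1)"
    proof (intro mult_nonneg_nonneg)
      have "1 \<le> R\<^sup>2" using assms by (rule one_le_power)
      moreover have "0 \<le> R * b" using assms that by simp
      ultimately show "0 \<le> R\<^sup>2 + R * b + b\<^sup>2 - 1" using zero_le_power2[of b] by linarith
    qed (use that in simp)
    then have "\<bar>V' b - V' R\<bar> \<le> V' b" using 0 V'_diff[of b R] by simp
    also have "\<dots> \<le> b ^ 3" using that assms by (simp add: V'_def)
    also have "\<dots> \<le> b ^ 3 * (b / R)" using that assms by (simp add: mult_left_mono[of 1 "b / R" "b ^ 3", simplified])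
    finally show ?thesis by (simp add: power_numeral_reduce field_simps)
  qed
  have odd: "V' (- b) = - V' b" for b by (simp add: V'_def)
  show ?thesis
  proof (cases "a > 0")
    case True
    with False have "cut_V' R a = V' R" using assms by (simp add: cut_V'_def trunc_def)
    with *[of a] True False show ?thesis by simp
  next
    case neg: False
    with False have "cut_V' R a = V' (- R)" using assms by (simp add: cut_V'_def trunc_def)
    with *[of "- a"] neg False show ?thesis by (simp add: odd abs_minus_commute)
  qed
qed

lemma cut_V'_truncation_error:
  assumes "1 \<le> R" "R \<le> S"
  shows "\<bar>cut_V' S a - cut_V' R a\<bar> \<le> \<bar>a\<bar> ^ 4 / R"
proof -
  have "cut_V' R a = cut_V' R (trunc S a)" using assms by (simp add: cut_V'_def trunc_clamp)
  then have "\<bar>cut_V' S a - cut_V' R a\<bar> \<le> \<bar>trunc S a\<bar> ^ 4 / R"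
    using V'_truncation_error[OF assms(1), of "trunc S a"] by (simp add: cut_V'_def)
  also have "\<dots> \<le> \<bar>a\<bar> ^ 4 / R"
    using assms by (intro divide_right_mono power_mono abs_trunc_le_abs) auto
  finally show ?thesis .
qed

section \<open>A priori bound and stability of the coupled system\<close>

text \<open>
  The two components are indexed by \<open>bool\<close>, so that \<open>\<not> i\<close> is the component coupled to \<open>i\<close>, and the
  symmetry of the system is used once and for all.
\<close>

definition drift :: "real \<Rightarrow> (real \<Rightarrow> real) \<Rightarrow> (bool \<Rightarrow> real \<times> real \<Rightarrow> real) \<Rightarrow> bool \<Rightarrow> real \<times> real \<Rightarrow> real" where
  "drift lam P u i p = P (u i p) + lam * (u i p - u (\<not> i) p)"

definition solves :: "real \<Rightarrow> (real \<Rightarrow> real) \<Rightarrow> (bool \<Rightarrow> real \<times> real \<Rightarrow> real) \<Rightarrow> (bool \<Rightarrow> real \<times> real \<Rightarrow> real) \<Rightarrow> bool" where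
  "solves lam P g u \<longleftrightarrow> (\<forall>i p. u i p = g i p - duhamel 0 (drift lam P u i) p)"

lemma solvesD: "solves lam P g u \<Longrightarrow> u i p = g i p - duhamel 0 (drift lam P u i) p"
  unfolding solves_def by blast

lemma lipschitz_weighted:
  assumes P: "\<And>a b. \<bar>P a - P b\<bar> \<le> L * \<bar>a - b\<bar>" "P 0 = (0::real)" and u: "u \<in> weighted \<alpha> B"
  shows "(\<lambda>p. P (u p)) \<in> weighted \<alpha> B"
proof (rule weighted_dominated[OF u])
  have "0 \<le> L" using order_trans[OF abs_ge_zero P(1)[of 1 0]] by simp
  then have "L-lipschitz_on UNIV P"
    using P(1) by (intro lipschitz_onI) (auto simp: dist_real_def)
  then have "continuous_on UNIV P" by (rule lipschitz_on_continuous_on)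
  then show "continuous_on UNIV (\<lambda>p. P (u p))"
    by (rule continuous_on_compose2[OF _ weighted_continuous[OF u]]) simp
  show "\<bar>P (u p)\<bar> \<le> L * \<bar>u p\<bar>" for p using P(1)[of "u p" 0] P(2) by simp
qed

lemma drift_weighted:
  assumes "\<And>i. u i \<in> weighted \<alpha> B" "\<And>a b. \<bar>P a - P b\<bar> \<le> L * \<bar>a - b\<bar>" "P 0 = (0::real)"
  shows "drift lam P u i \<in> weighted \<alpha> B"
  unfolding drift_def
  by (intro weighted_add weighted_cmult weighted_diff assms(1) lipschitz_weighted[OF assms(2,3)])

text \<open>
  The coupling costs nothing: in the sum of the two absolute values, what one component loses
  through \<open>lam\<close> in the damping coefficient it gives to the other.
\<close>

lemma coupled_comparison:
  assumes q: "\<And>i. q i \<in> weighted \<alpha> B0" and B0: "0 < B0" 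
    and d: "\<And>i p. d i p = duhamel 0 (q i) p"
    and K: "0 \<le> lam" "lam \<le> K" and A: "0 \<le> A" "A < B" and F: "0 \<le> F"
    and damp: "\<And>i p. \<bar>q i p + K * d i p\<bar> \<le> (K - lam + A) * \<bar>d i p\<bar> + lam * \<bar>d (\<not> i) p\<bar> + F * caloric \<alpha> B p"
  shows "\<bar>d i p\<bar> \<le> 2 * F / (B - A) * caloric \<alpha> B p"
proof -
  have K0: "0 \<le> K" using K by simp
  have d_eq: "d i = duhamel 0 (q i)" for i using d by (simp add: fun_eq_iff)
  have dW: "d i \<in> weighted \<alpha> B0" for i
    unfolding d_eq using q B0 by (intro duhamel_weighted) auto
  define B1 where "B1 = max B0 B"
  define h where "h i p = (K - lam + A) * \<bar>d i p\<bar> + lam * \<bar>d (\<not> i) p\<bar> + F * caloric \<alpha> B p" for i p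
  have hW: "h i \<in> weighted \<alpha> B1" for i
    unfolding h_def B1_def
    by (intro weighted_add weighted_cmult weighted_mono[OF weighted_abs[OF dW]] weighted_mono[OF weighted_caloric]) auto
  have dh: "\<bar>d i p\<bar> \<le> duhamel K (h i) p" for i p
  proof -
    obtain C where C: "\<And>p. \<bar>h i p\<bar> \<le> C * caloric \<alpha> B1 p" using weightedE[OF hW] by blast
    have "d i p = duhamel K (\<lambda>p. q i p + K * d i p) p"
      unfolding d_eq by (rule duhamel_discount[OF q K0 B0])
    also have "\<bar>\<dots>\<bar> \<le> duhamel K (h i) p"
    proof (rule abs_duhamel_le[OF _ weighted_measurable[OF hW] K0 C])
      show "(\<lambda>p. q i p + K * d i p) \<in> borel_measurable borel"
        by (rule weighted_measurable[OF weighted_add[OF q weighted_cmult[OF dW]]])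
    qed (use damp in \<open>simp add: h_def\<close>)
    finally show ?thesis .
  qed
  define U where "U p = \<bar>d True p\<bar> + \<bar>d False p\<bar>" for p
  have "U p \<le> (2 * F) / (B - A) * caloric \<alpha> B p"
  proof (rule duhamel_comparison)
    show "U \<in> weighted \<alpha> B0" unfolding U_def by (intro weighted_add weighted_abs dW)
    fix p
    have "U p \<le> duhamel K (h True) p + duhamel K (h False) p"
      unfolding U_def by (intro add_mono dh)
    also have "\<dots> = duhamel K (\<lambda>p. h True p + h False p) p"
      by (rule duhamel_add[OF hW hW K0, symmetric])
    also have "(\<lambda>p. h True p + h False p) = (\<lambda>p. (K + A) * U p + 2 * F * caloric \<alpha> B p)"
      by (simp add: h_def U_def algebra_simps)
    finally show "U p \<le> duhamel K (\<lambda>p. (K + A) * U p + 2 * F * caloric \<alpha> B p) p" .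
  qed (use K0 A F in \<open>auto simp: U_def\<close>)
  moreover have "\<bar>d i p\<bar> \<le> U p" by (cases i) (auto simp: U_def)
  ultimately show ?thesis by linarith
qed

text \<open>
  Comparison for \<open>u - g\<close> with \<open>A = 0\<close>.  An arbitrarily small \<open>B > 0\<close> is allowed, so the
  bound is uniform in \<open>R\<close> and grows subexponentially in time.
\<close>

lemma apriori_bound:
  assumes R: "1 \<le> R" and lam: "0 \<le> lam"
    and u: "solves lam (cut_V' R) g u" and W: "\<And>i. u i \<in> weighted \<alpha> B0" "0 < B0"
    and F: "0 \<le> F" "\<And>i p. 1 + \<bar>g i p\<bar> + \<bar>g i p\<bar> ^ 3 + lam * \<bar>g i p - g (\<not> i) p\<bar> \<le> F * caloric \<alpha> B p"
    and B: "0 < B"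
  shows "\<bar>u i p - g i p\<bar> \<le> 2 * F / B * caloric \<alpha> B p"
proof -
  \<comment> \<open>A Lipschitz constant of the drift in its own component.\<close>
  define K where "K = lam + 3 * R\<^sup>2"
  define q where "q i = (\<lambda>p. (- 1) * drift lam (cut_V' R) u i p)" for i
  define d where "d i p = u i p - g i p" for i p
  have "\<bar>d i p\<bar> \<le> 2 * F / (B - 0) * caloric \<alpha> B p"
  proof (rule coupled_comparison[where q=q and K=K and lam=lam])
    show "q i \<in> weighted \<alpha> B0" for i
      unfolding q_def by (intro weighted_cmult drift_weighted[OF W(1) cut_V'_lipschitz[OF R]]) (use R in auto)
    show "d i p = duhamel 0 (q i) p" for i p
      unfolding q_def duhamel_cmult using solvesD[OF u, of i p] by (simp add: d_def)
    fix i p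
    have "q i p + K * d i p = (3 * R\<^sup>2 * d i p - cut_V' R (d i p + g i p)) + lam * d (\<not> i) p - lam * (g i p - g (\<not> i) p)"
      by (simp add: q_def drift_def d_def K_def algebra_simps)
    also have "\<bar>\<dots>\<bar> \<le> \<bar>3 * R\<^sup>2 * d i p - cut_V' R (d i p + g i p)\<bar> + \<bar>lam * d (\<not> i) p\<bar> + \<bar>lam * (g i p - g (\<not> i) p)\<bar>"
      by linarith
    also have "\<bar>3 * R\<^sup>2 * d i p - cut_V' R (d i p + g i p)\<bar> \<le> 3 * R\<^sup>2 * \<bar>d i p\<bar> + (1 + \<bar>g i p\<bar> + \<bar>g i p\<bar> ^ 3)"
      using R by (intro confinement) auto
    finally show "\<bar>q i p + K * d i p\<bar> \<le> (K - lam + 0) * \<bar>d i p\<bar> + lam * \<bar>d (\<not> i) p\<bar> + F * caloric \<alpha> B p"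
      using F(2)[of i p] lam by (simp add: K_def abs_mult)
  qed (use W F B lam R in \<open>auto simp: K_def\<close>)
  then show ?thesis by (simp add: d_def)
qed

text \<open>
  Comparison for \<open>m - n\<close> with \<open>A = 1\<close> and \<open>B = 2\<close>.  The nonlinearity \<open>P\<close> enters only
  through its distance, along \<open>m\<close>, to the truncated one; it may be \<open>V'\<close> itself or a truncation at a
  larger height.
\<close>

lemma truncation_stability:
  assumes R: "1 \<le> R" and lam: "0 \<le> lam"
    and m: "solves lam P g m" and n: "solves lam (cut_V' R) g n"
    and mW: "\<And>i. drift lam P m i \<in> weighted \<alpha> B0" and nW: "\<And>i. n i \<in> weighted \<alpha> B0" and B0: "0 < B0"
    and E: "0 \<le> E" "\<And>i p. \<bar>P (m i p) - cut_V' R (m i p)\<bar> \<le> E * caloric \<alpha> 2 p"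
  shows "\<bar>m i p - n i p\<bar> \<le> 2 * E * caloric \<alpha> 2 p"
proof -
  define K where "K = lam + 3 * R\<^sup>2"
  define q where "q i = (\<lambda>p. drift lam (cut_V' R) n i p - drift lam P m i p)" for i
  define d where "d i p = m i p - n i p" for i p
  have dn: "drift lam (cut_V' R) n i \<in> weighted \<alpha> B0" for i
    by (intro drift_weighted[OF nW cut_V'_lipschitz[OF R]]) (use R in auto)
  have "\<bar>d i p\<bar> \<le> 2 * E / (2 - 1) * caloric \<alpha> 2 p"
  proof (rule coupled_comparison[where q=q and K=K and lam=lam])
    show "q i \<in> weighted \<alpha> B0" for i
      unfolding q_def by (intro weighted_diff dn mW)
    show "d i p = duhamel 0 (q i) p" for i p
      unfolding q_def duhamel_diff[OF dn mW order_refl]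
      using solvesD[OF m, of i p] solvesD[OF n, of i p] by (simp add: d_def)
    fix i p
    have "q i p + K * d i p = (3 * R\<^sup>2 * (m i p - n i p) - (cut_V' R (m i p) - cut_V' R (n i p)))
        + lam * d (\<not> i) p - (P (m i p) - cut_V' R (m i p))"
      by (simp add: q_def drift_def d_def K_def algebra_simps)
    also have "\<bar>\<dots>\<bar> \<le> \<bar>3 * R\<^sup>2 * (m i p - n i p) - (cut_V' R (m i p) - cut_V' R (n i p))\<bar>
        + \<bar>lam * d (\<not> i) p\<bar> + \<bar>P (m i p) - cut_V' R (m i p)\<bar>"
      by linarith
    also have "\<bar>3 * R\<^sup>2 * (m i p - n i p) - (cut_V' R (m i p) - cut_V' R (n i p))\<bar> \<le> (3 * R\<^sup>2 + 1) * \<bar>m i p - n i p\<bar>"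
      using R by (intro damping) auto
    finally show "\<bar>q i p + K * d i p\<bar> \<le> (K - lam + 1) * \<bar>d i p\<bar> + lam * \<bar>d (\<not> i) p\<bar> + E * caloric \<alpha> 2 p"
      using E(2)[of i p] lam by (simp add: K_def abs_mult d_def)
  qed (use B0 E lam R in \<open>auto simp: K_def\<close>)
  then show ?thesis by (simp add: d_def)
qed

section \<open>Picard iteration for the truncated system\<close>

lemma weighted_Cauchy:
  assumes u: "\<And>n. u n \<in> weighted \<alpha> B"
    and Cauchy: "\<And>n l p. n \<le> l \<Longrightarrow> \<bar>u n p - u l p\<bar> \<le> \<epsilon> n * caloric \<alpha> B p" and \<epsilon>: "\<epsilon> \<longlonglongrightarrow> (0::real)"
  shows "\<exists>m\<in>weighted \<alpha> B. \<forall>p. (\<lambda>n. u n p) \<longlonglongrightarrow> m p \<and> (\<forall>n. \<bar>u n p - m p\<bar> \<le> \<epsilon> n * caloric \<alpha> B p)"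
proof -
  have "convergent (\<lambda>n. u n p)" for p
  proof (rule Cauchy_convergent)
    show "Cauchy (\<lambda>n. u n p)"
    proof (rule metric_CauchyI)
      fix e :: real assume "0 < e"
      have "(\<lambda>n. \<epsilon> n * caloric \<alpha> B p) \<longlonglongrightarrow> 0 * caloric \<alpha> B p" by (intro tendsto_intros \<epsilon>)
      then have "\<forall>\<^sub>F n in sequentially. \<epsilon> n * caloric \<alpha> B p < e / 2"
        using \<open>0 < e\<close> by (intro order_tendstoD) auto
      then obtain N where N: "\<epsilon> N * caloric \<alpha> B p < e / 2" by (auto simp: eventually_sequentially)
      have "dist (u k p) (u l p) < e" if "N \<le> k" "N \<le> l" for k l
        using Cauchy[OF that(1), of p] Cauchy[OF that(2), of p] N by (simp add: dist_real_def)
      then show "\<exists>M. \<forall>k\<ge>M. \<forall>l\<ge>M. dist (u k p) (u l p) < e" by blast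
    qed
  qed
  define m where "m p = lim (\<lambda>n. u n p)" for p
  have lim: "(\<lambda>n. u n p) \<longlonglongrightarrow> m p" for p
    unfolding m_def using \<open>\<And>p. convergent (\<lambda>n. u n p)\<close> by (simp add: convergent_LIMSEQ_iff)
  have rate: "\<bar>u n p - m p\<bar> \<le> \<epsilon> n * caloric \<alpha> B p" for n p
  proof (rule LIMSEQ_le_const2)
    show "(\<lambda>l. \<bar>u n p - u l p\<bar>) \<longlonglongrightarrow> \<bar>u n p - m p\<bar>" by (intro tendsto_intros lim)
    show "\<exists>N. \<forall>l\<ge>N. \<bar>u n p - u l p\<bar> \<le> \<epsilon> n * caloric \<alpha> B p" using Cauchy by blast
  qed
  have cont: "continuous_on UNIV m"
  proof -
    have "uniform_limit UNIV (\<lambda>n p. u n p / caloric \<alpha> B p) (\<lambda>p. m p / caloric \<alpha> B p) sequentially"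
    proof (rule uniform_limitI)
      fix e :: real assume "0 < e"
      then have "\<forall>\<^sub>F n in sequentially. \<epsilon> n < e" using \<epsilon> by (intro order_tendstoD) auto
      then show "\<forall>\<^sub>F n in sequentially. \<forall>p\<in>UNIV. dist (u n p / caloric \<alpha> B p) (m p / caloric \<alpha> B p) < e"
      proof (rule eventually_mono, safe)
        fix n p assume "\<epsilon> n < e"
        have "dist (u n p / caloric \<alpha> B p) (m p / caloric \<alpha> B p) = \<bar>u n p - m p\<bar> / caloric \<alpha> B p"
          by (simp add: dist_real_def diff_divide_distrib[symmetric] abs_of_pos)
        also have "\<dots> \<le> \<epsilon> n" using rate[of n p] by (simp add: divide_le_eq)
        finally show "dist (u n p / caloric \<alpha> B p) (m p / caloric \<alpha> B p) < e" using \<open>\<epsilon> n < e\<close> by simp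
      qed
    qed
    then have "continuous_on UNIV (\<lambda>p. m p / caloric \<alpha> B p)"
    proof (rule uniform_limit_theorem[rotated])
      show "\<forall>\<^sub>F n in sequentially. continuous_on UNIV (\<lambda>p. u n p / caloric \<alpha> B p)"
        by (intro always_eventually allI continuous_on_divide caloric_continuous weighted_continuous[OF u])
           (simp add: less_imp_neq[OF caloric_pos, THEN not_sym])
    qed simp
    from continuous_on_mult[OF this caloric_continuous[of UNIV \<alpha> B]]
    show ?thesis by (simp add: less_imp_neq[OF caloric_pos, THEN not_sym])
  qed
  obtain C where C: "\<And>p. \<bar>u 0 p\<bar> \<le> C * caloric \<alpha> B p" using weightedE[OF u] by blast
  have "m \<in> weighted \<alpha> B"
  proof (rule weightedI[OF cont])
    show "\<bar>m p\<bar> \<le> (C + \<epsilon> 0) * caloric \<alpha> B p" for p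
      using C[of p] rate[of 0 p] by (simp add: distrib_right)
  qed
  with lim rate show ?thesis by blast
qed

primrec picard :: "real \<Rightarrow> (real \<Rightarrow> real) \<Rightarrow> (bool \<Rightarrow> real \<times> real \<Rightarrow> real) \<Rightarrow> nat \<Rightarrow> bool \<Rightarrow> real \<times> real \<Rightarrow> real" where
  "picard lam P g 0 = g"
| "picard lam P g (Suc n) = (\<lambda>i p. g i p - duhamel 0 (drift lam P (picard lam P g n) i) p)"

text \<open>
  For a globally Lipschitz nonlinearity, the growth rate \<open>2 (L + 2 lam)\<close> makes the Duhamel operator
  small enough for the iteration to contract by the factor \<open>1 / 2\<close>.
\<close>

lemma picard_converges:
  assumes P: "\<And>a b. \<bar>P a - P b\<bar> \<le> L * \<bar>a - b\<bar>" "P 0 = 0" "0 < L" and lam: "0 \<le> lam"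
    and g: "\<And>i. g i \<in> weighted \<alpha> 0"
  shows "\<exists>m. (\<forall>i. m i \<in> weighted \<alpha> (2 * (L + 2 * lam))) \<and> solves lam P g m \<and>
    (\<forall>i p. (\<lambda>n. picard lam P g n i p) \<longlonglongrightarrow> m i p)"
proof -
  define \<Lambda> where "\<Lambda> = L + 2 * lam"
  define B where "B = 2 * \<Lambda>"
  have pos: "0 < \<Lambda>" "0 < B" using P(3) lam by (auto simp: \<Lambda>_def B_def)
  let ?u = "picard lam P g"
  have dW: "drift lam P u i \<in> weighted \<alpha> B" if "\<And>i. u i \<in> weighted \<alpha> B" for u i
    using that P by (intro drift_weighted)
  have uW: "?u n i \<in> weighted \<alpha> B" for n i
  proof (induction n arbitrary: i)
    case 0
    show ?case using weighted_mono[OF g, of B] pos by simp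
  next
    case (Suc n)
    show ?case
      unfolding picard.simps
      by (rule weighted_diff[OF weighted_mono[OF g] duhamel_weighted[OF dW[OF Suc]]]) (use pos in auto)
  qed
  have u_Suc: "?u (Suc n) i p = g i p - duhamel 0 (drift lam P (?u n) i) p" for n i p
    by (simp only: picard.simps)
  have alg: "(a - b) - (a - c) = c - b" for a b c :: real by simp
  have dlip: "\<bar>drift lam P u i p - drift lam P v i p\<bar> \<le> \<Lambda> * c"
    if "\<And>i. \<bar>u i p - v i p\<bar> \<le> c" for u v i p c
  proof -
    have "\<bar>drift lam P u i p - drift lam P v i p\<bar> \<le>
        \<bar>P (u i p) - P (v i p)\<bar> + lam * (\<bar>u i p - v i p\<bar> + \<bar>u (\<not> i) p - v (\<not> i) p\<bar>)"
    proof -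
      have "drift lam P u i p - drift lam P v i p =
          (P (u i p) - P (v i p)) + lam * ((u i p - v i p) - (u (\<not> i) p - v (\<not> i) p))"
        by (simp add: drift_def algebra_simps)
      also have "\<bar>\<dots>\<bar> \<le> \<bar>P (u i p) - P (v i p)\<bar> + lam * \<bar>(u i p - v i p) - (u (\<not> i) p - v (\<not> i) p)\<bar>"
        using lam by (metis abs_triangle_ineq abs_mult abs_of_nonneg)
      also have "\<dots> \<le> \<bar>P (u i p) - P (v i p)\<bar> + lam * (\<bar>u i p - v i p\<bar> + \<bar>u (\<not> i) p - v (\<not> i) p\<bar>)"
        using lam by (intro add_left_mono mult_left_mono) auto
      finally show ?thesis .
    qed
    also have "\<dots> \<le> L * c + lam * (c + c)"
      using that[of i] that[of "\<not> i"] P(1)[of "u i p" "v i p"] P(3) lam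
      by (intro add_mono mult_left_mono) (auto intro: order_trans mult_left_mono)
    finally show ?thesis by (simp add: \<Lambda>_def algebra_simps)
  qed
  obtain C where C: "0 \<le> C" "\<And>i p. \<bar>?u 1 i p - ?u 0 i p\<bar> \<le> C * caloric \<alpha> B p"
  proof -
    have W: "(\<lambda>p. ?u 1 i p - ?u 0 i p) \<in> weighted \<alpha> B" for i by (intro weighted_diff uW)
    obtain C1 where C1: "0 \<le> C1" "\<And>p. \<bar>?u 1 True p - ?u 0 True p\<bar> \<le> C1 * caloric \<alpha> B p" using weightedE[OF W] by blast
    obtain C2 where C2: "0 \<le> C2" "\<And>p. \<bar>?u 1 False p - ?u 0 False p\<bar> \<le> C2 * caloric \<alpha> B p" using weightedE[OF W] by blast
    have "\<bar>?u 1 i p - ?u 0 i p\<bar> \<le> (C1 + C2) * caloric \<alpha> B p" for i p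
    proof (cases i)
      case True
      have "0 \<le> C2 * caloric \<alpha> B p" using C2(1) by simp
      with True C1(2)[of p] show ?thesis by (simp add: distrib_right)
    next
      case False
      have "0 \<le> C1 * caloric \<alpha> B p" using C1(1) by simp
      with False C2(2)[of p] show ?thesis by (simp add: distrib_right)
    qed
    with C1 C2 that[of "C1 + C2"] show thesis by simp
  qed
  have step: "\<bar>?u (Suc n) i p - ?u n i p\<bar> \<le> C / 2 ^ n * caloric \<alpha> B p" for n i p
  proof (induction n arbitrary: i p)
    case 0
    show ?case using C(2)[of i p] by simp
  next
    case (Suc n)
    have "?u (Suc (Suc n)) i p - ?u (Suc n) i p =
        duhamel 0 (drift lam P (?u n) i) p - duhamel 0 (drift lam P (?u (Suc n)) i) p"
      by (simp only: u_Suc alg)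
    also have "\<dots> = duhamel 0 (\<lambda>p. drift lam P (?u n) i p - drift lam P (?u (Suc n)) i p) p"
      by (rule duhamel_diff[OF dW[OF uW] dW[OF uW] order_refl, symmetric])
    also have "\<bar>\<dots>\<bar> \<le> (\<Lambda> * (C / 2 ^ n)) / (0 + B) * caloric \<alpha> B p"
    proof (rule abs_duhamel_le_caloric)
      show "(\<lambda>p. drift lam P (?u n) i p - drift lam P (?u (Suc n)) i p) \<in> borel_measurable borel"
        by (intro weighted_measurable[of _ \<alpha> B] weighted_diff dW uW)
      show "\<bar>drift lam P (?u n) i (y, s) - drift lam P (?u (Suc n)) i (y, s)\<bar> \<le> \<Lambda> * (C / 2 ^ n) * caloric \<alpha> B (y, s)" for y s
        using dlip[of "?u n" "(y, s)" "?u (Suc n)" "C / 2 ^ n * caloric \<alpha> B (y, s)" i] Suc.IH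
        by (simp add: abs_minus_commute mult.assoc)
    qed (use pos C in auto)
    also have "\<dots> = C / 2 ^ Suc n * caloric \<alpha> B p" using pos by (simp add: B_def)
    finally show ?case .
  qed
  have Cauchy: "\<bar>?u n i p - ?u l i p\<bar> \<le> 2 * C / 2 ^ n * caloric \<alpha> B p" if "n \<le> l" for n l i p
  proof -
    have "\<bar>?u n i p - ?u l i p\<bar> \<le> (2 * C / 2 ^ n - 2 * C / 2 ^ l) * caloric \<alpha> B p"
      using that
    proof (induction l rule: dec_induct)
      case (step l)
      have "2 * C / 2 ^ l - 2 * C / 2 ^ Suc l = C / 2 ^ l" by simp
      then have "(2 * C / 2 ^ n - 2 * C / 2 ^ Suc l) * caloric \<alpha> B p
          = (2 * C / 2 ^ n - 2 * C / 2 ^ l) * caloric \<alpha> B p + C / 2 ^ l * caloric \<alpha> B p"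
        by (simp add: algebra_simps)
      then show ?case using step.IH \<open>\<And>n i p. \<bar>?u (Suc n) i p - ?u n i p\<bar> \<le> C / 2 ^ n * caloric \<alpha> B p\<close>[of l i p] by linarith
    qed simp
    also have "\<dots> \<le> 2 * C / 2 ^ n * caloric \<alpha> B p" using C(1) by (intro mult_right_mono) auto
    finally show ?thesis .
  qed
  have "(\<lambda>n. 2 * C * (1 / 2) ^ n) \<longlonglongrightarrow> 2 * C * 0" by (intro tendsto_intros) auto
  then have "(\<lambda>n. 2 * C / 2 ^ n) \<longlonglongrightarrow> 0" by (simp add: power_one_over)
  from weighted_Cauchy[OF uW Cauchy this]
  have "\<forall>i. \<exists>m. m \<in> weighted \<alpha> B \<and> (\<forall>p. (\<lambda>n. ?u n i p) \<longlonglongrightarrow> m p \<and> (\<forall>n. \<bar>?u n i p - m p\<bar> \<le> 2 * C / 2 ^ n * caloric \<alpha> B p))"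
    by blast
  then obtain m where mW: "\<And>i. m i \<in> weighted \<alpha> B" and lim: "\<And>i p. (\<lambda>n. ?u n i p) \<longlonglongrightarrow> m i p"
    and rate: "\<And>i p n. \<bar>?u n i p - m i p\<bar> \<le> 2 * C / 2 ^ n * caloric \<alpha> B p"
    by metis
  have "m i p = g i p - duhamel 0 (drift lam P m i) p" for i p
  proof (rule LIMSEQ_unique)
    show "(\<lambda>n. ?u (Suc n) i p) \<longlonglongrightarrow> m i p" using lim by (rule LIMSEQ_Suc)
    have dm: "drift lam P m i \<in> weighted \<alpha> B" by (rule dW) (rule mW)
    obtain M where M: "\<And>p. \<bar>drift lam P m i p\<bar> \<le> M * caloric \<alpha> B p" using weightedE[OF dm] by blast
    have "(\<lambda>n. duhamel 0 (drift lam P (?u n) i) p) \<longlonglongrightarrow> duhamel 0 (drift lam P m i) p"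
    proof (rule duhamel_tendsto)
      show "drift lam P (?u n) i \<in> borel_measurable borel" for n by (rule weighted_measurable[OF dW[OF uW]])
      have D: "\<bar>drift lam P (?u n) i p - drift lam P m i p\<bar> \<le> \<Lambda> * (2 * C / 2 ^ n * caloric \<alpha> B p)" for n p
        by (rule dlip[OF rate])
      show "\<bar>drift lam P (?u n) i p\<bar> \<le> (M + \<Lambda> * (2 * C)) * caloric \<alpha> B p" for n p
      proof -
        have "2 * C / 2 ^ n \<le> 2 * C / 1" using C(1) by (intro divide_left_mono) auto
        then have "\<Lambda> * (2 * C / 2 ^ n * caloric \<alpha> B p) \<le> \<Lambda> * (2 * C * caloric \<alpha> B p)"
          using pos by (intro mult_left_mono mult_right_mono) auto
        then show ?thesis using D[of n p] M[of p] by (simp add: distrib_right mult.assoc)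
      qed
      fix p
      have "(\<lambda>n. drift lam P (?u n) i p - drift lam P m i p) \<longlonglongrightarrow> 0"
      proof (rule Lim_null_comparison)
        show "\<forall>\<^sub>F n in sequentially. norm (drift lam P (?u n) i p - drift lam P m i p) \<le> \<Lambda> * (2 * C / 2 ^ n * caloric \<alpha> B p)"
          using D by (intro always_eventually allI) simp
        have "(\<lambda>n. \<Lambda> * (2 * C / 2 ^ n * caloric \<alpha> B p)) \<longlonglongrightarrow> \<Lambda> * (0 * caloric \<alpha> B p)"
          by (intro tendsto_intros \<open>(\<lambda>n. 2 * C / 2 ^ n) \<longlonglongrightarrow> 0\<close>)
        then show "(\<lambda>n. \<Lambda> * (2 * C / 2 ^ n * caloric \<alpha> B p)) \<longlonglongrightarrow> 0" by simp
      qed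
      then show "(\<lambda>n. drift lam P (?u n) i p) \<longlonglongrightarrow> drift lam P m i p" by (rule LIM_zero_cancel)
    qed simp
    then show "(\<lambda>n. ?u (Suc n) i p) \<longlonglongrightarrow> g i p - duhamel 0 (drift lam P m i) p"
      by (auto intro!: tendsto_intros)
  qed
  then have "solves lam P g m" by (simp add: solves_def)
  with mW lim show ?thesis unfolding B_def \<Lambda>_def by blast
qed

section \<open>Subexponential growth\<close>

text \<open>
  Membership in the weighted spaces for all weights at once.  The class is closed under sums
  and products, hence under the cubic.
\<close>

definition subexp :: "(real \<times> real \<Rightarrow> real) \<Rightarrow> bool" where
  "subexp q \<longleftrightarrow> (\<forall>\<epsilon>>0. \<exists>C. \<forall>x t. \<bar>q (x, t)\<bar> \<le> C * exp (\<epsilon> * (\<bar>x\<bar> + max t 0)))"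

lemma subexpE:
  assumes "subexp q" "0 < \<epsilon>"
  obtains C where "0 \<le> C" "\<And>x t. \<bar>q (x, t)\<bar> \<le> C * exp (\<epsilon> * (\<bar>x\<bar> + max t 0))"
proof -
  from assms obtain C where C: "\<And>x t. \<bar>q (x, t)\<bar> \<le> C * exp (\<epsilon> * (\<bar>x\<bar> + max t 0))"
    unfolding subexp_def by blast
  have "0 \<le> C" using order_trans[OF abs_ge_zero C[of 0 0]] by simp
  with C that show thesis by blast
qed

lemma subexp_dominated: "subexp q \<Longrightarrow> (\<And>p. \<bar>r p\<bar> \<le> \<bar>q p\<bar>) \<Longrightarrow> subexp r"
  unfolding subexp_def by (meson order_trans)

lemma subexp_const: "subexp (\<lambda>p. c)"
  unfolding subexp_def
proof (intro allI impI exI[of _ "\<bar>c\<bar>"])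
  fix \<epsilon> x t :: real assume "0 < \<epsilon>"
  then have "1 \<le> exp (\<epsilon> * (\<bar>x\<bar> + max t 0))" by simp
  then show "\<bar>c\<bar> \<le> \<bar>c\<bar> * exp (\<epsilon> * (\<bar>x\<bar> + max t 0))" by (intro mult_left_mono[of 1 _ "\<bar>c\<bar>", simplified]) auto
qed

lemma subexp_add:
  assumes "subexp q" "subexp r" shows "subexp (\<lambda>p. q p + r p)"
  unfolding subexp_def
proof (intro allI impI)
  fix \<epsilon> :: real assume \<epsilon>: "0 < \<epsilon>"
  obtain C where C: "0 \<le> C" "\<And>x t. \<bar>q (x, t)\<bar> \<le> C * exp (\<epsilon> * (\<bar>x\<bar> + max t 0))" by (rule subexpE[OF assms(1) \<epsilon>]) (rule that)
  obtain D where D: "0 \<le> D" "\<And>x t. \<bar>r (x, t)\<bar> \<le> D * exp (\<epsilon> * (\<bar>x\<bar> + max t 0))" by (rule subexpE[OF assms(2) \<epsilon>]) (rule that)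
  have "\<bar>q (x, t) + r (x, t)\<bar> \<le> (C + D) * exp (\<epsilon> * (\<bar>x\<bar> + max t 0))" for x t
    using C(2)[of x t] D(2)[of x t] abs_triangle_ineq[of "q (x, t)" "r (x, t)"] unfolding distrib_right by linarith
  then show "\<exists>C. \<forall>x t. \<bar>q (x, t) + r (x, t)\<bar> \<le> C * exp (\<epsilon> * (\<bar>x\<bar> + max t 0))" by blast
qed

lemma subexp_mult:
  assumes "subexp q" "subexp r" shows "subexp (\<lambda>p. q p * r p)"
  unfolding subexp_def
proof (intro allI impI)
  fix \<epsilon> :: real assume "0 < \<epsilon>"
  then have \<epsilon>: "0 < \<epsilon> / 2" by simp
  obtain C where C: "0 \<le> C" "\<And>x t. \<bar>q (x, t)\<bar> \<le> C * exp (\<epsilon> / 2 * (\<bar>x\<bar> + max t 0))" by (rule subexpE[OF assms(1) \<epsilon>]) (rule that)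
  obtain D where D: "0 \<le> D" "\<And>x t. \<bar>r (x, t)\<bar> \<le> D * exp (\<epsilon> / 2 * (\<bar>x\<bar> + max t 0))" by (rule subexpE[OF assms(2) \<epsilon>]) (rule that)
  have "\<bar>q (x, t) * r (x, t)\<bar> \<le> (C * D) * exp (\<epsilon> * (\<bar>x\<bar> + max t 0))" for x t
  proof -
    have "\<bar>q (x, t) * r (x, t)\<bar> \<le> (C * exp (\<epsilon> / 2 * (\<bar>x\<bar> + max t 0))) * (D * exp (\<epsilon> / 2 * (\<bar>x\<bar> + max t 0)))"
      unfolding abs_mult using C D by (intro mult_mono) auto
    also have "\<dots> = (C * D) * (exp (\<epsilon> / 2 * (\<bar>x\<bar> + max t 0)) * exp (\<epsilon> / 2 * (\<bar>x\<bar> + max t 0)))" by simp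
    also have "exp (\<epsilon> / 2 * (\<bar>x\<bar> + max t 0)) * exp (\<epsilon> / 2 * (\<bar>x\<bar> + max t 0)) = exp (\<epsilon> * (\<bar>x\<bar> + max t 0))"
      by (simp flip: exp_add)
    finally show ?thesis .
  qed
  then show "\<exists>C. \<forall>x t. \<bar>q (x, t) * r (x, t)\<bar> \<le> C * exp (\<epsilon> * (\<bar>x\<bar> + max t 0))" by blast
qed

lemma subexp_power: "subexp q \<Longrightarrow> subexp (\<lambda>p. q p ^ n)"
  by (induction n) (simp_all add: subexp_const subexp_mult)

lemma subexp_abs: "subexp q \<Longrightarrow> subexp (\<lambda>p. \<bar>q p\<bar>)"
  by (simp add: subexp_def)

lemma subexp_diff: "subexp q \<Longrightarrow> subexp r \<Longrightarrow> subexp (\<lambda>p. q p - r p)"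
  using subexp_add[of q "\<lambda>p. (- 1) * r p"] subexp_mult[OF subexp_const[of "- 1"], of r] by simp

lemma exp_abs_le_cosh: "exp \<bar>c\<bar> \<le> 2 * cosh (c::real)"
  by (cases "c \<ge> 0") (auto simp: cosh_def)

text \<open>
  \<open>\<epsilon> = min \<alpha> (\<alpha>\<^sup>2 / 2)\<close> is what the caloric weight allows in space and in time.
\<close>

lemma subexp_caloric:
  assumes "subexp q" "0 < \<alpha>" "0 \<le> B"
  obtains C where "0 \<le> C" "\<And>p. \<bar>q p\<bar> \<le> C * caloric \<alpha> B p"
proof -
  define \<epsilon> where "\<epsilon> = min \<alpha> (\<alpha>\<^sup>2 / 2)"
  have "0 < \<epsilon>" using assms by (simp add: \<epsilon>_def)
  then obtain C where C: "0 \<le> C" "\<And>x t. \<bar>q (x, t)\<bar> \<le> C * exp (\<epsilon> * (\<bar>x\<bar> + max t 0))"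
    by (rule subexpE[OF assms(1)]) (rule that)
  have "\<bar>q p\<bar> \<le> (2 * C) * caloric \<alpha> B p" for p
  proof (cases p)
    case (Pair x t)
    have "\<epsilon> * \<bar>x\<bar> \<le> \<bar>\<alpha> * x\<bar>" unfolding abs_mult by (rule mult_right_mono) (auto simp: \<epsilon>_def)
    moreover have "\<epsilon> * max t 0 \<le> (\<alpha>\<^sup>2 / 2 + B) * max t 0" using assms by (intro mult_right_mono) (auto simp: \<epsilon>_def)
    ultimately have "exp (\<epsilon> * (\<bar>x\<bar> + max t 0)) \<le> exp ((\<alpha>\<^sup>2 / 2 + B) * max t 0) * exp \<bar>\<alpha> * x\<bar>"
      by (simp add: distrib_left flip: exp_add)
    also have "\<dots> \<le> exp ((\<alpha>\<^sup>2 / 2 + B) * max t 0) * (2 * cosh (\<alpha> * x))"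
      by (intro mult_left_mono exp_abs_le_cosh) simp
    finally have "C * exp (\<epsilon> * (\<bar>x\<bar> + max t 0)) \<le> C * (2 * caloric \<alpha> B p)"
      using C(1) by (intro mult_left_mono) (simp_all add: Pair caloric_def)
    with C(2)[of x t] show ?thesis by (simp add: Pair)
  qed
  with C(1) that[of "2 * C"] show thesis by simp
qed

lemma subexp_weighted:
  assumes "subexp q" "continuous_on UNIV q" "0 < \<alpha>" "0 \<le> B"
  shows "q \<in> weighted \<alpha> B"
  using subexp_caloric[OF assms(1,3,4)] weightedI[OF assms(2)] by metis

lemma subexpI_caloric:
  assumes "\<And>\<alpha>. 0 < \<alpha> \<Longrightarrow> \<exists>C. \<forall>p. \<bar>q p\<bar> \<le> C * caloric \<alpha> \<alpha> p"
  shows "subexp q"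
  unfolding subexp_def
proof (intro allI impI)
  fix \<epsilon> :: real assume "0 < \<epsilon>"
  \<comment> \<open>With \<open>\<alpha> \<le> 1\<close> the exponent \<open>\<alpha>\<^sup>2 / 2 + \<alpha>\<close> of the time is at most \<open>2 \<alpha>\<close>.\<close>
  define \<alpha> where "\<alpha> = min 1 (\<epsilon> / 2)"
  have \<alpha>: "0 < \<alpha>" "\<alpha> \<le> 1" "2 * \<alpha> \<le> \<epsilon>" using \<open>0 < \<epsilon>\<close> by (auto simp: \<alpha>_def)
  obtain C where C: "\<And>p. \<bar>q p\<bar> \<le> C * caloric \<alpha> \<alpha> p" using assms[OF \<alpha>(1)] by blast
  have C0: "0 \<le> C" by (rule caloric_scalar_nonneg[OF order_trans[OF abs_ge_zero C]])
  have "\<bar>q (x, t)\<bar> \<le> C * exp (\<epsilon> * (\<bar>x\<bar> + max t 0))" for x t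
  proof -
    have "\<alpha>\<^sup>2 \<le> \<alpha>" using \<alpha> by (simp add: power2_eq_square mult_left_le)
    then have "(\<alpha>\<^sup>2 / 2 + \<alpha>) * max t 0 \<le> \<epsilon> * max t 0" using \<alpha> by (intro mult_right_mono) auto
    moreover have "\<bar>\<alpha> * x\<bar> \<le> \<epsilon> * \<bar>x\<bar>" unfolding abs_mult using \<alpha> by (intro mult_right_mono) auto
    ultimately have "exp ((\<alpha>\<^sup>2 / 2 + \<alpha>) * max t 0) * exp \<bar>\<alpha> * x\<bar> \<le> exp (\<epsilon> * (\<bar>x\<bar> + max t 0))"
      by (simp add: distrib_left flip: exp_add)
    moreover have "caloric \<alpha> \<alpha> (x, t) \<le> exp ((\<alpha>\<^sup>2 / 2 + \<alpha>) * max t 0) * exp \<bar>\<alpha> * x\<bar>"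
      unfolding caloric_def by (simp add: cosh_le_exp_abs)
    ultimately have "C * caloric \<alpha> \<alpha> (x, t) \<le> C * exp (\<epsilon> * (\<bar>x\<bar> + max t 0))"
      using C0 by (intro mult_left_mono) auto
    with C[of "(x, t)"] show ?thesis by linarith
  qed
  then show "\<exists>C. \<forall>x t. \<bar>q (x, t)\<bar> \<le> C * exp (\<epsilon> * (\<bar>x\<bar> + max t 0))" by blast
qed

text \<open>
  The truncation error involves the fourth power of the solution.  It is measured with the weight
  \<open>caloric 1 2\<close> of \<open>truncation_stability\<close>, so the solution is bounded with a smaller weight.
\<close>

lemma caloric_fourth_power: "caloric (1/4) (1/8) p ^ 4 \<le> 2 * caloric 1 2 p"
proof (cases p)
  case (Pair x t)
  have "cosh (1/4 * x) ^ 4 \<le> exp \<bar>1/4 * x\<bar> ^ 4" by (intro power_mono cosh_le_exp_abs) simp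
  also have "\<dots> = exp \<bar>x\<bar>" by (simp flip: exp_of_nat_mult)
  also have "\<dots> \<le> 2 * cosh x" by (rule exp_abs_le_cosh)
  finally have 1: "cosh (1/4 * x) ^ 4 \<le> 2 * cosh (1 * x)" by simp
  have 2: "exp (((1/4)\<^sup>2 / 2 + 1/8) * max t 0) ^ 4 \<le> exp ((1\<^sup>2 / 2 + 2) * max t (0::real))"
    by (simp add: power2_eq_square flip: exp_of_nat_mult)
  have "exp (((1/4)\<^sup>2 / 2 + 1/8) * max t 0) ^ 4 * cosh (1/4 * x) ^ 4 \<le> exp ((1\<^sup>2 / 2 + 2) * max t 0) * (2 * cosh (1 * x))"
    by (rule mult_mono[OF 2 1]) auto
  then show ?thesis unfolding Pair caloric_def case_prod_conv power_mult_distrib by (simp only: mult.left_commute[of 2])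
qed

lemma one_le_caloric: "0 \<le> B \<Longrightarrow> 1 \<le> caloric \<alpha> B p"
  unfolding caloric_def case_prod_beta
  by (rule mult_ge1_I[OF _ cosh_real_ge_1]) simp

lemma continuous_on_V': "continuous_on S V'"
  unfolding V'_def by (intro continuous_intros)

section \<open>Removing the truncation\<close>

text \<open>
  Both limits are defined without reference to convergence, so that measurability
  in the random parameter holds for every outcome.  The truncation height \<open>k + 1\<close> is at least 1.
\<close>

definition trunc_solution where
  "trunc_solution lam g k i p = lim (\<lambda>n. picard lam (cut_V' (real (Suc k))) g n i p)"

definition solution where
  "solution lam g i p = lim (\<lambda>k. trunc_solution lam g k i p)"

context
  fixes lam :: real and g :: "bool \<Rightarrow> real \<times> real \<Rightarrow> real"
  assumes lam: "0 \<le> lam" and gc: "\<And>i. continuous_on UNIV (g i)" and gs: "\<And>i. subexp (g i)"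
begin

text \<open>
  The limit of the iterates does not mention the weight, so one and the same function lies in the
  weighted spaces for all \<open>\<alpha>\<close>.
\<close>

lemma trunc_solution_exists:
  assumes "0 < \<alpha>"
  shows "trunc_solution lam g k i \<in> weighted \<alpha> (2 * (3 * (real (Suc k))\<^sup>2 + 2 * lam))"
    and "solves lam (cut_V' (real (Suc k))) g (trunc_solution lam g k)"
proof -
  have R: "1 \<le> real (Suc k)" by simp
  have "g i \<in> weighted \<alpha> 0" for i
    using assms by (intro subexp_weighted gs gc) auto
  moreover have "0 < 3 * (real (Suc k))\<^sup>2" by simp
  ultimately have "\<exists>m. (\<forall>i. m i \<in> weighted \<alpha> (2 * (3 * (real (Suc k))\<^sup>2 + 2 * lam))) \<and>
      solves lam (cut_V' (real (Suc k))) g m \<and> (\<forall>i p. (\<lambda>n. picard lam (cut_V' (real (Suc k))) g n i p) \<longlonglongrightarrow> m i p)"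
    by (intro picard_converges[OF cut_V'_lipschitz[OF R] _ _ lam]) auto
  then obtain m where m: "\<And>i. m i \<in> weighted \<alpha> (2 * (3 * (real (Suc k))\<^sup>2 + 2 * lam))"
    "solves lam (cut_V' (real (Suc k))) g m"
    "\<And>i p. (\<lambda>n. picard lam (cut_V' (real (Suc k))) g n i p) \<longlonglongrightarrow> m i p"
    by blast
  have "trunc_solution lam g k = m"
    unfolding trunc_solution_def using limI[OF m(3)] by (simp add: fun_eq_iff)
  with m(1,2) show "trunc_solution lam g k i \<in> weighted \<alpha> (2 * (3 * (real (Suc k))\<^sup>2 + 2 * lam))"
    "solves lam (cut_V' (real (Suc k))) g (trunc_solution lam g k)" by auto
qed

lemma trunc_solution_uniform_bound:
  assumes "0 < \<alpha>" "0 < \<delta>"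
  obtains C where "0 \<le> C" "\<And>k i p. \<bar>trunc_solution lam g k i p\<bar> \<le> C * caloric \<alpha> \<delta> p"
proof -
  have s: "subexp (\<lambda>p. (1 + \<bar>g i p\<bar> + \<bar>g i p\<bar> ^ 3 + lam * \<bar>g i p - g (\<not> i) p\<bar>) + \<bar>g i p\<bar>)" for i
    by (intro subexp_add subexp_mult subexp_power subexp_abs subexp_diff subexp_const gs)
  obtain F1 where F1: "0 \<le> F1" "\<And>p. \<bar>(1 + \<bar>g True p\<bar> + \<bar>g True p\<bar> ^ 3 + lam * \<bar>g True p - g (\<not> True) p\<bar>) + \<bar>g True p\<bar>\<bar> \<le> F1 * caloric \<alpha> \<delta> p"
    by (rule subexp_caloric[OF s assms(1) less_imp_le[OF assms(2)]]) (rule that)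
  obtain F2 where F2: "0 \<le> F2" "\<And>p. \<bar>(1 + \<bar>g False p\<bar> + \<bar>g False p\<bar> ^ 3 + lam * \<bar>g False p - g (\<not> False) p\<bar>) + \<bar>g False p\<bar>\<bar> \<le> F2 * caloric \<alpha> \<delta> p"
    by (rule subexp_caloric[OF s assms(1) less_imp_le[OF assms(2)]]) (rule that)
  define F where "F = max F1 F2"
  have F: "(1 + \<bar>g i p\<bar> + \<bar>g i p\<bar> ^ 3 + lam * \<bar>g i p - g (\<not> i) p\<bar>) + \<bar>g i p\<bar> \<le> F * caloric \<alpha> \<delta> p" for i p
  proof (cases i)
    case True
    have "F1 * caloric \<alpha> \<delta> p \<le> F * caloric \<alpha> \<delta> p" by (rule mult_right_mono) (simp_all add: F_def)
    moreover have "i = True" using True by simp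
    ultimately show ?thesis using F1(2)[of p] by (simp only:)
  next
    case False
    have "F2 * caloric \<alpha> \<delta> p \<le> F * caloric \<alpha> \<delta> p" by (rule mult_right_mono) (simp_all add: F_def)
    moreover have "i = False" using False by simp
    ultimately show ?thesis using F2(2)[of p] by (simp only:)
  qed
  have F0: "0 \<le> F" using F1(1) by (simp add: F_def)
  have "\<bar>trunc_solution lam g k i p\<bar> \<le> (2 * F / \<delta> + F) * caloric \<alpha> \<delta> p" for k i p
  proof -
    have pos: "0 < 2 * (3 * (real (Suc k))\<^sup>2 + 2 * lam)"
      using lam by (intro mult_pos_pos add_pos_nonneg) auto
    have "\<bar>trunc_solution lam g k i p - g i p\<bar> \<le> 2 * F / \<delta> * caloric \<alpha> \<delta> p"
    proof (rule apriori_bound[OF _ lam trunc_solution_exists(2)[OF assms(1)] trunc_solution_exists(1)[OF assms(1)] pos F0 _ assms(2)])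
      show "1 + \<bar>g i p\<bar> + \<bar>g i p\<bar> ^ 3 + lam * \<bar>g i p - g (\<not> i) p\<bar> \<le> F * caloric \<alpha> \<delta> p" for i p
        using F[of i p] by linarith
    qed simp
    moreover have "\<bar>g i p\<bar> \<le> F * caloric \<alpha> \<delta> p"
    proof -
      have "0 \<le> 1 + \<bar>g i p\<bar> + \<bar>g i p\<bar> ^ 3 + lam * \<bar>g i p - g (\<not> i) p\<bar>" using lam by (intro add_nonneg_nonneg) auto
      with F[of i p] show ?thesis by linarith
    qed
    ultimately show ?thesis by (simp add: distrib_right)
  qed
  with F0 assms(2) that[of "2 * F / \<delta> + F"] show thesis by simp
qed

lemma trunc_solution_weighted:
  assumes "0 < \<alpha>" "0 < \<delta>"
  shows "trunc_solution lam g k i \<in> weighted \<alpha> \<delta>"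
proof -
  obtain C where "0 \<le> C" "\<And>k i p. \<bar>trunc_solution lam g k i p\<bar> \<le> C * caloric \<alpha> \<delta> p"
    by (rule trunc_solution_uniform_bound[OF assms]) (rule that)
  then show ?thesis
    by (intro weightedI[OF weighted_continuous[OF trunc_solution_exists(1)[OF assms(1)]]])
qed

lemma trunc_solution_fourth_power:
  obtains E where "0 \<le> E" "\<And>k i p. \<bar>trunc_solution lam g k i p\<bar> ^ 4 \<le> E * caloric 1 2 p"
proof -
  obtain C where C: "0 \<le> C" "\<And>k i p. \<bar>trunc_solution lam g k i p\<bar> \<le> C * caloric (1/4) (1/8) p"
    by (rule trunc_solution_uniform_bound[of "1/4" "1/8"]) (simp_all add: that)
  have "\<bar>trunc_solution lam g k i p\<bar> ^ 4 \<le> (2 * C ^ 4) * caloric 1 2 p" for k i p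
  proof -
    have "\<bar>trunc_solution lam g k i p\<bar> ^ 4 \<le> (C * caloric (1/4) (1/8) p) ^ 4" by (intro power_mono C) simp
    also have "\<dots> \<le> C ^ 4 * (2 * caloric 1 2 p)"
      unfolding power_mult_distrib by (intro mult_left_mono caloric_fourth_power) (simp add: C)
    finally show ?thesis by simp
  qed
  with that[of "2 * C ^ 4"] show thesis by simp
qed

text \<open>
  Every solution for a nonlinearity that agrees with the truncated one up to \<open>O (1 / k)\<close> is close to the
  truncated solution.  It is applied to truncated solutions at larger heights (existence) and to
  solutions of the full system (uniqueness).
\<close>

lemma trunc_solution_rate:
  assumes n: "solves lam P g n" "\<And>i. drift lam P n i \<in> weighted 1 1"
    and E: "0 \<le> E" "\<And>i p. \<bar>P (n i p) - cut_V' (real (Suc k)) (n i p)\<bar> \<le> E / real (Suc k) * caloric 1 2 p"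
  shows "\<bar>n i p - trunc_solution lam g k i p\<bar> \<le> 2 * E / real (Suc k) * caloric 1 2 p"
proof -
  have "\<bar>n i p - trunc_solution lam g k i p\<bar> \<le> 2 * (E / real (Suc k)) * caloric 1 2 p"
    by (rule truncation_stability[OF _ lam n(1) trunc_solution_exists(2)[OF zero_less_one] n(2)
        trunc_solution_weighted zero_less_one _ E(2)]) (use E(1) in auto)
  then show ?thesis by simp
qed

lemma rate_tendsto_0: "(\<lambda>k. c / real (Suc k)) \<longlonglongrightarrow> 0"
  using tendsto_mult[OF tendsto_const[of c] LIMSEQ_inverse_real_of_nat] by (simp add: divide_inverse)

lemma solution_limit:
  "solution lam g i \<in> weighted 1 2" "(\<lambda>k. trunc_solution lam g k i p) \<longlonglongrightarrow> solution lam g i p"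
proof -
  obtain E where E: "0 \<le> E" "\<And>k i p. \<bar>trunc_solution lam g k i p\<bar> ^ 4 \<le> E * caloric 1 2 p"
    by (rule trunc_solution_fourth_power) (rule that)
  have Cauchy: "\<bar>trunc_solution lam g k i p - trunc_solution lam g l i p\<bar> \<le> 2 * E / real (Suc k) * caloric 1 2 p" if "k \<le> l" for k l p
  proof -
    have R: "1 \<le> real (Suc l)" by simp
    have "\<bar>trunc_solution lam g l i p - trunc_solution lam g k i p\<bar> \<le> 2 * E / real (Suc k) * caloric 1 2 p"
    proof (rule trunc_solution_rate[OF trunc_solution_exists(2)[OF zero_less_one] _ E(1)])
      show "drift lam (cut_V' (real (Suc l))) (trunc_solution lam g l) i \<in> weighted 1 1" for i
        by (rule drift_weighted[OF trunc_solution_weighted cut_V'_lipschitz[OF R]]) auto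
      show "\<bar>cut_V' (real (Suc l)) (trunc_solution lam g l i p) - cut_V' (real (Suc k)) (trunc_solution lam g l i p)\<bar>
          \<le> E / real (Suc k) * caloric 1 2 p" for i p
      proof -
        have "\<bar>cut_V' (real (Suc l)) (trunc_solution lam g l i p) - cut_V' (real (Suc k)) (trunc_solution lam g l i p)\<bar>
            \<le> \<bar>trunc_solution lam g l i p\<bar> ^ 4 / real (Suc k)"
          using that by (intro cut_V'_truncation_error) auto
        also have "\<dots> \<le> E * caloric 1 2 p / real (Suc k)" by (intro divide_right_mono E) simp
        finally show ?thesis by simp
      qed
    qed
    then show ?thesis by (simp add: abs_minus_commute)
  qed
  obtain m where m: "m \<in> weighted 1 2" "\<And>p. (\<lambda>k. trunc_solution lam g k i p) \<longlonglongrightarrow> m p"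
    using weighted_Cauchy[OF trunc_solution_weighted Cauchy rate_tendsto_0] by auto
  have "solution lam g i = m"
    unfolding solution_def using limI[OF m(2)] by (simp add: fun_eq_iff)
  with m show "solution lam g i \<in> weighted 1 2" "(\<lambda>k. trunc_solution lam g k i p) \<longlonglongrightarrow> solution lam g i p"
    by auto
qed

lemma solution_continuous: "continuous_on UNIV (solution lam g i)"
  by (rule weighted_continuous[OF solution_limit(1)])

lemma solution_subexp: "subexp (solution lam g i)"
proof (rule subexpI_caloric)
  fix \<alpha> :: real assume \<alpha>: "0 < \<alpha>"
  obtain C where C: "0 \<le> C" "\<And>k i p. \<bar>trunc_solution lam g k i p\<bar> \<le> C * caloric \<alpha> \<alpha> p"
    by (rule trunc_solution_uniform_bound[OF \<alpha> \<alpha>]) (rule that)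
  have "\<bar>solution lam g i p\<bar> \<le> C * caloric \<alpha> \<alpha> p" for p
    by (rule LIMSEQ_le_const2[OF tendsto_rabs[OF solution_limit(2)]]) (use C(2) in blast)
  then show "\<exists>C. \<forall>p. \<bar>solution lam g i p\<bar> \<le> C * caloric \<alpha> \<alpha> p" by blast
qed

text \<open>
  Passage to the limit in the Duhamel integral by dominated convergence; the powers up to 4 of the
  truncated solutions have a common bound by \<open>caloric 1 2\<close>.
\<close>

lemma solution_solves: "solves lam V' g (solution lam g)"
  unfolding solves_def
proof (intro allI)
  fix i p
  obtain E where E: "0 \<le> E" "\<And>k i p. \<bar>trunc_solution lam g k i p\<bar> ^ 4 \<le> E * caloric 1 2 p"
    by (rule trunc_solution_fourth_power) (rule that)
  let ?P = "\<lambda>k. cut_V' (real (Suc k))" and ?u = "trunc_solution lam g"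
  have low: "\<bar>?u k i p\<bar> ^ j \<le> (1 + E) * caloric 1 2 p" if "j \<le> 4" for k i p j
  proof -
    have "\<bar>?u k i p\<bar> ^ j \<le> 1 + \<bar>?u k i p\<bar> ^ 4"
    proof (cases "\<bar>?u k i p\<bar> \<le> 1")
      case True
      then have "\<bar>?u k i p\<bar> ^ j \<le> 1" by (simp add: power_le_one)
      then show ?thesis by (simp add: add_increasing2)
    next
      case False
      then have "\<bar>?u k i p\<bar> ^ j \<le> \<bar>?u k i p\<bar> ^ 4" using that by (intro power_increasing) auto
      then show ?thesis by simp
    qed
    also have "\<dots> \<le> caloric 1 2 p + E * caloric 1 2 p" by (intro add_mono one_le_caloric E) simp
    finally show ?thesis by (simp add: distrib_right)
  qed
  have "(\<lambda>k. duhamel 0 (drift lam (?P k) (?u k) i) p) \<longlonglongrightarrow> duhamel 0 (drift lam V' (solution lam g) i) p"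
  proof (rule duhamel_tendsto)
    fix k
    have R: "1 \<le> real (Suc k)" by simp
    have "drift lam (?P k) (?u k) i \<in> weighted 1 1"
      by (rule drift_weighted[OF trunc_solution_weighted cut_V'_lipschitz[OF R]]) auto
    then show "drift lam (?P k) (?u k) i \<in> borel_measurable borel" by (rule weighted_measurable)
  next
    fix k p
    have "\<bar>drift lam (?P k) (?u k) i p\<bar> \<le> \<bar>?P k (?u k i p)\<bar> + lam * \<bar>?u k i p - ?u k (\<not> i) p\<bar>"
      unfolding drift_def using lam by (metis abs_triangle_ineq abs_mult abs_of_nonneg)
    also have "\<dots> \<le> (\<bar>?u k i p\<bar> ^ 3 + \<bar>?u k i p\<bar>) + lam * (\<bar>?u k i p\<bar> + \<bar>?u k (\<not> i) p\<bar>)"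
      using lam by (intro add_mono mult_left_mono abs_cut_V'_le) auto
    also have "\<dots> \<le> ((1 + E) * caloric 1 2 p + (1 + E) * caloric 1 2 p) + lam * ((1 + E) * caloric 1 2 p + (1 + E) * caloric 1 2 p)"
      using low[of 3] low[of 1] lam by (intro add_mono mult_left_mono) auto
    also have "\<dots> = ((2 + 2 * lam) * (1 + E)) * caloric 1 2 p" by (simp add: algebra_simps)
    finally show "\<bar>drift lam (?P k) (?u k) i p\<bar> \<le> ((2 + 2 * lam) * (1 + E)) * caloric 1 2 p" .
  next
    fix p
    have lim: "(\<lambda>k. ?u k i p) \<longlonglongrightarrow> solution lam g i p" for i by (rule solution_limit(2))
    have "(\<lambda>k. V' (?u k i p)) \<longlonglongrightarrow> V' (solution lam g i p)"
      using continuous_on_V'[of UNIV] lim[of i] unfolding continuous_on_sequentially o_def by simp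
    moreover have "(\<lambda>k. ?P k (?u k i p) - V' (?u k i p)) \<longlonglongrightarrow> 0"
    proof (rule Lim_null_comparison)
      show "\<forall>\<^sub>F k in sequentially. norm (?P k (?u k i p) - V' (?u k i p)) \<le> E * caloric 1 2 p / real (Suc k)"
      proof (intro always_eventually allI)
        fix k
        have "\<bar>V' (?u k i p) - ?P k (?u k i p)\<bar> \<le> \<bar>?u k i p\<bar> ^ 4 / real (Suc k)"
          by (intro V'_truncation_error) simp
        also have "\<dots> \<le> E * caloric 1 2 p / real (Suc k)" by (intro divide_right_mono E) simp
        finally show "norm (?P k (?u k i p) - V' (?u k i p)) \<le> E * caloric 1 2 p / real (Suc k)"
          by (simp add: abs_minus_commute)
      qed
    qed (rule rate_tendsto_0)
    ultimately have "(\<lambda>k. (?P k (?u k i p) - V' (?u k i p)) + V' (?u k i p)) \<longlonglongrightarrow> 0 + V' (solution lam g i p)"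
      by (intro tendsto_add)
    then have "(\<lambda>k. ?P k (?u k i p)) \<longlonglongrightarrow> V' (solution lam g i p)" by simp
    then show "(\<lambda>k. drift lam (?P k) (?u k) i p) \<longlonglongrightarrow> drift lam V' (solution lam g) i p"
      unfolding drift_def by (intro tendsto_intros lim)
  qed simp
  then have "(\<lambda>k. g i p - duhamel 0 (drift lam (?P k) (?u k) i) p) \<longlonglongrightarrow> g i p - duhamel 0 (drift lam V' (solution lam g) i) p"
    by (intro tendsto_intros)
  then have "(\<lambda>k. ?u k i p) \<longlonglongrightarrow> g i p - duhamel 0 (drift lam V' (solution lam g) i) p"
    by (simp only: solvesD[OF trunc_solution_exists(2)[OF zero_less_one], symmetric])
  then show "solution lam g i p = g i p - duhamel 0 (drift lam V' (solution lam g) i) p"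
    by (rule LIMSEQ_unique[OF solution_limit(2)])
qed

text \<open>
  Any solution is the limit of the truncated solutions, which are constructed from the
  data alone.
\<close>

lemma solution_unique:
  assumes n: "solves lam V' g n" and c: "\<And>i. continuous_on UNIV (n i)" and s: "\<And>i. subexp (n i)"
  shows "n i p = solution lam g i p"
proof -
  have W: "drift lam V' n i \<in> weighted 1 1" for i
  proof (rule subexp_weighted)
    show "subexp (drift lam V' n i)"
      unfolding drift_def V'_def by (intro subexp_add subexp_mult subexp_diff subexp_power subexp_const s)
    show "continuous_on UNIV (drift lam V' n i)"
      unfolding drift_def V'_def by (intro continuous_intros c)
  qed auto
  \<comment> \<open>One function that dominates both components, to obtain a common constant.\<close>
  have s4: "subexp (\<lambda>p. n True p ^ 4 + n False p ^ 4)" by (intro subexp_add subexp_power s)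
  obtain E where E: "0 \<le> E" "\<And>p. \<bar>n True p ^ 4 + n False p ^ 4\<bar> \<le> E * caloric 1 2 p"
    by (rule subexp_caloric[OF s4, of 1 2]) (simp_all add: that)
  have n4: "\<bar>n i p\<bar> ^ 4 \<le> E * caloric 1 2 p" for i p
  proof -
    have "0 \<le> n True p ^ 4" "0 \<le> n False p ^ 4" by simp_all
    with E(2)[of p] have "n True p ^ 4 \<le> E * caloric 1 2 p" "n False p ^ 4 \<le> E * caloric 1 2 p" by linarith+
    then show ?thesis by (cases "i = True") (simp_all add: power_even_abs)
  qed
  have rate: "\<bar>n i p - trunc_solution lam g k i p\<bar> \<le> 2 * E / real (Suc k) * caloric 1 2 p" for k
  proof (rule trunc_solution_rate[OF n W E(1)])
    fix i p
    have "\<bar>V' (n i p) - cut_V' (real (Suc k)) (n i p)\<bar> \<le> \<bar>n i p\<bar> ^ 4 / real (Suc k)"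
      by (intro V'_truncation_error) simp
    also have "\<dots> \<le> E * caloric 1 2 p / real (Suc k)" by (intro divide_right_mono n4) simp
    finally show "\<bar>V' (n i p) - cut_V' (real (Suc k)) (n i p)\<bar> \<le> E / real (Suc k) * caloric 1 2 p" by simp
  qed
  have "(\<lambda>k. trunc_solution lam g k i p - n i p) \<longlonglongrightarrow> 0"
  proof (rule Lim_null_comparison)
    show "\<forall>\<^sub>F k in sequentially. norm (trunc_solution lam g k i p - n i p) \<le> 2 * E / real (Suc k) * caloric 1 2 p"
      using rate by (intro always_eventually allI) (simp add: abs_minus_commute)
    show "(\<lambda>k. 2 * E / real (Suc k) * caloric 1 2 p) \<longlonglongrightarrow> 0"
      using rate_tendsto_0[of "2 * E * caloric 1 2 p"] by simp
  qed
  then have "(\<lambda>k. trunc_solution lam g k i p) \<longlonglongrightarrow> n i p" by (rule LIM_zero_cancel)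
  then show ?thesis by (rule LIMSEQ_unique[OF _ solution_limit(2)])
qed

end

section \<open>The mild equations as a Duhamel system\<close>

text \<open>
  Functions on \<open>\<real> \<times> \<real>\<^sup>+\<close> are made functions on the plane by freezing them before time 0.
\<close>

definition ext :: "(real \<times> real \<Rightarrow> real) \<Rightarrow> real \<times> real \<Rightarrow> real" where
  "ext q p = q (fst p, max (snd p) 0)"

lemma ext_continuous:
  assumes "continuous_on spacetime q"
  shows "continuous_on UNIV (ext q)"
  unfolding ext_def
  by (rule continuous_on_compose2[OF assms]) (auto intro!: continuous_intros simp: spacetime_def)

lemma le_mult_exp: "exp (- e) * a \<le> C \<Longrightarrow> a \<le> C * exp (e::real)"
  by (simp add: exp_minus divide_simps)

lemma C_spaceD:
  assumes "f \<in> C_space \<alpha>"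
  obtains C where "0 \<le> C" "\<And>x. \<bar>f x\<bar> \<le> C * exp (\<alpha> * \<bar>x\<bar>)"
proof -
  have "space_norm \<alpha> f < \<infinity>" using assms by (simp add: C_space_def)
  then obtain C where C: "0 \<le> C" "space_norm \<alpha> f = ennreal C" by (cases "space_norm \<alpha> f") auto
  have "\<bar>f x\<bar> \<le> C * exp (\<alpha> * \<bar>x\<bar>)" for x
  proof -
    have "ennreal (exp (- \<alpha> * \<bar>x\<bar>) * \<bar>f x\<bar>) \<le> space_norm \<alpha> f"
      unfolding space_norm_def by (rule SUP_upper) simp
    then have "exp (- \<alpha> * \<bar>x\<bar>) * \<bar>f x\<bar> \<le> C" using C by simp
    then have "exp (- (\<alpha> * \<bar>x\<bar>)) * \<bar>f x\<bar> \<le> C" by simp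
    then show ?thesis by (rule le_mult_exp)
  qed
  with C(1) show thesis by (rule that)
qed

lemma C_spacetimeD:
  assumes "q \<in> C_spacetime \<alpha>"
  obtains C where "0 \<le> C" "\<And>x t. 0 \<le> t \<Longrightarrow> \<bar>q (x, t)\<bar> \<le> C * exp (\<alpha>\<^sup>2 / 2 * t + \<alpha> * \<bar>x\<bar>)"
proof -
  have "spacetime_norm \<alpha> q < \<infinity>" using assms by (simp add: C_spacetime_def)
  then obtain C where C: "0 \<le> C" "spacetime_norm \<alpha> q = ennreal C" by (cases "spacetime_norm \<alpha> q") auto
  have "\<bar>q (x, t)\<bar> \<le> C * exp (\<alpha>\<^sup>2 / 2 * t + \<alpha> * \<bar>x\<bar>)" if t: "0 \<le> t" for x t
  proof -
    let ?e = "\<alpha>\<^sup>2 / 2 * t + \<alpha> * \<bar>x\<bar>"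
    have "ennreal (exp (- (\<alpha>\<^sup>2 / 2) * t - \<alpha> * \<bar>x\<bar>) * \<bar>q (x, t)\<bar>)
        \<le> (SUP x. ennreal (exp (- (\<alpha>\<^sup>2 / 2) * t - \<alpha> * \<bar>x\<bar>) * \<bar>q (x, t)\<bar>))"
      by (rule SUP_upper) simp
    also have "\<dots> \<le> spacetime_norm \<alpha> q"
      unfolding spacetime_norm_def by (rule SUP_upper) (use t in simp)
    finally have "exp (- ?e) * \<bar>q (x, t)\<bar> \<le> C" using C by simp
    then show ?thesis by (rule le_mult_exp)
  qed
  with C(1) show thesis by (rule that)
qed

lemma C_spacetime_subexp:
  assumes "\<And>\<alpha>. 0 < \<alpha> \<Longrightarrow> q \<in> C_spacetime \<alpha>"
  shows "subexp (ext q)"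
  unfolding subexp_def
proof (intro allI impI)
  fix \<epsilon> :: real assume "0 < \<epsilon>"
  define \<alpha> where "\<alpha> = min 1 \<epsilon>"
  have \<alpha>: "0 < \<alpha>" "\<alpha> \<le> 1" "\<alpha> \<le> \<epsilon>" using \<open>0 < \<epsilon>\<close> by (auto simp: \<alpha>_def)
  obtain C where C: "0 \<le> C" "\<And>x t. 0 \<le> t \<Longrightarrow> \<bar>q (x, t)\<bar> \<le> C * exp (\<alpha>\<^sup>2 / 2 * t + \<alpha> * \<bar>x\<bar>)"
    by (rule C_spacetimeD[OF assms[OF \<alpha>(1)]]) (rule that)
  have "\<bar>ext q (x, t)\<bar> \<le> C * exp (\<epsilon> * (\<bar>x\<bar> + max t 0))" for x t
  proof -
    have "\<alpha>\<^sup>2 \<le> \<alpha>" using \<alpha> by (simp add: power2_eq_square mult_left_le)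
    then have "\<alpha>\<^sup>2 / 2 * max t 0 \<le> \<epsilon> * max t 0" using \<alpha> by (intro mult_right_mono) auto
    moreover have "\<alpha> * \<bar>x\<bar> \<le> \<epsilon> * \<bar>x\<bar>" using \<alpha> by (intro mult_right_mono) auto
    ultimately have "C * exp (\<alpha>\<^sup>2 / 2 * max t 0 + \<alpha> * \<bar>x\<bar>) \<le> C * exp (\<epsilon> * (\<bar>x\<bar> + max t 0))"
      using C(1) by (intro mult_left_mono) (simp_all add: distrib_left)
    then show ?thesis using C(2)[of "max t 0" x] by (simp add: ext_def)
  qed
  then show "\<exists>C. \<forall>x t. \<bar>ext q (x, t)\<bar> \<le> C * exp (\<epsilon> * (\<bar>x\<bar> + max t 0))" by blast
qed

lemma subexp_C_spacetime:
  assumes c: "continuous_on UNIV q" and s: "subexp q" and \<alpha>: "0 < \<alpha>"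
  shows "q \<in> C_spacetime \<alpha>"
proof -
  define \<epsilon> where "\<epsilon> = min \<alpha> (\<alpha>\<^sup>2 / 2)"
  have "0 < \<epsilon>" using \<alpha> by (simp add: \<epsilon>_def)
  then obtain C where C: "0 \<le> C" "\<And>x t. \<bar>q (x, t)\<bar> \<le> C * exp (\<epsilon> * (\<bar>x\<bar> + max t 0))"
    by (rule subexpE[OF s]) (rule that)
  have "spacetime_norm \<alpha> q \<le> ennreal C"
    unfolding spacetime_norm_def
  proof (intro SUP_least ennreal_leI)
    fix t x :: real assume "t \<in> {0..}"
    then have t: "0 \<le> t" "max t 0 = t" by auto
    have "\<epsilon> * t \<le> \<alpha>\<^sup>2 / 2 * t" by (rule mult_right_mono) (use t in \<open>simp_all add: \<epsilon>_def\<close>)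
    moreover have "\<epsilon> * \<bar>x\<bar> \<le> \<alpha> * \<bar>x\<bar>" by (rule mult_right_mono) (simp_all add: \<epsilon>_def)
    ultimately have e: "(- (\<alpha>\<^sup>2 / 2) * t - \<alpha> * \<bar>x\<bar>) + \<epsilon> * (\<bar>x\<bar> + t) \<le> 0" by (simp add: distrib_left)
    have "exp (- (\<alpha>\<^sup>2 / 2) * t - \<alpha> * \<bar>x\<bar>) * \<bar>q (x, t)\<bar> \<le> exp (- (\<alpha>\<^sup>2 / 2) * t - \<alpha> * \<bar>x\<bar>) * (C * exp (\<epsilon> * (\<bar>x\<bar> + t)))"
      using C(2)[of x t] t by (intro mult_left_mono) auto
    also have "\<dots> = C * exp ((- (\<alpha>\<^sup>2 / 2) * t - \<alpha> * \<bar>x\<bar>) + \<epsilon> * (\<bar>x\<bar> + t))" by (simp only: exp_add mult.left_commute)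
    also have "\<dots> \<le> C * 1" using e C(1) by (intro mult_left_mono) auto
    finally show "exp (- (\<alpha>\<^sup>2 / 2) * t - \<alpha> * \<bar>x\<bar>) * \<bar>q (x, t)\<bar> \<le> C" by simp
  qed
  then have "spacetime_norm \<alpha> q < \<infinity>" using ennreal_less_top le_less_trans by fastforce
  then show ?thesis using continuous_on_subset[OF c] by (simp add: C_spacetime_def)
qed

text \<open>
  \<open>H\<^sub>t\<close> maps \<open>cosh (\<alpha> x)\<close> to \<open>exp (\<alpha>\<^sup>2 t / 2) cosh (\<alpha> x)\<close>; that this holds for every \<open>\<alpha> > 0\<close> also gives
  the subexponential growth in time.
\<close>

lemma heat_initial_datum:
  assumes u0: "\<And>\<alpha>. 0 < \<alpha> \<Longrightarrow> u0 \<in> C_space \<alpha>"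
  shows "continuous_on UNIV (\<lambda>p. heat (max (snd p) 0) u0 (fst p))" (is "continuous_on _ ?h")
    and "subexp (\<lambda>p. heat (max (snd p) 0) u0 (fst p))"
proof -
  have c0: "continuous_on UNIV u0" using u0[of 1] by (simp add: C_space_def)
  have C: "\<exists>C\<ge>0. \<forall>x. \<bar>u0 x\<bar> \<le> C * cosh (\<alpha> * x)" if \<alpha>: "0 < \<alpha>" for \<alpha>
  proof -
    obtain C where C: "0 \<le> C" "\<And>x. \<bar>u0 x\<bar> \<le> C * exp (\<alpha> * \<bar>x\<bar>)" by (rule C_spaceD[OF u0[OF \<alpha>]]) (rule that)
    have "\<bar>u0 x\<bar> \<le> (2 * C) * cosh (\<alpha> * x)" for x
    proof -
      have "C * exp \<bar>\<alpha> * x\<bar> \<le> C * (2 * cosh (\<alpha> * x))" by (intro mult_left_mono exp_abs_le_cosh C)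
      then show ?thesis using C(2)[of x] \<alpha> by (simp add: abs_mult)
    qed
    with C(1) show ?thesis by (intro exI[of _ "2 * C"]) auto
  qed
  define q where "q p = u0 (fst p)" for p :: "real \<times> real"
  have q: "q \<in> weighted 1 0"
  proof -
    obtain C where C: "0 \<le> C" "\<And>x. \<bar>u0 x\<bar> \<le> C * cosh (1 * x)" using C[of 1] by auto
    show ?thesis
    proof (rule weightedI)
      show "continuous_on UNIV q"
        unfolding q_def by (rule continuous_on_compose2[OF c0]) (auto intro: continuous_intros)
      fix p :: "real \<times> real"
      have "1 * cosh (1 * fst p) \<le> caloric 1 0 p"
        unfolding caloric_def case_prod_beta by (intro mult_right_mono) auto
      then show "\<bar>q p\<bar> \<le> C * caloric 1 0 p"
        using C(2)[of "fst p"] mult_left_mono[OF _ C(1)] by (fastforce simp: q_def intro: order_trans)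
    qed
  qed
  have "continuous_on UNIV (\<lambda>p. heat (max (snd p) 0) (\<lambda>y. q (y, 0)) (fst p))"
    by (rule continuous_on_heat_compose[OF q]) (intro continuous_intros)+
  then show "continuous_on UNIV ?h" by (simp add: q_def)
  show "subexp ?h"
  proof (rule subexpI_caloric)
    fix \<alpha> :: real assume \<alpha>: "0 < \<alpha>"
    obtain C where C0: "0 \<le> C" "\<And>x. \<bar>u0 x\<bar> \<le> C * cosh (\<alpha> * x)" using C[OF \<alpha>] by auto
    have "\<bar>heat T u0 x\<bar> \<le> C * (exp (\<alpha>\<^sup>2 / 2 * T) * cosh (\<alpha> * x))" if T: "0 \<le> T" for T x
    proof -
      note gc = gauss_cosh[OF T, of \<alpha> x]
      have [measurable]: "u0 \<in> borel_measurable borel" by (rule borel_measurable_continuous_onI[OF c0])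
      have i: "integrable gauss (\<lambda>z. C * cosh (\<alpha> * (x + sqrt T * z)))"
        by (intro integrable_mult_right gc)
      have "integrable gauss (\<lambda>z. u0 (x + sqrt T * z))"
        by (rule Bochner_Integration.integrable_bound[OF i]) (auto intro!: order_trans[OF C0(2) abs_ge_self] simp: AE_I2)
      from integral_abs_bound_integral[OF this i C0(2)] gc(2) T
      show ?thesis by (simp add: heat_def)
    qed
    from this[of "max (snd p) 0" "fst p" for p]
    have "\<bar>?h p\<bar> \<le> C * caloric \<alpha> 0 p" for p by (simp add: caloric_def case_prod_beta)
    then have "\<bar>?h p\<bar> \<le> C * caloric \<alpha> \<alpha> p" for p
      using mult_left_mono[OF caloric_mono[of 0 \<alpha> \<alpha> p] C0(1)] \<alpha> by (meson less_imp_le order_trans)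
    then show "\<exists>C. \<forall>p. \<bar>?h p\<bar> \<le> C * caloric \<alpha> \<alpha> p" by blast
  qed
qed

lemma mild_equation_iff:
  assumes u0: "continuous_on UNIV u0"
    and u: "\<And>\<alpha>. 0 < \<alpha> \<Longrightarrow> u \<in> C_spacetime \<alpha>" and v: "\<And>\<alpha>. 0 < \<alpha> \<Longrightarrow> v \<in> C_spacetime \<alpha>"
  shows "mild_equation lam u0 z u v \<longleftrightarrow>
    (\<forall>p. ext u p = (heat (max (snd p) 0) u0 (fst p) + ext z p) -
       duhamel 0 (\<lambda>p. V' (ext u p) + lam * (ext u p - ext v p)) p)"
proof -
  define q where "q p = V' (ext u p) + lam * (ext u p - ext v p)" for p
  have c: "continuous_on UNIV (ext u)" "continuous_on UNIV (ext v)"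
    using u[of 1] v[of 1] by (auto intro!: ext_continuous simp: C_spacetime_def)
  have qc: "continuous_on UNIV q" unfolding q_def V'_def by (intro continuous_intros c)
  have "subexp q"
    unfolding q_def V'_def
    by (intro subexp_add subexp_mult subexp_diff subexp_power subexp_const C_spacetime_subexp u v)
  then have qW: "q \<in> weighted 1 1" using qc by (intro subexp_weighted) auto
  have eq: "(u (x, t) = heat_semigroup t u0 x
        - (LBINT s:{0..t}. heat_semigroup (t - s) (\<lambda>y. V' (u (y, s)) + lam * (u (y, s) - v (y, s))) x) + z (x, t))
      \<longleftrightarrow> u (x, t) = (heat t u0 x + z (x, t)) - duhamel 0 q (x, t)" if t: "0 \<le> t" for x t
  proof -
    have "heat_semigroup t u0 x = heat t u0 x"
      by (rule heat_semigroup_eq_heat[OF borel_measurable_continuous_onI[OF u0] t])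
    moreover have "(LBINT s:{0..t}. heat_semigroup (t - s) (\<lambda>y. V' (u (y, s)) + lam * (u (y, s) - v (y, s))) x)
        = (LBINT s:{0..t}. exp (- 0 * (t - s)) * heat (t - s) (\<lambda>y. q (y, s)) x)"
      unfolding set_lebesgue_integral_def
    proof (intro Bochner_Integration.integral_cong refl)
      fix s
      have "heat_semigroup (t - s) (\<lambda>y. V' (u (y, s)) + lam * (u (y, s) - v (y, s))) x = heat (t - s) (\<lambda>y. q (y, s)) x"
        if s: "s \<in> {0..t}"
      proof -
        have "(\<lambda>y. V' (u (y, s)) + lam * (u (y, s) - v (y, s))) = (\<lambda>y. q (y, s))"
          using s by (simp add: q_def ext_def)
        moreover have "(\<lambda>y. q (y, s)) \<in> borel_measurable borel"
          by (rule borel_measurable_continuous_onI, rule continuous_on_compose2[OF qc]) (auto intro: continuous_intros)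
        ultimately show ?thesis using s by (simp add: heat_semigroup_eq_heat)
      qed
      then show "indicator {0..t} s *\<^sub>R heat_semigroup (t - s) (\<lambda>y. V' (u (y, s)) + lam * (u (y, s) - v (y, s))) x =
          indicator {0..t} s *\<^sub>R (exp (- 0 * (t - s)) * heat (t - s) (\<lambda>y. q (y, s)) x)"
        by (cases "s \<in> {0..t}") auto
    qed
    moreover have "\<dots> = duhamel 0 q (x, t)" by (rule duhamel_eq_set_integral[OF qW order_refl t, symmetric])
    ultimately show ?thesis by simp linarith
  qed
  have D: "duhamel 0 q (x, t) = duhamel 0 q (x, max t 0)" for x t by (simp add: duhamel_def lookback_def)
  show ?thesis
  proof
    assume m: "mild_equation lam u0 z u v"
    show "\<forall>p. ext u p = heat (max (snd p) 0) u0 (fst p) + ext z p - duhamel 0 (\<lambda>p. V' (ext u p) + lam * (ext u p - ext v p)) p"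
    proof
      fix p :: "real \<times> real"
      obtain x t where p: "p = (x, t)" by fastforce
      have "u (x, max t 0) = heat (max t 0) u0 x + z (x, max t 0) - duhamel 0 q (x, max t 0)"
        using m eq[of "max t 0" x] unfolding mild_equation_def by simp
      then show "ext u p = heat (max (snd p) 0) u0 (fst p) + ext z p - duhamel 0 (\<lambda>p. V' (ext u p) + lam * (ext u p - ext v p)) p"
        unfolding q_def[symmetric] p using D[of x t] by (simp add: ext_def)
    qed
  next
    assume r: "\<forall>p. ext u p = heat (max (snd p) 0) u0 (fst p) + ext z p - duhamel 0 (\<lambda>p. V' (ext u p) + lam * (ext u p - ext v p)) p"
    show "mild_equation lam u0 z u v"
      unfolding mild_equation_def
    proof (intro allI impI)
      fix t x :: real assume t: "0 \<le> t"
      have "ext u (x, t) = heat (max t 0) u0 x + ext z (x, t) - duhamel 0 q (x, t)"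
        using r[rule_format, of "(x, t)"] unfolding q_def[symmetric] by simp
      then show "u (x, t) = heat_semigroup t u0 x
        - (LBINT s:{0..t}. heat_semigroup (t - s) (\<lambda>y. V' (u (y, s)) + lam * (u (y, s) - v (y, s))) x) + z (x, t)"
        unfolding eq[OF t] using t by (simp add: ext_def)
    qed
  qed
qed

section \<open>Progressive measurability\<close>

text \<open>
  Joint measurability in the outcome and in spacetime up to time \<open>t\<close>, with respect to the
  information at time \<open>t\<close>.  Adaptedness alone is not preserved by the Duhamel integral, because the
  integration over spacetime needs joint measurability.
\<close>

definition progressive :: "(real \<Rightarrow> 'w measure) \<Rightarrow> ('w \<Rightarrow> real \<times> real \<Rightarrow> real) \<Rightarrow> bool" where
  "progressive \<F> m \<longleftrightarrow>
     (\<forall>t\<ge>0. (\<lambda>v. m (fst v) (fst (snd v), min (snd (snd v)) t)) \<in> borel_measurable (\<F> t \<Otimes>\<^sub>M borel))"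

lemma fst_snd_borel [measurable]:
  "fst \<in> borel_measurable (borel :: (real \<times> real) measure)"
  "snd \<in> borel_measurable (borel :: (real \<times> real) measure)"
  by (auto intro!: borel_measurable_continuous_onI continuous_intros)

lemma progressive_adapted:
  assumes "progressive \<F> m" shows "adapted \<F> m"
  unfolding adapted_def
proof (intro allI impI)
  fix t x :: real assume "0 \<le> t"
  then have "(\<lambda>v. m (fst v) (fst (snd v), min (snd (snd v)) t)) \<in> borel_measurable (\<F> t \<Otimes>\<^sub>M borel)"
    using assms by (simp add: progressive_def)
  from measurable_compose[OF _ this, of "\<lambda>\<omega>. (\<omega>, (x, t))"]
  show "(\<lambda>\<omega>. m \<omega> (x, t)) \<in> borel_measurable (\<F> t)" by simp
qed

text \<open>
  At time at most \<open>t\<close> the backward path only visits times at most \<open>t\<close>.  A parameter integral of a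
  jointly measurable function is measurable whether or not it converges.
\<close>

lemma progressive_duhamel:
  assumes q: "progressive \<F> q"
  shows "progressive \<F> (\<lambda>\<omega>. duhamel K (q \<omega>))"
  unfolding progressive_def
proof (intro allI impI)
  fix t :: real assume t: "0 \<le> t"
  let ?N = "\<F> t \<Otimes>\<^sub>M (borel :: (real \<times> real) measure)"
  define b where "b = (\<lambda>(p :: real \<times> real) w. (fst (lookback (fst p, min (snd p) t) w), snd (lookback (fst p, min (snd p) t) w)))"
  have qm: "(\<lambda>v. q (fst v) (fst (snd v), min (snd (snd v)) t)) \<in> borel_measurable ?N"
    using q t by (simp add: progressive_def)
  have "continuous_on UNIV (\<lambda>(p, w). b p w)"
    unfolding b_def lookback_def case_prod_beta by (intro continuous_intros)
  then have bm: "(\<lambda>(p, w). b p w) \<in> borel \<rightarrow>\<^sub>M borel" by (rule borel_measurable_continuous_onI)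
  have pw: "(\<lambda>v. (snd (fst v), snd v)) \<in> ?N \<Otimes>\<^sub>M lookback_law \<rightarrow>\<^sub>M borel"
  proof -
    have "(\<lambda>v. (snd (fst v), snd v)) \<in> ?N \<Otimes>\<^sub>M lookback_law \<rightarrow>\<^sub>M borel \<Otimes>\<^sub>M borel"
      by (intro measurable_Pair measurable_compose[OF measurable_snd id_lookback_law]) measurable
    then show ?thesis by (simp add: borel_prod)
  qed
  have "(\<lambda>v. b (snd (fst v)) (snd v)) \<in> ?N \<Otimes>\<^sub>M lookback_law \<rightarrow>\<^sub>M borel"
    using measurable_compose[OF pw bm] by simp
  then have "(\<lambda>v. (fst (fst v), b (snd (fst v)) (snd v))) \<in> ?N \<Otimes>\<^sub>M lookback_law \<rightarrow>\<^sub>M \<F> t \<Otimes>\<^sub>M borel"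
    by measurable
  from measurable_compose[OF this qm]
  have qb[measurable]: "(\<lambda>v. q (fst (fst v)) (fst (b (snd (fst v)) (snd v)), min (snd (b (snd (fst v)) (snd v))) t))
      \<in> borel_measurable (?N \<Otimes>\<^sub>M lookback_law)" by simp
  have [measurable]: "(\<lambda>v. fst (snd v)) \<in> borel_measurable (?N \<Otimes>\<^sub>M lookback_law)"
    by (rule measurable_compose[OF measurable_snd fst_lookback_law])
  have "(\<lambda>v. duhamel K (q (fst v)) (fst (snd v), min (snd (snd v)) t)) =
    (\<lambda>v. max (min (snd (snd v)) t) 0 * (\<integral>w. exp (- K * max (min (snd (snd v)) t) 0 * fst w) *
       q (fst v) (fst (b (snd v) w), min (snd (b (snd v) w)) t) \<partial>lookback_law))"
  proof (rule ext)
    fix v :: "'a \<times> real \<times> real"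
    have "min (snd (b (snd v) w)) t = snd (b (snd v) w)" if "w \<in> space lookback_law" for w
      using snd_lookback_le[OF that, of "(fst (snd v), min (snd (snd v)) t)"] t by (auto simp: b_def)
    then show "duhamel K (q (fst v)) (fst (snd v), min (snd (snd v)) t) =
        max (min (snd (snd v)) t) 0 * (\<integral>w. exp (- K * max (min (snd (snd v)) t) 0 * fst w) *
       q (fst v) (fst (b (snd v) w), min (snd (b (snd v) w)) t) \<partial>lookback_law)"
      by (auto simp: duhamel_def case_prod_beta b_def intro!: Bochner_Integration.integral_cong)
  qed
  also have "\<dots> \<in> borel_measurable ?N"
  proof (intro borel_measurable_times lookback_law.borel_measurable_lebesgue_integral)
    show "(\<lambda>v. max (min (snd (snd v)) t) 0) \<in> borel_measurable ?N" by measurable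
    show "(\<lambda>(v, w). exp (- K * max (min (snd (snd v)) t) 0 * fst w) *
       q (fst v) (fst (b (snd v) w), min (snd (b (snd v) w)) t)) \<in> borel_measurable (?N \<Otimes>\<^sub>M lookback_law)"
      unfolding case_prod_beta by measurable
  qed
  finally show "(\<lambda>v. duhamel K (q (fst v)) (fst (snd v), min (snd (snd v)) t)) \<in> borel_measurable ?N" .
qed

text \<open>
  A continuous field is the limit of its values at the grid points to the lower left.  They are
  countably many and do not lie in the future.
\<close>

lemma progressive_continuous:
  assumes c: "\<And>t \<omega>. \<omega> \<in> space (\<F> t) \<Longrightarrow> continuous_on UNIV (ext (z \<omega>))"
    and m: "\<And>x s t. 0 \<le> s \<Longrightarrow> s \<le> t \<Longrightarrow> (\<lambda>\<omega>. z \<omega> (x, s)) \<in> borel_measurable (\<F> t)"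
  shows "progressive \<F> (\<lambda>\<omega>. ext (z \<omega>))"
  unfolding progressive_def
proof (intro allI impI)
  fix t :: real assume t: "0 \<le> t"
  let ?N = "\<F> t \<Otimes>\<^sub>M (borel :: (real \<times> real) measure)"
  define T where "T s = max (min s t) 0" for s
  define f where "f n y = real_of_int \<lfloor>real (Suc n) * y\<rfloor> / real (Suc n)" for n y
  have f_le: "f n y \<le> y" for n y
    unfolding f_def by (simp add: divide_le_eq mult.commute)
  have f_nonneg: "0 \<le> f n y" if "0 \<le> y" for n y
    using that by (simp add: f_def)
  have f_lim: "(\<lambda>n. f n y) \<longlonglongrightarrow> y" for y
  proof -
    have "(\<lambda>n. f n y - y) \<longlonglongrightarrow> 0"
    proof (rule Lim_null_comparison)
      show "\<forall>\<^sub>F n in sequentially. norm (f n y - y) \<le> inverse (real (Suc n))"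
      proof (intro always_eventually allI)
        fix n
        have "f n y - y = (real_of_int \<lfloor>real (Suc n) * y\<rfloor> - real (Suc n) * y) / real (Suc n)"
          by (simp add: f_def diff_divide_distrib)
        moreover have "\<bar>real_of_int \<lfloor>real (Suc n) * y\<rfloor> - real (Suc n) * y\<bar> \<le> 1" by linarith
        ultimately show "norm (f n y - y) \<le> inverse (real (Suc n))"
          by (simp add: divide_le_eq inverse_eq_divide del: of_nat_Suc)
      qed
      show "(\<lambda>n. inverse (real (Suc n))) \<longlonglongrightarrow> 0" by (rule LIMSEQ_inverse_real_of_nat)
    qed
    then show ?thesis by (rule LIM_zero_cancel)
  qed
  define Z where "Z n v = z (fst v) (f n (fst (snd v)), f n (T (snd (snd v))))" for n and v :: "'a \<times> real \<times> real"
  have "(\<lambda>v. ext (z (fst v)) (fst (snd v), min (snd (snd v)) t)) \<in> borel_measurable ?N"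
  proof (rule borel_measurable_LIMSEQ_real)
    fix n
    define a where "a j k \<omega> = z \<omega> (real_of_int j / real (Suc n), T (real_of_int k / real (Suc n)))" for j k \<omega>
    have am: "(\<lambda>v. a (fst jk) (snd jk) (fst v)) \<in> borel_measurable ?N" for jk
      unfolding a_def using t by (intro measurable_compose[OF measurable_fst m]) (auto simp: T_def)
    define J where "J v = (\<lfloor>real (Suc n) * fst (snd v)\<rfloor>, \<lfloor>real (Suc n) * T (snd (snd v))\<rfloor>)" for v :: "'a \<times> real \<times> real"
    have "(\<lambda>v. (\<lambda>jk v. a (fst jk) (snd jk) (fst v)) (J v) v) \<in> borel_measurable ?N"
    proof (rule measurable_compose_countable[OF am])
      have "J \<in> ?N \<rightarrow>\<^sub>M count_space UNIV \<Otimes>\<^sub>M count_space UNIV"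
        unfolding J_def T_def by measurable
      then show "J \<in> ?N \<rightarrow>\<^sub>M count_space UNIV"
        by (simp add: pair_measure_countable)
    qed
    moreover have "T (f n (T s)) = f n (T s)" for s
      using f_le[of n "T s"] f_nonneg[of "T s" n] t by (auto simp: T_def)
    ultimately show "Z n \<in> borel_measurable ?N"
      by (simp add: Z_def[abs_def] a_def J_def f_def)
  next
    fix v assume "v \<in> space ?N"
    then have v: "fst v \<in> space (\<F> t)" by (auto simp: space_pair_measure)
    have "(\<lambda>n. (f n (fst (snd v)), f n (T (snd (snd v))))) \<longlonglongrightarrow> (fst (snd v), T (snd (snd v)))"
      by (intro tendsto_Pair f_lim)
    then have "(\<lambda>n. ext (z (fst v)) (f n (fst (snd v)), f n (T (snd (snd v))))) \<longlonglongrightarrow> ext (z (fst v)) (fst (snd v), T (snd (snd v)))"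
      using c[OF v] unfolding continuous_on_sequentially o_def by blast
    moreover have "0 \<le> f n (T (snd (snd v)))" for n by (rule f_nonneg) (simp add: T_def)
    then have "ext (z (fst v)) (f n (fst (snd v)), f n (T (snd (snd v)))) = Z n v" for n
      by (simp add: Z_def ext_def)
    moreover have "ext (z (fst v)) (fst (snd v), T (snd (snd v))) = ext (z (fst v)) (fst (snd v), min (snd (snd v)) t)"
      by (simp add: ext_def T_def)
    ultimately show "(\<lambda>n. Z n v) \<longlonglongrightarrow> ext (z (fst v)) (fst (snd v), min (snd (snd v)) t)"
      by simp
  qed
  then show "(\<lambda>v. ext (z (fst v)) (fst (snd v), min (snd (snd v)) t)) \<in> borel_measurable ?N" .
qed

lemma progressive_deterministic:
  assumes "continuous_on UNIV q" shows "progressive \<F> (\<lambda>\<omega>. q)"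
  unfolding progressive_def
proof (intro allI impI)
  fix t :: real
  have "continuous_on UNIV (\<lambda>p. q (fst p, min (snd p) t))"
    by (rule continuous_on_compose2[OF assms]) (auto intro!: continuous_intros)
  from measurable_compose[OF measurable_snd borel_measurable_continuous_onI[OF this]]
  show "(\<lambda>v. q (fst (snd v), min (snd (snd v)) t)) \<in> borel_measurable (\<F> t \<Otimes>\<^sub>M borel)" .
qed

lemma progressive_add: "progressive \<F> q \<Longrightarrow> progressive \<F> r \<Longrightarrow> progressive \<F> (\<lambda>\<omega> p. q \<omega> p + r \<omega> p)"
  and progressive_diff: "progressive \<F> q \<Longrightarrow> progressive \<F> r \<Longrightarrow> progressive \<F> (\<lambda>\<omega> p. q \<omega> p - r \<omega> p)"
  and progressive_cmult: "progressive \<F> q \<Longrightarrow> progressive \<F> (\<lambda>\<omega> p. c * q \<omega> p)"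
  by (auto simp: progressive_def intro!: borel_measurable_add borel_measurable_diff borel_measurable_times)

lemma progressive_compose:
  assumes "P \<in> borel_measurable borel" "progressive \<F> q"
  shows "progressive \<F> (\<lambda>\<omega> p. P (q \<omega> p))"
  using assms measurable_compose[OF _ assms(1)] by (auto simp: progressive_def)

lemma progressive_lim:
  assumes "\<And>n. progressive \<F> (q n)"
  shows "progressive \<F> (\<lambda>\<omega> p. lim (\<lambda>n. q n \<omega> p))"
  using assms by (auto simp: progressive_def intro!: borel_measurable_lim_metric)

lemma progressive_picard:
  assumes P: "P \<in> borel_measurable borel" and g: "\<And>i. progressive \<F> (\<lambda>\<omega>. g \<omega> i)"
  shows "progressive \<F> (\<lambda>\<omega>. picard lam P (g \<omega>) n i)"
proof (induction n arbitrary: i)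
  case 0
  show ?case by (simp add: g)
next
  case (Suc n)
  have "progressive \<F> (\<lambda>\<omega>. drift lam P (picard lam P (g \<omega>) n) i)"
    unfolding drift_def
    by (intro progressive_add progressive_cmult progressive_diff progressive_compose[OF P] Suc)
  from progressive_diff[OF g progressive_duhamel[OF this]]
  show ?case by simp
qed

lemma progressive_solution:
  assumes g: "\<And>i. progressive \<F> (\<lambda>\<omega>. g \<omega> i)"
  shows "progressive \<F> (\<lambda>\<omega>. solution lam (g \<omega>) i)"
  unfolding solution_def trunc_solution_def
proof (intro progressive_lim progressive_picard g)
  fix k
  show "cut_V' (real (Suc k)) \<in> borel_measurable borel"
    unfolding cut_V'_def V'_def trunc_def by measurable
qed

lemma noise_filtration_measurable:
  assumes "Z \<in> {Z1, Z2}" "0 \<le> s" "s \<le> t"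
  shows "(\<lambda>\<omega>. Z \<omega> (x, s)) \<in> borel_measurable (noise_filtration M Z1 Z2 t)"
proof (rule measurableI)
  fix B :: "real set" assume B: "B \<in> sets borel"
  have "(\<lambda>\<omega>. Z \<omega> (x, s)) -` B \<inter> space M \<in> {(\<lambda>\<omega>. Z \<omega> (x, s)) -` B \<inter> space M | Z x s B.
        Z \<in> {Z1, Z2} \<and> 0 \<le> s \<and> s \<le> t \<and> B \<in> sets borel}"
    using assms B by blast
  then show "(\<lambda>\<omega>. Z \<omega> (x, s)) -` B \<inter> space (noise_filtration M Z1 Z2 t) \<in> sets (noise_filtration M Z1 Z2 t)"
    unfolding noise_filtration_def by (subst sets_measure_of) (auto simp: space_measure_of_conv intro!: sigma_sets.Basic)
qed simp

section \<open>Moments of white noise increments\<close>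

lemma centred_gaussian_moment:
  assumes "0 \<le> v" "0 < k"
  shows "(\<integral>\<^sup>+x. ennreal (x ^ (2 * k)) \<partial>centred_gaussian v) = ennreal (fact (2 * k) / (2 ^ k * fact k) * v ^ k)"
proof (cases "v = 0")
  case True
  then show ?thesis using assms(2) by (simp add: centred_gaussian_def nn_integral_return power_0_left)
next
  case False
  with assms have v: "0 < v" by simp
  then have m: "has_bochner_integral lborel (\<lambda>x. normal_density 0 (sqrt v) x * (x - 0) ^ (2 * k))
      (fact (2 * k) / ((2 / (sqrt v)\<^sup>2) ^ k * fact k))"
    by (intro normal_moment_even) simp
  have "(\<integral>\<^sup>+x. ennreal (x ^ (2 * k)) \<partial>centred_gaussian v) =
      (\<integral>\<^sup>+x. ennreal (normal_density 0 (sqrt v) x) * ennreal (x ^ (2 * k)) \<partial>lborel)"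
    using v by (simp add: centred_gaussian_def nn_integral_density)
  also have "\<dots> = (\<integral>\<^sup>+x. ennreal (normal_density 0 (sqrt v) x * (x - 0) ^ (2 * k)) \<partial>lborel)"
    by (simp add: ennreal_mult)
  also have "\<dots> = ennreal (fact (2 * k) / ((2 / (sqrt v)\<^sup>2) ^ k * fact k))"
    using m by (subst nn_integral_eq_integral) (auto simp: has_bochner_integral_iff)
  also have "fact (2 * k) / ((2 / (sqrt v)\<^sup>2) ^ k * fact k) = fact (2 * k) / (2 ^ k * fact k) * v ^ k"
    using v by (simp add: power_divide field_simps)
  finally show ?thesis .
qed

lemma centred_gaussian_moment':
  assumes "X \<in> borel_measurable M" "distr M borel X = centred_gaussian v" "0 \<le> v" "0 < k"
  shows "(\<integral>\<^sup>+\<omega>. ennreal (X \<omega> ^ (2 * k)) \<partial>M) = ennreal (fact (2 * k) / (2 ^ k * fact k) * v ^ k)"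
  using centred_gaussian_moment[OF assms(3,4)] assms(1)
  unfolding assms(2)[symmetric] by (simp add: nn_integral_distr)

text \<open>
  The difference of two white noise integrals is a centred Gaussian variable.  Its variance is its
  second moment, which the covariance determines, and the other moments follow.  The
  representing linear combination is written so that it also covers \<open>f = g\<close>.
\<close>

lemma white_noise_increment_moment:
  assumes W: "white_noise M W" and fg: "f \<in> L2" "g \<in> L2" and k: "0 < k"
    and v: "v = (\<integral>z. f z * f z \<partial>spacetime_measure) + (\<integral>z. g z * g z \<partial>spacetime_measure)
      - 2 * (\<integral>z. f z * g z \<partial>spacetime_measure)"
  shows "0 \<le> v" and "(\<integral>\<^sup>+\<omega>. ennreal ((W f \<omega> - W g \<omega>) ^ (2 * k)) \<partial>M) = ennreal (fact (2 * k) / (2 ^ k * fact k) * v ^ k)"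
proof -
  have [measurable]: "W f \<in> borel_measurable M" "W g \<in> borel_measurable M"
    using W fg by (auto simp: white_noise_def)
  have cov: "(\<integral>\<omega>. W h \<omega> * W h' \<omega> \<partial>M) = (\<integral>z. h z * h' z \<partial>spacetime_measure)" if "h \<in> {f, g}" "h' \<in> {f, g}" for h h'
    using W fg that by (auto simp: white_noise_def)
  have gauss: "\<exists>v\<ge>0. distr M borel (\<lambda>\<omega>. \<Sum>f\<in>F. c f * W f \<omega>) = centred_gaussian v" if "finite F" "F \<subseteq> L2" for F c
    using W that by (simp add: white_noise_def)
  have sq: "integrable M (\<lambda>\<omega>. W h \<omega> * W h \<omega>)" if h: "h \<in> {f, g}" for h
  proof -
    have [measurable]: "W h \<in> borel_measurable M" using h by auto
    obtain u where u: "0 \<le> u" "distr M borel (\<lambda>\<omega>. \<Sum>f\<in>{h}. 1 * W f \<omega>) = centred_gaussian u"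
      using gauss[of "{h}" "\<lambda>_. 1"] h fg by auto
    have "(\<integral>\<^sup>+\<omega>. ennreal (W h \<omega> ^ (2 * 1)) \<partial>M) = ennreal (fact (2 * 1) / (2 ^ 1 * fact 1) * u ^ 1)"
      using u h by (intro centred_gaussian_moment') auto
    then have "(\<integral>\<^sup>+\<omega>. ennreal (W h \<omega> * W h \<omega>) \<partial>M) < \<infinity>" by (simp add: power2_eq_square)
    then show ?thesis by (intro integrableI_nonneg) auto
  qed
  have prod: "integrable M (\<lambda>\<omega>. W f \<omega> * W g \<omega>)"
  proof (rule Bochner_Integration.integrable_bound)
    show "integrable M (\<lambda>\<omega>. W f \<omega> * W f \<omega> + W g \<omega> * W g \<omega>)" by (intro Bochner_Integration.integrable_add sq) auto
    have "\<bar>a * b\<bar> \<le> a * a + b * b" for a b :: real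
    proof -
      have "0 \<le> (\<bar>a\<bar> - \<bar>b\<bar>)\<^sup>2" by simp
      then have "2 * (\<bar>a\<bar> * \<bar>b\<bar>) \<le> a * a + b * b" by (simp add: power2_eq_square algebra_simps)
      moreover have "0 \<le> \<bar>a\<bar> * \<bar>b\<bar>" by simp
      ultimately show ?thesis unfolding abs_mult by linarith
    qed
    then show "AE \<omega> in M. norm (W f \<omega> * W g \<omega>) \<le> norm (W f \<omega> * W f \<omega> + W g \<omega> * W g \<omega>)"
      by (intro AE_I2) simp
  qed simp
  define c where "c h = (if h = f then 1 else 0) - (if h = g then 1 else (0::real))" for h
  have "(\<Sum>h\<in>{f, g}. c h * W h \<omega>) = W f \<omega> - W g \<omega>" for \<omega>
    by (cases "f = g") (auto simp: c_def)
  then obtain u where u: "0 \<le> u" "distr M borel (\<lambda>\<omega>. W f \<omega> - W g \<omega>) = centred_gaussian u"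
    using gauss[of "{f, g}" c] fg by auto
  note moment = centred_gaussian_moment'[OF _ u(2,1)]
  have "ennreal u = (\<integral>\<^sup>+\<omega>. ennreal ((W f \<omega> - W g \<omega>) ^ (2 * 1)) \<partial>M)"
    by (subst moment) auto
  also have "\<dots> = ennreal (\<integral>\<omega>. W f \<omega> * W f \<omega> + W g \<omega> * W g \<omega> - 2 * (W f \<omega> * W g \<omega>) \<partial>M)"
  proof -
    have e: "(W f \<omega> - W g \<omega>) ^ (2 * 1) = W f \<omega> * W f \<omega> + W g \<omega> * W g \<omega> - 2 * (W f \<omega> * W g \<omega>)" for \<omega>
      by (simp add: power2_eq_square algebra_simps)
    have nn: "0 \<le> W f \<omega> * W f \<omega> + W g \<omega> * W g \<omega> - 2 * (W f \<omega> * W g \<omega>)" for \<omega>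
      unfolding e[symmetric] by simp
    show ?thesis
      unfolding e using sq prod nn by (intro nn_integral_eq_integral) auto
  qed
  also have "(\<integral>\<omega>. W f \<omega> * W f \<omega> + W g \<omega> * W g \<omega> - 2 * (W f \<omega> * W g \<omega>) \<partial>M) = v"
    using sq prod cov v by simp
  finally have "ennreal u = ennreal v" .
  moreover show "0 \<le> v"
  proof -
    have "0 \<le> (\<integral>\<omega>. (W f \<omega> - W g \<omega>)\<^sup>2 \<partial>M)" by (rule Bochner_Integration.integral_nonneg) simp
    also have "\<dots> = v"
      using sq prod cov v by (simp add: power2_eq_square algebra_simps)
    finally show ?thesis .
  qed
  ultimately have "u = v" using u(1) by simp
  with moment[OF _ k] show "(\<integral>\<^sup>+\<omega>. ennreal ((W f \<omega> - W g \<omega>) ^ (2 * k)) \<partial>M) = ennreal (fact (2 * k) / (2 ^ k * fact k) * v ^ k)"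
    by simp
qed

section \<open>Covariance of the stochastic convolution\<close>

text \<open>
  The integrand of the stochastic convolution at \<open>(x, t)\<close>.
\<close>

definition noise_kernel :: "real \<Rightarrow> real \<Rightarrow> real \<times> real \<Rightarrow> real" where
  "noise_kernel x t = (\<lambda>(y, s). if 0 \<le> s \<and> s < t then heat_kernel (t - s) x y else 0)"

lemma heat_kernel_nonneg [simp]: "0 \<le> heat_kernel t x y"
  by (simp add: heat_kernel_def)

lemma noise_kernel_nonneg [simp]: "0 \<le> noise_kernel x t z"
  by (simp add: noise_kernel_def case_prod_beta)

lemma heat_kernel_eq:
  assumes "0 < t"
  shows "heat_kernel t x y = exp (- (x - y)\<^sup>2 / (2 * t)) / (sqrt (2 * pi) * sqrt t)"
proof -
  have "(2 * pi * t) powr (- 1 / 2) = inverse ((2 * pi * t) powr (1 / 2))"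
    by (metis minus_divide_left powr_minus)
  also have "\<dots> = inverse (sqrt (2 * pi * t))" using assms by (subst powr_half_sqrt) auto
  also have "\<dots> = 1 / (sqrt (2 * pi) * sqrt t)" by (simp only: real_sqrt_mult inverse_eq_divide)
  finally show ?thesis by (simp add: heat_kernel_def)
qed

lemma heat_kernel_normal_density:
  assumes "0 < t"
  shows "heat_kernel t x y = normal_density 0 (sqrt t) (x - y)"
  unfolding heat_kernel_eq[OF assms] normal_density_def using assms by (simp add: real_sqrt_mult)

lemma heat_kernel_convolution:
  assumes a: "0 < a" and b: "0 < b"
  shows "(\<integral>\<^sup>+y. ennreal (heat_kernel a x y * heat_kernel b x' y) \<partial>lborel) = ennreal (heat_kernel (a + b) x x')"
proof -
  have "(\<integral>\<^sup>+y. ennreal (heat_kernel a x y * heat_kernel b x' y) \<partial>lborel)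
    = (\<integral>\<^sup>+y. ennreal (normal_density 0 (sqrt a) (x - y) * normal_density 0 (sqrt b) (x' - y)) \<partial>lborel)"
    using a b by (simp add: heat_kernel_normal_density)
  also have "\<dots> = (\<integral>\<^sup>+y. ennreal (normal_density 0 (sqrt a) (x - (x' + 1 * y)) * normal_density 0 (sqrt b) (x' - (x' + 1 * y))) \<partial>lborel)"
    by (subst nn_integral_real_affine[where c=1 and t=x']) auto
  also have "\<dots> = (\<integral>\<^sup>+y. ennreal (normal_density 0 (sqrt a) ((x - x') - y) * normal_density 0 (sqrt b) y) \<partial>lborel)"
    by (intro nn_integral_cong) (simp add: normal_density_def algebra_simps)
  also have "\<dots> = normal_density 0 (sqrt ((sqrt a)\<^sup>2 + (sqrt b)\<^sup>2)) (x - x')"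
    using fun_cong[OF conv_normal_density_zero_mean[of "sqrt a" "sqrt b"], of "x - x'"] a b by simp
  also have "\<dots> = ennreal (heat_kernel (a + b) x x')"
    using a b by (simp add: heat_kernel_normal_density)
  finally show ?thesis .
qed

lemma heat_kernel_measurable [measurable]:
  "(\<lambda>z. heat_kernel (t - snd z) x (fst z)) \<in> borel_measurable (lborel \<Otimes>\<^sub>M lborel)"
  unfolding heat_kernel_def by measurable

lemma noise_kernel_measurable [measurable]: "noise_kernel x t \<in> borel_measurable borel"
proof -
  have "noise_kernel x t \<in> borel_measurable (lborel \<Otimes>\<^sub>M lborel)"
    unfolding noise_kernel_def case_prod_unfold by measurable
  then show ?thesis by (simp add: lborel_prod)
qed

lemma noise_kernel_measurable' [measurable]: "noise_kernel x t \<in> borel_measurable spacetime_measure"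
  unfolding spacetime_measure_def by (rule measurable_restrict_space1) simp

text \<open>
  Integrating over \<open>y\<close> first, the kernels convolve to a heat kernel, so the covariance becomes an
  integral over time.
\<close>

lemma nn_integral_noise_kernel:
  "(\<integral>\<^sup>+z. ennreal (noise_kernel x t z * noise_kernel x' t' z) \<partial>spacetime_measure) =
   (\<integral>\<^sup>+s. ennreal (heat_kernel (t + t' - 2 * s) x x') * indicator {0..<min t t'} s \<partial>lborel)"
proof -
  have "closed spacetime" unfolding spacetime_def by (intro closed_Times) auto
  then have [measurable]: "spacetime \<in> sets borel" by auto
  have "(\<integral>\<^sup>+z. ennreal (noise_kernel x t z * noise_kernel x' t' z) \<partial>spacetime_measure)
    = (\<integral>\<^sup>+z. ennreal (noise_kernel x t z * noise_kernel x' t' z) * indicator spacetime z \<partial>lborel)"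
    unfolding spacetime_measure_def by (subst nn_integral_restrict_space) auto
  also have "\<dots> = (\<integral>\<^sup>+z. ennreal (noise_kernel x t z * noise_kernel x' t' z) \<partial>(lborel \<Otimes>\<^sub>M lborel))"
    unfolding lborel_prod by (intro nn_integral_cong) (auto simp: noise_kernel_def spacetime_def indicator_def split: if_splits)
  also have "\<dots> = (\<integral>\<^sup>+s. \<integral>\<^sup>+y. ennreal (noise_kernel x t (y, s) * noise_kernel x' t' (y, s)) \<partial>lborel \<partial>lborel)"
  proof -
    have "(\<lambda>z. ennreal (noise_kernel x t z * noise_kernel x' t' z)) \<in> borel_measurable (lborel \<Otimes>\<^sub>M lborel)"
      unfolding lborel_prod by measurable
    from lborel_pair.nn_integral_snd[OF this] show ?thesis by simp
  qed
  also have "\<dots> = (\<integral>\<^sup>+s. ennreal (heat_kernel (t + t' - 2 * s) x x') * indicator {0..<min t t'} s \<partial>lborel)"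
  proof (rule nn_integral_cong)
    fix s
    show "(\<integral>\<^sup>+y. ennreal (noise_kernel x t (y, s) * noise_kernel x' t' (y, s)) \<partial>lborel) =
        ennreal (heat_kernel (t + t' - 2 * s) x x') * indicator {0..<min t t'} s"
    proof (cases "s \<in> {0..<min t t'}")
      case True
      then have "(\<integral>\<^sup>+y. ennreal (noise_kernel x t (y, s) * noise_kernel x' t' (y, s)) \<partial>lborel)
          = ennreal (heat_kernel ((t - s) + (t' - s)) x x')"
        using heat_kernel_convolution[of "t - s" "t' - s" x x'] by (simp add: noise_kernel_def)
      moreover have "(t - s) + (t' - s) = t + t' - 2 * s" by simp
      ultimately show ?thesis using True by simp
    next
      case False
      then have "noise_kernel x t (y, s) * noise_kernel x' t' (y, s) = 0" for y by (auto simp: noise_kernel_def)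
      then have "(\<integral>\<^sup>+y. ennreal (noise_kernel x t (y, s) * noise_kernel x' t' (y, s)) \<partial>lborel) = 0"
        by (simp only: ennreal_0 nn_integral_const mult_zero_left)
      with False show ?thesis by simp
    qed
  qed
  finally show ?thesis .
qed

text \<open>
  The fundamental theorem for a nonnegative derivative that may be singular at the
  end points, as the heat kernel on the diagonal is.
\<close>

lemma nn_integral_FTC_interior:
  fixes F f :: "real \<Rightarrow> real"
  assumes "0 \<le> m" "continuous_on {0..m} F" "\<And>s. 0 < s \<Longrightarrow> s < m \<Longrightarrow> (F has_real_derivative f s) (at s)"
    and "\<And>s. 0 \<le> s \<Longrightarrow> s < m \<Longrightarrow> 0 \<le> f s"
  shows "(\<integral>\<^sup>+s. ennreal (f s) * indicator {0..<m} s \<partial>lborel) = ennreal (F m - F 0)"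
proof (rule nn_integral_has_integral_lebesgue')
  have "(f has_integral (F m - F 0)) {0..m}"
    using fundamental_theorem_of_calculus_interior[OF assms(1,2), of f] assms(3)
    by (simp add: has_real_derivative_iff_has_vector_derivative)
  then show "(f has_integral (F m - F 0)) {0..<m}"
    by (subst has_integral_spike_set_eq[of _ "{0..m}"]) (auto intro!: negligible_subset[OF negligible_sing[of m]])
qed (use assms(4) in auto)

lemma nn_integral_noise_kernel_same_place:
  assumes "0 \<le> t" "0 \<le> t'"
  shows "(\<integral>\<^sup>+z. ennreal (noise_kernel x t z * noise_kernel x t' z) \<partial>spacetime_measure)
    = ennreal ((sqrt (t + t') - sqrt \<bar>t - t'\<bar>) / sqrt (2 * pi))"
proof -
  let ?m = "min t t'" and ?F = "\<lambda>s. - sqrt (t + t' - 2 * s) / sqrt (2 * pi)"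
  have "(\<integral>\<^sup>+z. ennreal (noise_kernel x t z * noise_kernel x t' z) \<partial>spacetime_measure)
      = ennreal (?F ?m - ?F 0)"
    unfolding nn_integral_noise_kernel
  proof (rule nn_integral_FTC_interior)
    show "continuous_on {0..?m} ?F" by (intro continuous_intros) auto
    fix s assume s: "0 < s" "s < ?m"
    then have pos: "0 < t + t' - 2 * s" by auto
    have "((\<lambda>s. sqrt (t + t' - 2 * s)) has_real_derivative (inverse (sqrt (t + t' - 2 * s)) / 2 * (- 2))) (at s)"
      using pos by (auto intro!: derivative_eq_intros simp: field_simps)
    from DERIV_cdivide[OF DERIV_minus[OF this], of "sqrt (2 * pi)"]
    show "(?F has_real_derivative heat_kernel (t + t' - 2 * s) x x) (at s)"
      using pos by (simp add: heat_kernel_eq field_simps)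
  qed (use assms in auto)
  also have "?F ?m - ?F 0 = (sqrt (t + t') - sqrt \<bar>t - t'\<bar>) / sqrt (2 * pi)"
    by (cases "t \<le> t'") (auto simp: min_def diff_divide_distrib abs_if)
  finally show ?thesis .
qed

lemma noise_kernel_L2:
  assumes "0 \<le> t" shows "noise_kernel x t \<in> L2"
proof -
  have "integrable spacetime_measure (\<lambda>z. (noise_kernel x t z)\<^sup>2)"
    using nn_integral_noise_kernel_same_place[OF assms assms, of x]
    by (intro integrableI_nonneg) (auto simp: power2_eq_square)
  then show ?thesis by (simp add: L2_def)
qed

text \<open>
  The right side has an elementary antiderivative after division by the square root of time.  With
  \<open>q = sqrt (1 + w)\<close> it is \<open>4 (q - 1) / q\<close>, which is at least 1 for \<open>q \<ge> 4/3\<close>; for smaller \<open>q\<close> it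
  dominates \<open>w / 2 = (q - 1) (q + 1) / 2\<close>.
\<close>

lemma one_minus_exp_le:
  assumes "0 \<le> w"
  shows "1 - exp (- w / 2) \<le> 4 * (1 - 1 / sqrt (1 + w :: real))"
proof -
  define q where "q = sqrt (1 + w)"
  have q: "1 \<le> q" "w = (q - 1) * (q + 1)" using assms by (auto simp: q_def algebra_simps)
  have r: "1 - 1 / q = (q - 1) / q" using q by (simp add: field_simps)
  show ?thesis
  proof (cases "4 / 3 \<le> q")
    case True
    then have "1 \<le> 4 * ((q - 1) / q)" by (simp add: field_simps)
    moreover have "1 - exp (- w / 2) \<le> 1" by simp
    ultimately show ?thesis unfolding q_def[symmetric] r by linarith
  next
    case False
    have "q * (q + 1) \<le> 4 / 3 * (4 / 3 + 1)" using False q by (intro mult_mono) auto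
    then have "q + 1 \<le> 8 / q" using q by (simp add: field_simps)
    then have "(q - 1) * (q + 1) \<le> (q - 1) * (8 / q)" using q by (intro mult_left_mono) auto
    also have "(q - 1) * (8 / q) = 8 * ((q - 1) / q)" by simp
    finally have "w / 2 \<le> 4 * ((q - 1) / q)" unfolding q(2) by linarith
    moreover have "1 - exp (- w / 2) \<le> w / 2" using exp_ge_add_one_self[of "- w / 2"] by simp
    ultimately show ?thesis unfolding q_def[symmetric] r by linarith
  qed
qed

text \<open>
  \<open>H\<^sub>c(x, x) - H\<^sub>c(x, x')\<close> is a multiple of \<open>(1 - exp (- d\<^sup>2 / (2 c))) / sqrt c\<close> with \<open>d = \<bar>x - x'\<bar>\<close>.
  By \<open>one_minus_exp_le\<close> it is dominated by the derivative of a difference of square roots, and the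
  integral of this derivative is at most a multiple of \<open>d\<close>, for all times.
\<close>

lemma nn_integral_noise_kernel_same_time:
  assumes t: "0 \<le> t"
  shows "(\<integral>\<^sup>+z. ennreal (noise_kernel x t z * noise_kernel x t z) \<partial>spacetime_measure)
    \<le> (\<integral>\<^sup>+z. ennreal (noise_kernel x t z * noise_kernel x' t z) \<partial>spacetime_measure) + ennreal (2 * \<bar>x - x'\<bar>)"
proof (cases "x = x'")
  case True
  then show ?thesis by simp
next
  case False
  define d where "d = \<bar>x - x'\<bar>"
  have d: "0 < d" using False by (simp add: d_def)
  define b where "b s = 4 / sqrt (2 * pi) * (1 / sqrt (2 * (t - s)) - 1 / sqrt (2 * (t - s) + d\<^sup>2))" for s
  define F where "F s = 4 / sqrt (2 * pi) * (sqrt (2 * (t - s) + d\<^sup>2) - sqrt (2 * (t - s)))" for s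
  have b0: "0 \<le> b s" if "s < t" for s
  proof -
    have "sqrt (2 * (t - s)) \<le> sqrt (2 * (t - s) + d\<^sup>2)" by simp
    then have "1 / sqrt (2 * (t - s) + d\<^sup>2) \<le> 1 / sqrt (2 * (t - s))" using that by (intro frac_le) auto
    then show ?thesis by (simp add: b_def)
  qed
  have kb: "heat_kernel (t + t - 2 * s) x x \<le> heat_kernel (t + t - 2 * s) x x' + b s" if s: "s < t" for s
  proof -
    define c where "c = 2 * (t - s)"
    have c: "0 < c" "t + t - 2 * s = c" using s by (auto simp: c_def)
    have "1 - exp (- (d\<^sup>2 / c) / 2) \<le> 4 * (1 - 1 / sqrt (1 + d\<^sup>2 / c))"
      using c by (intro one_minus_exp_le) simp
    then have "(1 - exp (- (d\<^sup>2 / c) / 2)) / (sqrt (2 * pi) * sqrt c) \<le> 4 * (1 - 1 / sqrt (1 + d\<^sup>2 / c)) / (sqrt (2 * pi) * sqrt c)"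
      using c by (intro divide_right_mono) auto
    also have "\<dots> = 4 / sqrt (2 * pi) * (1 / sqrt c - 1 / (sqrt (1 + d\<^sup>2 / c) * sqrt c))"
      by (simp add: divide_simps)
    also have "sqrt (1 + d\<^sup>2 / c) * sqrt c = sqrt (c + d\<^sup>2)"
      using c by (simp add: field_simps flip: real_sqrt_mult)
    also have "4 / sqrt (2 * pi) * (1 / sqrt c - 1 / sqrt (c + d\<^sup>2)) = b s" by (simp add: b_def c_def)
    finally have 1: "(1 - exp (- (d\<^sup>2 / c) / 2)) / (sqrt (2 * pi) * sqrt c) \<le> b s" .
    have 2: "heat_kernel c x x = 1 / (sqrt (2 * pi) * sqrt c)" using c by (simp add: heat_kernel_eq)
    have 3: "heat_kernel c x x' = exp (- (d\<^sup>2 / c) / 2) / (sqrt (2 * pi) * sqrt c)"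
      unfolding heat_kernel_eq[OF c(1)] by (simp add: d_def mult.commute)
    show ?thesis using 1 unfolding c(2) 2 3 by (simp add: diff_divide_distrib)
  qed
  have "(\<integral>\<^sup>+z. ennreal (noise_kernel x t z * noise_kernel x t z) \<partial>spacetime_measure)
    = (\<integral>\<^sup>+s. ennreal (heat_kernel (t + t - 2 * s) x x) * indicator {0..<t} s \<partial>lborel)"
    unfolding nn_integral_noise_kernel by simp
  also have "\<dots> \<le> (\<integral>\<^sup>+s. ennreal (heat_kernel (t + t - 2 * s) x x') * indicator {0..<t} s + ennreal (b s) * indicator {0..<t} s \<partial>lborel)"
    using kb b0 by (intro nn_integral_mono) (auto simp: indicator_def simp flip: ennreal_plus intro!: ennreal_leI)
  also have "\<dots> = (\<integral>\<^sup>+s. ennreal (heat_kernel (t + t - 2 * s) x x') * indicator {0..<t} s \<partial>lborel)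
      + (\<integral>\<^sup>+s. ennreal (b s) * indicator {0..<t} s \<partial>lborel)"
    unfolding b_def heat_kernel_def by (rule nn_integral_add) measurable
  also have "(\<integral>\<^sup>+s. ennreal (b s) * indicator {0..<t} s \<partial>lborel) = ennreal (F t - F 0)"
  proof (rule nn_integral_FTC_interior[OF t])
    show "continuous_on {0..t} F" unfolding F_def by (intro continuous_intros)
    fix s assume s: "0 < s" "s < t"
    have p: "0 < 2 * (t - s)" "0 < 2 * (t - s) + d\<^sup>2" using s d by (auto intro: add_pos_nonneg)
    have 1: "((\<lambda>s. sqrt (2 * (t - s) + d\<^sup>2)) has_real_derivative (- (1 / sqrt (2 * (t - s) + d\<^sup>2)))) (at s)"
      using p by (auto intro!: derivative_eq_intros simp: field_simps)
    have 2: "((\<lambda>s. sqrt (2 * (t - s))) has_real_derivative (- (1 / sqrt (2 * (t - s))))) (at s)"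
      by (rule derivative_eq_intros refl | use p in \<open>simp add: field_simps\<close>)+
    show "(F has_real_derivative b s) (at s)"
      unfolding F_def b_def using DERIV_cmult[OF DERIV_diff[OF 1 2], of "4 / sqrt (2 * pi)"] by simp
  qed (use b0 in auto)
  also have "\<dots> \<le> ennreal (2 * d)"
  proof (rule ennreal_leI)
    have "sqrt (2 * t) \<le> sqrt (2 * t + d\<^sup>2)" by simp
    then have "4 / sqrt (2 * pi) * (sqrt (2 * t) - sqrt (2 * t + d\<^sup>2)) \<le> 0" by (intro mult_nonneg_nonpos) auto
    then have "F t - F 0 \<le> 4 / sqrt (2 * pi) * d" using d by (simp add: F_def algebra_simps)
    also have "\<dots> \<le> 2 * d"
    proof (rule mult_right_mono)
      have "2 = sqrt (4::real)" by simp
      also have "\<dots> \<le> sqrt (2 * pi)" using pi_gt3 by (intro real_sqrt_le_mono) simp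
      finally show "4 / sqrt (2 * pi) \<le> 2" by (simp add: divide_le_eq)
    qed (use d in simp)
    finally show "F t - F 0 \<le> 2 * d" .
  qed
  finally show ?thesis unfolding nn_integral_noise_kernel d_def by (simp add: add_left_mono)
qed

definition noise_cov :: "real \<Rightarrow> real \<Rightarrow> real \<Rightarrow> real \<Rightarrow> real" where
  "noise_cov x t x' t' = (\<integral>z. noise_kernel x t z * noise_kernel x' t' z \<partial>spacetime_measure)"

lemma noise_cov_same_place:
  assumes "0 \<le> t" "0 \<le> t'"
  shows "noise_cov x t x t' = (sqrt (t + t') - sqrt \<bar>t - t'\<bar>) / sqrt (2 * pi)"
proof -
  have "sqrt \<bar>t - t'\<bar> \<le> sqrt (t + t')" using assms by (intro real_sqrt_le_mono) auto
  then have "0 \<le> (sqrt (t + t') - sqrt \<bar>t - t'\<bar>) / sqrt (2 * pi)" by simp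
  then show ?thesis
    unfolding noise_cov_def using nn_integral_noise_kernel_same_place[OF assms, of x]
    by (subst integral_eq_nn_integral) auto
qed

text \<open>
  The three square roots \<open>sqrt (2 t)\<close>, \<open>sqrt (2 t')\<close> and \<open>2 sqrt (t + t')\<close> in the variance have a
  nonpositive sum with the signs they carry, by concavity; only \<open>sqrt \<bar>t - t'\<bar>\<close> remains.
\<close>

lemma noise_var_time:
  assumes "0 \<le> t" "0 \<le> t'"
  shows "noise_cov x t x t + noise_cov x t' x t' - 2 * noise_cov x t x t' \<le> sqrt \<bar>t - t'\<bar>"
proof -
  have "(p + q)\<^sup>2 \<le> 2 * p\<^sup>2 + 2 * q\<^sup>2" for p q :: real
    using zero_le_power2[of "p - q"] by (simp add: power2_eq_square algebra_simps)
  from this[of "sqrt (2 * t)" "sqrt (2 * t')"]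
  have "(sqrt (2 * t) + sqrt (2 * t'))\<^sup>2 \<le> (2 * sqrt (t + t'))\<^sup>2"
    using assms by (simp add: power_mult_distrib)
  then have "sqrt (2 * t) + sqrt (2 * t') \<le> 2 * sqrt (t + t')"
    by (rule power2_le_imp_le) (use assms in simp)
  then have 1: "sqrt (2 * t) + sqrt (2 * t') - 2 * (sqrt (t + t') - sqrt \<bar>t - t'\<bar>) \<le> 2 * sqrt \<bar>t - t'\<bar>" by simp
  have "2 = sqrt (4::real)" by simp
  also have "\<dots> \<le> sqrt (2 * pi)" using pi_gt3 by (intro real_sqrt_le_mono) simp
  finally have 2: "2 \<le> sqrt (2 * pi)" .
  have "noise_cov x t x t + noise_cov x t' x t' - 2 * noise_cov x t x t' =
      (sqrt (2 * t) + sqrt (2 * t') - 2 * (sqrt (t + t') - sqrt \<bar>t - t'\<bar>)) / sqrt (2 * pi)"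
    using assms by (simp add: noise_cov_same_place add_divide_distrib diff_divide_distrib)
  also have "\<dots> \<le> 2 * sqrt \<bar>t - t'\<bar> / sqrt (2 * pi)" using 1 by (intro divide_right_mono) auto
  also have "\<dots> \<le> sqrt \<bar>t - t'\<bar>"
    using 2 mult_right_mono[OF 2, of "sqrt \<bar>t - t'\<bar>"] by (simp add: divide_le_eq mult.commute)
  finally show ?thesis .
qed

lemma noise_var_space:
  assumes t: "0 \<le> t"
  shows "noise_cov x t x t + noise_cov x' t x' t - 2 * noise_cov x t x' t \<le> 4 * \<bar>x - x'\<bar>"
proof -
  let ?I = "\<lambda>x x'. (\<integral>\<^sup>+z. ennreal (noise_kernel x t z * noise_kernel x' t z) \<partial>spacetime_measure)"
  have nn: "0 \<le> noise_cov x t x t" for x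
    unfolding noise_cov_def by (rule Bochner_Integration.integral_nonneg) simp
  have same: "?I x x = ennreal (noise_cov x t x t)" for x
    using nn_integral_noise_kernel_same_place[OF t t, of x] noise_cov_same_place[OF t t, of x] by simp
  have int: "integrable spacetime_measure (\<lambda>z. noise_kernel x t z * noise_kernel x' t z)"
  proof (rule Bochner_Integration.integrable_bound)
    show "integrable spacetime_measure (\<lambda>z. (noise_kernel x t z)\<^sup>2 + (noise_kernel x' t z)\<^sup>2)"
      using noise_kernel_L2[OF t] by (intro Bochner_Integration.integrable_add) (auto simp: L2_def)
    have "a * b \<le> a\<^sup>2 + b\<^sup>2" if "0 \<le> a" "0 \<le> b" for a b :: real
    proof -
      have "0 \<le> (a - b)\<^sup>2" "0 \<le> a * b" using that by auto
      then show ?thesis by (simp add: power2_eq_square algebra_simps)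
    qed
    then show "AE z in spacetime_measure. norm (noise_kernel x t z * noise_kernel x' t z) \<le>
        norm ((noise_kernel x t z)\<^sup>2 + (noise_kernel x' t z)\<^sup>2)"
      by (intro AE_I2) (simp add: abs_mult)
  qed measurable
  then have cross: "?I x x' = ennreal (noise_cov x t x' t)"
    unfolding noise_cov_def by (intro nn_integral_eq_integral) auto
  have c0: "0 \<le> noise_cov x t x' t"
    unfolding noise_cov_def by (rule Bochner_Integration.integral_nonneg) simp
  have "ennreal (noise_cov x t x t) \<le> ennreal (noise_cov x t x' t + 2 * \<bar>x - x'\<bar>)"
    using nn_integral_noise_kernel_same_time[OF t, of x x'] c0 by (simp add: same cross ennreal_plus)
  then have "noise_cov x t x t \<le> noise_cov x t x' t + 2 * \<bar>x - x'\<bar>"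
    using c0 by (subst (asm) ennreal_le_iff) auto
  moreover have "noise_cov x' t x' t = noise_cov x t x t"
    using noise_cov_same_place[OF t t] by simp
  ultimately show ?thesis by linarith
qed

lemma stochastic_convolution_increment:
  assumes W: "white_noise M W" and Z: "continuous_stochastic_convolution M W Z"
    and t: "0 \<le> t" "0 \<le> t'" and k: "0 < k"
    and v: "noise_cov x t x t + noise_cov x' t' x' t' - 2 * noise_cov x t x' t' \<le> v"
  shows "(\<integral>\<^sup>+\<omega>. ennreal ((Z \<omega> (x, t) - Z \<omega> (x', t')) ^ (2 * k)) \<partial>M) \<le> ennreal (fact (2 * k) / (2 ^ k * fact k) * v ^ k)"
proof -
  have AE: "AE \<omega> in M. Z \<omega> (x, t) = W (noise_kernel x t) \<omega>" if "0 \<le> t" for x t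
    using Z that unfolding continuous_stochastic_convolution_def noise_kernel_def by blast
  let ?v = "noise_cov x t x t + noise_cov x' t' x' t' - 2 * noise_cov x t x' t'"
  have "(\<integral>\<^sup>+\<omega>. ennreal ((Z \<omega> (x, t) - Z \<omega> (x', t')) ^ (2 * k)) \<partial>M)
      = (\<integral>\<^sup>+\<omega>. ennreal ((W (noise_kernel x t) \<omega> - W (noise_kernel x' t') \<omega>) ^ (2 * k)) \<partial>M)"
    by (rule nn_integral_cong_AE) (use AE[OF t(1), of x] AE[OF t(2), of x'] in eventually_elim, simp)
  also have "\<dots> = ennreal (fact (2 * k) / (2 ^ k * fact k) * ?v ^ k)"
    by (rule white_noise_increment_moment(2)[OF W noise_kernel_L2[OF t(1)] noise_kernel_L2[OF t(2)] k])
       (simp add: noise_cov_def)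
  also have "\<dots> \<le> ennreal (fact (2 * k) / (2 ^ k * fact k) * v ^ k)"
  proof (intro ennreal_leI mult_left_mono power_mono v)
    show "0 \<le> ?v"
      by (rule white_noise_increment_moment(1)[OF W noise_kernel_L2[OF t(1)] noise_kernel_L2[OF t(2)] k])
         (simp add: noise_cov_def)
  qed simp
  finally show ?thesis .
qed

section \<open>Growth of the stochastic convolution\<close>

lemma geometric_telescope:
  fixes a :: "nat \<Rightarrow> real"
  assumes q: "0 < q" "q < 1" and c: "0 \<le> c" and step: "\<And>n. \<bar>a (Suc n) - a n\<bar> \<le> c * q ^ n" and lim: "a \<longlonglongrightarrow> l"
  shows "\<bar>l - a 0\<bar> \<le> c / (1 - q)"
proof (rule LIMSEQ_le_const2)
  show "(\<lambda>n. \<bar>a n - a 0\<bar>) \<longlonglongrightarrow> \<bar>l - a 0\<bar>" by (intro tendsto_intros lim)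
  have "\<bar>a n - a 0\<bar> \<le> c * (1 - q ^ n) / (1 - q)" for n
  proof (induction n)
    case (Suc n)
    have "c * (1 - q ^ Suc n) / (1 - q) = c * (1 - q ^ n) / (1 - q) + c * q ^ n"
      using q by (simp add: field_simps)
    with Suc step[of n] show ?case by linarith
  qed simp
  also have "c * (1 - q ^ n) / (1 - q) \<le> c / (1 - q)" for n
    using q c by (intro divide_right_mono) (simp_all add: mult_left_le)
  finally show "\<exists>N. \<forall>n\<ge>N. \<bar>a n - a 0\<bar> \<le> c / (1 - q)" by blast
qed

text \<open>
  The increments of \<open>z\<close> from a dyadic point to its right and upper neighbours, in the power that is
  integrated.  The exponent 32 leaves room for the weight \<open>64\<^sup>n\<close> used below: the expectation of these powers
  decays like \<open>256\<^sup>-\<^sup>n\<close>, while the squares of the two indices, which make the sum over the grid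
  converge, cost \<open>16\<^sup>n\<close> at a fixed point.
\<close>

definition dyadic_increment :: "(real \<times> real \<Rightarrow> real) \<Rightarrow> nat \<Rightarrow> int \<Rightarrow> nat \<Rightarrow> real" where
  "dyadic_increment z n a b =
     (z (real_of_int (a + 1) / 2 ^ n, real b / 2 ^ n) - z (real_of_int a / 2 ^ n, real b / 2 ^ n)) ^ 32 +
     (z (real_of_int a / 2 ^ n, real (b + 1) / 2 ^ n) - z (real_of_int a / 2 ^ n, real b / 2 ^ n)) ^ 32"

text \<open>
  A point is joined to the corner \<open>(\<lfloor>x\<rfloor>, \<lfloor>t\<rfloor>)\<close> through the dyadic points to its lower left.  Two
  consecutive ones differ by at most one horizontal and one vertical step of the finer grid.  There the
  indices are at most \<open>2\<^sup>n\<close> times \<open>1 + \<bar>x\<bar>\<close> and \<open>1 + t\<close>, so the steps are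
  bounded by a geometric sequence.  The corner is reached from time 0 by vertical
  steps of length 1.
\<close>

lemma dyadic_chaining:
  assumes c: "continuous_on spacetime z" and z0: "\<And>a::int. z (real_of_int a, 0) = 0"
    and S: "1 \<le> S" "\<And>n a b. dyadic_increment z n a b \<le> S * ((1 + \<bar>real_of_int a\<bar>) * (1 + real b))\<^sup>2 / 64 ^ n"
  shows "\<exists>K\<ge>0. \<forall>x t. 0 \<le> t \<longrightarrow> \<bar>z (x, t)\<bar> \<le> K * ((2 + \<bar>x\<bar>) * (2 + t))\<^sup>2"
proof -
  \<comment> \<open>\<open>4\<^sup>2\<^sup>n\<close> from the two indices against \<open>64\<^sup>n\<close> leaves \<open>4\<^sup>-\<^sup>n\<close> for the 32nd power of a step.\<close>
  define q where "q = root 32 (1 / 4)"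
  have q: "0 < q" "q < 1" "q ^ 32 = 1 / 4" by (simp_all add: q_def)
  have "\<bar>z (x, t)\<bar> \<le> (S * (1 + 2 / (1 - q))) * ((2 + \<bar>x\<bar>) * (2 + t))\<^sup>2" if t: "0 \<le> t" for x t
  proof -
    define Y where "Y = (2 + \<bar>x\<bar>) * (2 + t)"
    have Y: "1 \<le> Y" unfolding Y_def using t by (intro mult_ge1_I) auto
    have SY: "1 \<le> S * Y" using S(1) Y by (intro mult_ge1_I)
    have SY0: "0 \<le> S" "0 \<le> Y" "0 \<le> S * Y" using S(1) Y SY by linarith+
    have inc: "\<bar>z (real_of_int (a + 1) / 2 ^ n, real b / 2 ^ n) - z (real_of_int a / 2 ^ n, real b / 2 ^ n)\<bar> \<le> S * Y * q ^ n"
      "\<bar>z (real_of_int a / 2 ^ n, real (b + 1) / 2 ^ n) - z (real_of_int a / 2 ^ n, real b / 2 ^ n)\<bar> \<le> S * Y * q ^ n"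
      if a: "\<bar>real_of_int a\<bar> \<le> 2 ^ n * (1 + \<bar>x\<bar>)" and b: "real b \<le> 2 ^ n * (1 + t)" for n a b
    proof -
      have "1 + \<bar>real_of_int a\<bar> \<le> 2 ^ n * (2 + \<bar>x\<bar>)"
        using a one_le_power[of "2::real" n] unfolding distrib_left by linarith
      moreover have "1 + real b \<le> 2 ^ n * (2 + t)"
        using b one_le_power[of "2::real" n] unfolding distrib_left by linarith
      ultimately have "(1 + \<bar>real_of_int a\<bar>) * (1 + real b) \<le> (2 ^ n * (2 + \<bar>x\<bar>)) * (2 ^ n * (2 + t))"
        using t by (intro mult_mono) auto
      also have "\<dots> = 4 ^ n * Y"
      proof -
        have "(4::real) ^ n = 2 ^ n * 2 ^ n" by (simp flip: power_mult_distrib)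
        then show ?thesis by (simp add: Y_def)
      qed
      finally have "((1 + \<bar>real_of_int a\<bar>) * (1 + real b))\<^sup>2 \<le> (4 ^ n * Y)\<^sup>2"
        by (intro power_mono) auto
      then have "S * ((1 + \<bar>real_of_int a\<bar>) * (1 + real b))\<^sup>2 / 64 ^ n \<le> S * (4 ^ n * Y)\<^sup>2 / 64 ^ n"
        using S(1) by (intro divide_right_mono mult_left_mono) auto
      also have "\<dots> = S * Y\<^sup>2 * (1 / 4) ^ n"
      proof -
        have "(64::real) ^ n = (4 ^ n)\<^sup>2 * 4 ^ n" by (simp add: power2_eq_square flip: power_mult_distrib)
        then show ?thesis by (simp add: power_mult_distrib power_divide)
      qed
      also have "\<dots> \<le> (S * Y) ^ 32 * (1 / 4) ^ n"
      proof (rule mult_right_mono)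
        have "S * Y\<^sup>2 \<le> (S * S) * Y\<^sup>2" using S(1) by (intro mult_right_mono) (auto simp: mult_left_le)
        also have "\<dots> = (S * Y) ^ 2" by (simp add: power2_eq_square)
        also have "\<dots> \<le> (S * Y) ^ 32" using SY by (intro power_increasing) auto
        finally show "S * Y\<^sup>2 \<le> (S * Y) ^ 32" .
      qed simp
      also have "\<dots> = (S * Y * q ^ n) ^ 32"
        by (simp add: power_mult_distrib power_mult[symmetric] mult.commute[of n 32] power_mult q(3))
      finally have I: "dyadic_increment z n a b \<le> (S * Y * q ^ n) ^ 32" using S(2)[of n a b] by linarith
      have nn: "0 \<le> S * Y * q ^ n" using SY0 q by (intro mult_nonneg_nonneg) auto
      have r: "\<bar>d\<bar> \<le> S * Y * q ^ n" if "d ^ 32 \<le> (S * Y * q ^ n) ^ 32" for d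
        using that nn power_mono_iff[of "\<bar>d\<bar>" "S * Y * q ^ n" 32] by (simp add: power_even_abs)
      let ?u = "z (real_of_int (a + 1) / 2 ^ n, real b / 2 ^ n) - z (real_of_int a / 2 ^ n, real b / 2 ^ n)"
      let ?v = "z (real_of_int a / 2 ^ n, real (b + 1) / 2 ^ n) - z (real_of_int a / 2 ^ n, real b / 2 ^ n)"
      have "0 \<le> ?u ^ 32" "0 \<le> ?v ^ 32" by simp_all
      with I have "?u ^ 32 \<le> (S * Y * q ^ n) ^ 32" "?v ^ 32 \<le> (S * Y * q ^ n) ^ 32"
        unfolding dyadic_increment_def by linarith+
      then show "\<bar>?u\<bar> \<le> S * Y * q ^ n" "\<bar>?v\<bar> \<le> S * Y * q ^ n" by (auto intro: r)
    qed
    define a where "a n = \<lfloor>2 ^ n * x\<rfloor>" for n :: nat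
    define b where "b n = nat \<lfloor>2 ^ n * t\<rfloor>" for n :: nat
    have a_bounds: "real_of_int (a n) \<le> 2 ^ n * x" "2 ^ n * x < real_of_int (a n) + 1" for n
      unfolding a_def by linarith+
    have rb: "real (b n) = real_of_int \<lfloor>2 ^ n * t\<rfloor>" for n
      using t by (simp add: b_def)
    have b_bounds: "real (b n) \<le> 2 ^ n * t" "2 ^ n * t < real (b n) + 1" for n
      unfolding rb by linarith+
    define p where "p n = (real_of_int (a n) / 2 ^ n, real (b n) / 2 ^ n)" for n
    have a_ok: "\<bar>real_of_int (a n)\<bar> \<le> 2 ^ n * (1 + \<bar>x\<bar>)" for n
    proof -
      have "\<bar>2 ^ n * x\<bar> = 2 ^ n * \<bar>x\<bar>" by (simp add: abs_mult)
      then show ?thesis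
        using a_bounds[of n] one_le_power[of "2::real" n] unfolding distrib_left by linarith
    qed
    have b_ok: "real (b n) \<le> 2 ^ n * (1 + t)" for n
      using b_bounds[of n] one_le_power[of "2::real" n] unfolding distrib_left by linarith
    have plim: "p \<longlonglongrightarrow> (x, t)"
    proof -
      have half: "(\<lambda>n. (1 / 2) ^ n) \<longlonglongrightarrow> (0::real)" by (rule LIMSEQ_power_zero) simp
      have "(\<lambda>n. real_of_int (a n) / 2 ^ n - x) \<longlonglongrightarrow> 0"
      proof (rule Lim_null_comparison[OF _ half], intro always_eventually allI)
        fix n
        have "real_of_int (a n) / 2 ^ n - x = (real_of_int (a n) - 2 ^ n * x) / 2 ^ n" by (simp add: diff_divide_distrib)
        moreover have "\<bar>real_of_int (a n) - 2 ^ n * x\<bar> \<le> 1" using a_bounds[of n] by linarith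
        ultimately show "norm (real_of_int (a n) / 2 ^ n - x) \<le> (1 / 2) ^ n"
          by (simp add: power_divide divide_right_mono)
      qed
      moreover have "(\<lambda>n. real (b n) / 2 ^ n - t) \<longlonglongrightarrow> 0"
      proof (rule Lim_null_comparison[OF _ half], intro always_eventually allI)
        fix n
        have "real (b n) / 2 ^ n - t = (real (b n) - 2 ^ n * t) / 2 ^ n" by (simp add: diff_divide_distrib)
        moreover have "\<bar>real (b n) - 2 ^ n * t\<bar> \<le> 1" using b_bounds[of n] by linarith
        ultimately show "norm (real (b n) / 2 ^ n - t) \<le> (1 / 2) ^ n"
          by (simp add: power_divide divide_right_mono)
      qed
      ultimately show ?thesis
        unfolding p_def by (intro tendsto_Pair) (auto intro: LIM_zero_cancel)
    qed
    have lim: "(\<lambda>n. z (p n)) \<longlonglongrightarrow> z (x, t)"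
    proof -
      have "p n \<in> spacetime" for n by (simp add: p_def spacetime_def)
      moreover have "(x, t) \<in> spacetime" using t by (simp add: spacetime_def)
      ultimately show ?thesis using c plim unfolding continuous_on_sequentially o_def by blast
    qed
    have step: "\<bar>z (p (Suc n)) - z (p n)\<bar> \<le> 2 * (S * Y) * q ^ n" for n
    proof -
      let ?N = "Suc n"
      have a2: "a ?N = 2 * a n \<or> a ?N = 2 * a n + 1"
      proof -
        have "2 ^ ?N * x = 2 * (2 ^ n * x)" by simp
        then have "real_of_int (2 * a n) < real_of_int (a ?N) + 1" "real_of_int (a ?N) < real_of_int (2 * a n) + 2"
          using a_bounds[of n] a_bounds[of ?N] by auto
        then show ?thesis by linarith
      qed
      have b2: "b ?N = 2 * b n \<or> b ?N = 2 * b n + 1"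
      proof -
        have "2 ^ ?N * t = 2 * (2 ^ n * t)" by simp
        then have "real (2 * b n) < real (b ?N) + 1" "real (b ?N) < real (2 * b n) + 2"
          using b_bounds[of n] b_bounds[of ?N] by auto
        then show ?thesis by linarith
      qed
      have pn: "p n = (real_of_int (2 * a n) / 2 ^ ?N, real (2 * b n) / 2 ^ ?N)" by (simp add: p_def)
      have ok: "\<bar>real_of_int (2 * a n)\<bar> \<le> 2 ^ ?N * (1 + \<bar>x\<bar>)" "real (2 * b n) \<le> 2 ^ ?N * (1 + t)"
        using a_ok[of n] b_ok[of n] by (simp_all add: abs_mult)
      have "S * Y * q ^ ?N \<le> S * Y * q ^ n" using SY0 q by (intro mult_left_mono power_decreasing) auto
      moreover have "0 \<le> S * Y * q ^ ?N" using SY0 q by (intro mult_nonneg_nonneg) auto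
      moreover have "\<bar>z (real_of_int (a ?N) / 2 ^ ?N, real (2 * b n) / 2 ^ ?N) - z (p n)\<bar> \<le> S * Y * q ^ ?N"
        using a2 inc(1)[OF ok] \<open>0 \<le> S * Y * q ^ ?N\<close> unfolding pn by auto
      moreover have "\<bar>z (p ?N) - z (real_of_int (a ?N) / 2 ^ ?N, real (2 * b n) / 2 ^ ?N)\<bar> \<le> S * Y * q ^ ?N"
        using b2 inc(2)[OF a_ok[of ?N] ok(2)] \<open>0 \<le> S * Y * q ^ ?N\<close> unfolding p_def by auto
      ultimately show ?thesis by linarith
    qed
    have start: "\<bar>z (p 0)\<bar> \<le> S * Y * Y"
    proof -
      have "\<bar>z (real_of_int (a 0), real j)\<bar> \<le> real j * (S * Y)" if "j \<le> b 0" for j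
        using that
      proof (induction j)
        case (Suc j)
        have "real j \<le> 2 ^ 0 * (1 + t)" using b_ok[of 0] Suc.prems by simp
        from inc(2)[OF a_ok[of 0] this]
        have "\<bar>z (real_of_int (a 0), real (j + 1)) - z (real_of_int (a 0), real j)\<bar> \<le> S * Y" by simp
        moreover have "\<bar>z (real_of_int (a 0), real j)\<bar> \<le> real j * (S * Y)" using Suc by simp
        moreover have "real (Suc j) * (S * Y) = real j * (S * Y) + S * Y" by (simp add: algebra_simps)
        ultimately show ?case by simp
      qed (simp add: z0)
      from this[of "b 0"] have "\<bar>z (p 0)\<bar> \<le> real (b 0) * (S * Y)" by (simp add: p_def)
      also have "\<dots> \<le> Y * (S * Y)"
      proof (rule mult_right_mono)
        have "real (b 0) \<le> 1 + t" using b_ok[of 0] by simp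
        also have "\<dots> \<le> 1 * (2 + t)" by simp
        also have "\<dots> \<le> Y" unfolding Y_def using t by (intro mult_right_mono) auto
        finally show "real (b 0) \<le> Y" .
      qed (use SY0 in simp)
      finally show ?thesis by (simp add: mult.commute)
    qed
    have "\<bar>z (x, t) - z (p 0)\<bar> \<le> 2 * (S * Y) / (1 - q)"
      by (rule geometric_telescope[OF q(1,2) _ step lim]) (use SY0 in simp)
    also have "\<dots> \<le> 2 * (S * Y * Y) / (1 - q)"
      using mult_left_mono[OF Y SY0(3)] q by (intro divide_right_mono mult_left_mono) auto
    finally have "\<bar>z (x, t)\<bar> \<le> S * Y * Y + 2 * (S * Y * Y) / (1 - q)" using start by linarith
    also have "\<dots> = (S * (1 + 2 / (1 - q))) * Y\<^sup>2" by (simp add: power2_eq_square algebra_simps)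
    finally show ?thesis unfolding Y_def .
  qed
  moreover have "0 \<le> S * (1 + 2 / (1 - q))" using S(1) q by simp
  ultimately show ?thesis by blast
qed

lemma stochastic_convolution_dyadic:
  assumes W: "white_noise M W" and Z: "continuous_stochastic_convolution M W Z"
  shows "(\<integral>\<^sup>+\<omega>. ennreal (dyadic_increment (Z \<omega>) n a b) \<partial>M)
    \<le> ennreal (fact 32 / (2 ^ 16 * fact 16) * (4 ^ 16 + 1) / 256 ^ n)"
proof -
  let ?c = "fact 32 / (2 ^ 16 * fact 16) :: real"
  let ?x = "real_of_int a / 2 ^ n" and ?x' = "real_of_int (a + 1) / 2 ^ n"
  let ?t = "real b / 2 ^ n" and ?t' = "real (b + 1) / 2 ^ n"
  have dx: "\<bar>?x' - ?x\<bar> = 1 / 2 ^ n" and dt: "\<bar>?t' - ?t\<bar> = 1 / 2 ^ n"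
    by (simp_all flip: diff_divide_distrib)
  have [measurable]: "(\<lambda>\<omega>. Z \<omega> (x, t)) \<in> borel_measurable M" if "0 \<le> t" for x t
    using Z that by (auto simp: continuous_stochastic_convolution_def)
  have 1: "(\<integral>\<^sup>+\<omega>. ennreal ((Z \<omega> (?x', ?t) - Z \<omega> (?x, ?t)) ^ (2 * 16)) \<partial>M) \<le> ennreal (fact (2 * 16) / (2 ^ 16 * fact 16) * (4 * \<bar>?x' - ?x\<bar>) ^ 16)"
    by (rule stochastic_convolution_increment[OF W Z _ _ _ noise_var_space]) auto
  have 2: "(\<integral>\<^sup>+\<omega>. ennreal ((Z \<omega> (?x, ?t') - Z \<omega> (?x, ?t)) ^ (2 * 16)) \<partial>M) \<le> ennreal (fact (2 * 16) / (2 ^ 16 * fact 16) * sqrt \<bar>?t' - ?t\<bar> ^ 16)"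
    by (rule stochastic_convolution_increment[OF W Z _ _ _ noise_var_time]) auto
  have "(\<integral>\<^sup>+\<omega>. ennreal (dyadic_increment (Z \<omega>) n a b) \<partial>M) =
      (\<integral>\<^sup>+\<omega>. ennreal ((Z \<omega> (?x', ?t) - Z \<omega> (?x, ?t)) ^ (2 * 16)) + ennreal ((Z \<omega> (?x, ?t') - Z \<omega> (?x, ?t)) ^ (2 * 16)) \<partial>M)"
    unfolding dyadic_increment_def by (intro nn_integral_cong) (simp flip: ennreal_plus)
  also have "\<dots> = (\<integral>\<^sup>+\<omega>. ennreal ((Z \<omega> (?x', ?t) - Z \<omega> (?x, ?t)) ^ (2 * 16)) \<partial>M) + (\<integral>\<^sup>+\<omega>. ennreal ((Z \<omega> (?x, ?t') - Z \<omega> (?x, ?t)) ^ (2 * 16)) \<partial>M)"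
    by (intro nn_integral_add) measurable
  also have "\<dots> \<le> ennreal (fact (2 * 16) / (2 ^ 16 * fact 16) * (4 * \<bar>?x' - ?x\<bar>) ^ 16) + ennreal (fact (2 * 16) / (2 ^ 16 * fact 16) * sqrt \<bar>?t' - ?t\<bar> ^ 16)"
    by (rule add_mono[OF 1 2])
  also have "\<dots> = ennreal (fact (2 * 16) / (2 ^ 16 * fact 16) * (4 * \<bar>?x' - ?x\<bar>) ^ 16 + fact (2 * 16) / (2 ^ 16 * fact 16) * sqrt \<bar>?t' - ?t\<bar> ^ 16)"
    by (rule ennreal_plus[symmetric]) (intro mult_nonneg_nonneg; simp)+
  also have "\<dots> \<le> ennreal (?c * (4 ^ 16 + 1) / 256 ^ n)"
  proof (rule ennreal_leI)
    have "(4 * \<bar>?x' - ?x\<bar>) ^ 16 = 4 ^ 16 * (1 / 2 ^ n) ^ 16" unfolding dx by (rule power_mult_distrib)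
    also have "((1::real) / 2 ^ n) ^ 16 \<le> (1 / 2 ^ n) ^ 8" by (rule power_decreasing) auto
    also have e: "((1::real) / 2 ^ n) ^ 8 = 1 / 256 ^ n"
    proof -
      have "((2::real) ^ n) ^ 8 = (2 ^ 8) ^ n" by (simp only: power_mult[symmetric] mult.commute)
      then show ?thesis by (simp add: power_divide)
    qed
    finally have u: "(4 * \<bar>?x' - ?x\<bar>) ^ 16 \<le> 4 ^ 16 * (1 / 256 ^ n)" by simp
    have "sqrt \<bar>?t' - ?t\<bar> ^ 16 = ((sqrt (1 / 2 ^ n))\<^sup>2) ^ 8" unfolding dt by (simp only: power_mult[symmetric]) simp
    also have "\<dots> = 1 / 256 ^ n" unfolding e[symmetric] by simp
    finally have v: "sqrt \<bar>?t' - ?t\<bar> ^ 16 = 1 / 256 ^ n" .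
    have "?c * (4 * \<bar>?x' - ?x\<bar>) ^ 16 + ?c * sqrt \<bar>?t' - ?t\<bar> ^ 16 \<le> ?c * (4 ^ 16 * (1 / 256 ^ n)) + ?c * (1 / 256 ^ n)"
      unfolding v by (intro add_right_mono mult_left_mono u) simp
    also have "\<dots> = ?c * (4 ^ 16 + 1) / 256 ^ n" by (simp only: distrib_left distrib_right add_divide_distrib times_divide_eq_right mult_1_right)
    finally show "fact (2 * 16) / (2 ^ 16 * fact 16) * (4 * \<bar>?x' - ?x\<bar>) ^ 16 + fact (2 * 16) / (2 ^ 16 * fact 16) * sqrt \<bar>?t' - ?t\<bar> ^ 16
        \<le> ?c * (4 ^ 16 + 1) / 256 ^ n" by simp
  qed
  finally show ?thesis .
qed

lemma dyadic_increment_nonneg [simp]: "0 \<le> dyadic_increment z n a b"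
  by (simp add: dyadic_increment_def)

text \<open>
  The expectation of the sum of all dyadic increments, with weight \<open>64\<^sup>n / ((1 + \<bar>a\<bar>) (1 + b))\<^sup>2\<close>, is
  finite, since the moments decay like \<open>256\<^sup>-\<^sup>n\<close>.  Hence almost surely the sum is finite, and it bounds
  each of its terms.
\<close>

lemma stochastic_convolution_dyadic_bound:
  assumes W: "white_noise M W" and Z: "continuous_stochastic_convolution M W Z"
  shows "AE \<omega> in M. \<exists>S\<ge>1. \<forall>n a b. dyadic_increment (Z \<omega>) n a b \<le> S * ((1 + \<bar>real_of_int a\<bar>) * (1 + real b))\<^sup>2 / 64 ^ n"
proof -
  define C where "C = fact 32 / (2 ^ 16 * fact 16) * (4 ^ 16 + 1 :: real)"
  have C: "0 \<le> C" unfolding C_def by (intro mult_nonneg_nonneg) auto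
  \<comment> \<open>The sum over integers \<open>a\<close> is written as a sum over \<open>j = \<bar>a\<bar>\<close> with both signs.\<close>
  define w where "w n j b = 64 ^ n / ((1 + real j) * (1 + real b))\<^sup>2" for n j b :: nat
  have w: "0 < w n j b" for n j b unfolding w_def by (intro divide_pos_pos zero_less_power mult_pos_pos) auto
  define T where "T n j b \<omega> = ennreal (w n j b) *
      (ennreal (dyadic_increment (Z \<omega>) n (int j) b) + ennreal (dyadic_increment (Z \<omega>) n (- int j) b))" for n j b \<omega>
  have Zm[measurable]: "(\<lambda>\<omega>. Z \<omega> (x, t)) \<in> borel_measurable M" if "0 \<le> t" for x t
    using Z that by (auto simp: continuous_stochastic_convolution_def)
  have im[measurable]: "(\<lambda>\<omega>. dyadic_increment (Z \<omega>) n a b) \<in> borel_measurable M" for n a b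
    unfolding dyadic_increment_def by measurable
  have Tm[measurable]: "T n j b \<in> borel_measurable M" for n j b
    unfolding T_def by measurable
  define r where "r i = inverse ((1 + real i)\<^sup>2)" for i
  have "summable (\<lambda>i. inverse (real (Suc i) ^ 2))"
    unfolding summable_Suc_iff[of "\<lambda>i. inverse (real i ^ 2)"] by (rule inverse_power_summable) simp
  then have r: "summable r" "\<And>i. 0 \<le> r i" by (simp_all add: r_def[abs_def])
  have ET: "(\<integral>\<^sup>+\<omega>. T n j b \<omega> \<partial>M) \<le> ennreal (2 * C * (1 / 4) ^ n * r j * r b)" for n j b
  proof -
    have "(\<integral>\<^sup>+\<omega>. T n j b \<omega> \<partial>M) = ennreal (w n j b) *
      ((\<integral>\<^sup>+\<omega>. ennreal (dyadic_increment (Z \<omega>) n (int j) b) \<partial>M) + (\<integral>\<^sup>+\<omega>. ennreal (dyadic_increment (Z \<omega>) n (- int j) b) \<partial>M))"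
      unfolding T_def by (subst nn_integral_cmult) (simp_all add: nn_integral_add)
    also have "\<dots> \<le> ennreal (w n j b) * (ennreal (C / 256 ^ n) + ennreal (C / 256 ^ n))"
      unfolding C_def by (intro mult_left_mono add_mono stochastic_convolution_dyadic[OF W Z]) simp
    also have "\<dots> = ennreal (w n j b * (C / 256 ^ n + C / 256 ^ n))"
    proof -
      have "ennreal (C / 256 ^ n) + ennreal (C / 256 ^ n) = ennreal (C / 256 ^ n + C / 256 ^ n)"
        by (rule ennreal_plus[symmetric]) (use C in simp_all)
      then show ?thesis
        by (simp only:) (rule ennreal_mult[symmetric], use C w[of n j b] in \<open>simp_all add: less_imp_le\<close>)
    qed
    also have "w n j b * (C / 256 ^ n + C / 256 ^ n) = 2 * C * (1 / 4) ^ n * r j * r b"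
    proof -
      have "(256::real) ^ n = 64 ^ n * 4 ^ n" by (simp flip: power_mult_distrib)
      then show ?thesis
        by (simp only: w_def r_def power_mult_distrib power_one_over) (simp add: divide_inverse mult_ac)
    qed
    finally show ?thesis .
  qed
  define R where "R = (\<Sum>i. r i)"
  have sb: "(\<Sum>b. ennreal (K * r b)) = ennreal (K * R)" if "0 \<le> K" for K
    using r that by (intro suminf_ennreal_eq) (auto simp: R_def intro!: sums_mult summable_sums)
  have R0: "0 \<le> R" unfolding R_def using r by (intro suminf_nonneg) auto
  have "(\<integral>\<^sup>+\<omega>. (\<Sum>n. \<Sum>j. \<Sum>b. T n j b \<omega>) \<partial>M) = (\<Sum>n. \<Sum>j. \<Sum>b. \<integral>\<^sup>+\<omega>. T n j b \<omega> \<partial>M)"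
    by (simp add: nn_integral_suminf)
  also have "\<dots> \<le> (\<Sum>n. \<Sum>j. \<Sum>b. ennreal ((2 * C * (1 / 4) ^ n * r j) * r b))"
    by (intro suminf_le ET) simp_all
  also have "\<dots> = (\<Sum>n. \<Sum>j. ennreal ((2 * C * (1 / 4) ^ n * R) * r j))"
    using C r(2) by (subst sb) (simp_all add: mult.assoc mult.commute[of _ R] mult.left_commute[of _ R])
  also have "\<dots> = (\<Sum>n. ennreal ((2 * C * (1 / 4) ^ n * R) * R))"
    using C R0 by (subst sb) simp_all
  also have "\<dots> = (\<Sum>n. ennreal ((2 * C * R * R) * (1 / 4) ^ n))" by (simp add: mult_ac)
  also have "\<dots> = ennreal ((2 * C * R * R) * (1 / (1 - 1 / 4)))"
    using C R0 by (intro suminf_ennreal_eq sums_mult geometric_sums) auto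
  also have "\<dots> < \<infinity>" by simp
  finally have fin: "(\<integral>\<^sup>+\<omega>. (\<Sum>n. \<Sum>j. \<Sum>b. T n j b \<omega>) \<partial>M) \<noteq> \<infinity>" by simp
  have "AE \<omega> in M. (\<Sum>n. \<Sum>j. \<Sum>b. T n j b \<omega>) \<noteq> \<infinity>"
    by (rule nn_integral_PInf_AE[OF _ fin]) measurable
  then show ?thesis
  proof (rule AE_mp, intro AE_I2 impI)
    fix \<omega> assume "(\<Sum>n. \<Sum>j. \<Sum>b. T n j b \<omega>) \<noteq> \<infinity>"
    then obtain S where S: "0 \<le> S" "(\<Sum>n. \<Sum>j. \<Sum>b. T n j b \<omega>) = ennreal S"
      by (cases "\<Sum>n. \<Sum>j. \<Sum>b. T n j b \<omega>") auto
    have summand_le: "f i \<le> (\<Sum>i. f i)" for f :: "nat \<Rightarrow> ennreal" and i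
      using sum_le_suminf[of f "{i}"] by simp
    have T_le: "T n j b \<omega> \<le> ennreal S" for n j b
      unfolding S(2)[symmetric] by (meson summand_le order_trans)
    have "dyadic_increment (Z \<omega>) n a b \<le> max 1 S * ((1 + \<bar>real_of_int a\<bar>) * (1 + real b))\<^sup>2 / 64 ^ n" for n a b
    proof -
      define j where "j = nat \<bar>a\<bar>"
      have a: "a = int j \<or> a = - int j" and rj: "real j = \<bar>real_of_int a\<bar>" by (auto simp: j_def)
      have "ennreal (w n j b) * ennreal (dyadic_increment (Z \<omega>) n a b) \<le> T n j b \<omega>"
        unfolding T_def using a by (intro mult_left_mono) (auto simp: add_increasing add_increasing2)
      also have "\<dots> \<le> ennreal S" by (rule T_le)
      finally have "w n j b * dyadic_increment (Z \<omega>) n a b \<le> S"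
        using S(1) w[of n j b] by (simp add: less_imp_le flip: ennreal_mult)
      then have "w n j b * dyadic_increment (Z \<omega>) n a b \<le> max 1 S" by simp
      then have "dyadic_increment (Z \<omega>) n a b \<le> max 1 S / w n j b"
        using w[of n j b] by (simp add: le_divide_eq mult.commute)
      also have "\<dots> = max 1 S * ((1 + \<bar>real_of_int a\<bar>) * (1 + real b))\<^sup>2 / 64 ^ n"
        unfolding w_def rj by simp
      finally show ?thesis .
    qed
    then show "\<exists>S\<ge>1. \<forall>n a b. dyadic_increment (Z \<omega>) n a b \<le> S * ((1 + \<bar>real_of_int a\<bar>) * (1 + real b))\<^sup>2 / 64 ^ n"
      by (intro exI[of _ "max 1 S"]) auto
  qed
qed

text \<open>
  The kernel vanishes at \<open>t = 0\<close>, so the white noise integral has variance 0.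
\<close>

lemma stochastic_convolution_initial:
  assumes W: "white_noise M W" and Z: "continuous_stochastic_convolution M W Z"
  shows "AE \<omega> in M. Z \<omega> (x, 0) = 0"
proof -
  have [measurable]: "(\<lambda>\<omega>. Z \<omega> (x, 0)) \<in> borel_measurable M"
    using Z by (auto simp: continuous_stochastic_convolution_def)
  have z: "noise_kernel x 0 = (\<lambda>_. 0)" by (auto simp: noise_kernel_def)
  have L: "noise_kernel x 0 \<in> L2" by (rule noise_kernel_L2) simp
  have Wm[measurable]: "W (noise_kernel x 0) \<in> borel_measurable M" using W L by (simp add: white_noise_def)
  obtain v where v: "0 \<le> v" "distr M borel (\<lambda>\<omega>. \<Sum>f\<in>{noise_kernel x 0}. 1 * W f \<omega>) = centred_gaussian v"
    using W L unfolding white_noise_def by (elim conjE allE[of _ "{noise_kernel x 0}"] allE[of _ "\<lambda>_. 1"]) auto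
  have "(\<integral>\<^sup>+\<omega>. ennreal (W (noise_kernel x 0) \<omega> ^ (2 * 1)) \<partial>M) = ennreal (fact (2 * 1) / (2 ^ 1 * fact 1) * v ^ 1)"
    using v by (intro centred_gaussian_moment') auto
  then have fin: "(\<integral>\<^sup>+\<omega>. ennreal ((W (noise_kernel x 0) \<omega>)\<^sup>2) \<partial>M) = ennreal v" by simp
  then have int: "integrable M (\<lambda>\<omega>. (W (noise_kernel x 0) \<omega>)\<^sup>2)"
    by (intro integrableI_nonneg) auto
  have "(\<integral>\<omega>. W (noise_kernel x 0) \<omega> * W (noise_kernel x 0) \<omega> \<partial>M) = (\<integral>u. noise_kernel x 0 u * noise_kernel x 0 u \<partial>spacetime_measure)"
    using W L by (simp add: white_noise_def)
  then have "(\<integral>\<omega>. (W (noise_kernel x 0) \<omega>)\<^sup>2 \<partial>M) = 0" by (simp add: z power2_eq_square)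
  then have "AE \<omega> in M. (W (noise_kernel x 0) \<omega>)\<^sup>2 = 0"
    using integral_nonneg_eq_0_iff_AE[OF int] by simp
  moreover have "AE \<omega> in M. Z \<omega> (x, 0) = W (noise_kernel x 0) \<omega>"
    using Z unfolding continuous_stochastic_convolution_def noise_kernel_def by blast
  ultimately show ?thesis by eventually_elim simp
qed

lemma subexp_polynomial: "subexp (\<lambda>p. (2 + \<bar>fst p\<bar>) * (2 + max (snd p) 0))"
proof -
  have le: "y \<le> 1 / \<epsilon> * exp (\<epsilon> * y)" if "0 < \<epsilon>" for \<epsilon> y :: real
  proof -
    have "\<epsilon> * y \<le> exp (\<epsilon> * y)" using exp_ge_add_one_self[of "\<epsilon> * y"] by linarith
    with that show ?thesis by (simp add: field_simps)
  qed
  have "subexp (\<lambda>p. \<bar>fst p\<bar>)" "subexp (\<lambda>p. max (snd p) 0)"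
    unfolding subexp_def
  proof (safe, goal_cases)
    case (1 \<epsilon>)
    have "\<bar>x\<bar> \<le> 1 / \<epsilon> * exp (\<epsilon> * (\<bar>x\<bar> + max t 0))" for x t
      using 1 by (intro order_trans[OF le[OF 1, of "\<bar>x\<bar>"] mult_left_mono]) auto
    then show ?case by (intro exI[of _ "1 / \<epsilon>"]) auto
  next
    case (2 \<epsilon>)
    have "max t 0 \<le> 1 / \<epsilon> * exp (\<epsilon> * (\<bar>x\<bar> + max t 0))" for x t
      using 2 by (intro order_trans[OF le[OF 2, of "max t 0"] mult_left_mono]) auto
    then show ?case by (intro exI[of _ "1 / \<epsilon>"]) auto
  qed
  then show ?thesis by (intro subexp_mult subexp_add subexp_const)
qed

lemma stochastic_convolution_subexp:
  assumes W: "white_noise M W" and Z: "continuous_stochastic_convolution M W Z"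
  shows "AE \<omega> in M. subexp (ext (Z \<omega>))"
proof -
  have "AE \<omega> in M. \<forall>a::int. Z \<omega> (real_of_int a, 0) = 0"
    by (subst AE_all_countable) (intro allI stochastic_convolution_initial[OF W Z])
  then show ?thesis
    using stochastic_convolution_dyadic_bound[OF W Z] AE_space
  proof eventually_elim
    fix \<omega>
    assume z0: "\<forall>a::int. Z \<omega> (real_of_int a, 0) = 0"
      and "\<exists>S\<ge>1. \<forall>n a b. dyadic_increment (Z \<omega>) n a b \<le> S * ((1 + \<bar>real_of_int a\<bar>) * (1 + real b))\<^sup>2 / 64 ^ n"
      and \<omega>: "\<omega> \<in> space M"
    then obtain S where S: "1 \<le> S" "\<And>n a b. dyadic_increment (Z \<omega>) n a b \<le> S * ((1 + \<bar>real_of_int a\<bar>) * (1 + real b))\<^sup>2 / 64 ^ n"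
      by blast
    have c: "continuous_on spacetime (Z \<omega>)"
      using Z \<omega> by (simp add: continuous_stochastic_convolution_def)
    obtain K where K: "0 \<le> K" "\<And>x t. 0 \<le> t \<Longrightarrow> \<bar>Z \<omega> (x, t)\<bar> \<le> K * ((2 + \<bar>x\<bar>) * (2 + t))\<^sup>2"
      using dyadic_chaining[OF c _ S] z0 by blast
    show "subexp (ext (Z \<omega>))"
    proof (rule subexp_dominated)
      show "subexp (\<lambda>p. K * ((2 + \<bar>fst p\<bar>) * (2 + max (snd p) 0))\<^sup>2)"
        by (intro subexp_mult subexp_const subexp_power subexp_polynomial)
      fix p
      have "\<bar>ext (Z \<omega>) p\<bar> \<le> K * ((2 + \<bar>fst p\<bar>) * (2 + max (snd p) 0))\<^sup>2"
        unfolding ext_def by (rule K(2)) simp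
      then show "\<bar>ext (Z \<omega>) p\<bar> \<le> \<bar>K * ((2 + \<bar>fst p\<bar>) * (2 + max (snd p) 0))\<^sup>2\<bar>" by linarith
    qed
  qed
qed

section \<open>Existence and uniqueness\<close>

lemma stochastic_convolution_continuous:
  "continuous_stochastic_convolution M W Z \<Longrightarrow> \<omega> \<in> space M \<Longrightarrow> continuous_on UNIV (ext (Z \<omega>))"
  by (rule ext_continuous) (simp add: continuous_stochastic_convolution_def)

text \<open>
  The component \<open>True\<close> is the first one of the system.
\<close>

definition forcing ::
  "(real \<Rightarrow> real) \<Rightarrow> (real \<Rightarrow> real) \<Rightarrow> ('w \<Rightarrow> real \<times> real \<Rightarrow> real) \<Rightarrow> ('w \<Rightarrow> real \<times> real \<Rightarrow> real) \<Rightarrow>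
   'w \<Rightarrow> bool \<Rightarrow> real \<times> real \<Rightarrow> real" where
  "forcing m10 m20 Z1 Z2 \<omega> i p =
     heat (max (snd p) 0) (if i then m10 else m20) (fst p) + ext ((if i then Z1 else Z2) \<omega>) p"

lemma solves_iff_mild_equations:
  assumes "continuous_on UNIV m10" "continuous_on UNIV m20"
    and "\<And>\<alpha>. 0 < \<alpha> \<Longrightarrow> m1 \<in> C_spacetime \<alpha>" "\<And>\<alpha>. 0 < \<alpha> \<Longrightarrow> m2 \<in> C_spacetime \<alpha>"
  shows "solves lam V' (forcing m10 m20 Z1 Z2 \<omega>) (\<lambda>i. ext (if i then m1 else m2)) \<longleftrightarrow>
    mild_equation lam m10 (Z1 \<omega>) m1 m2 \<and> mild_equation lam m20 (Z2 \<omega>) m2 m1"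
proof -
  have 1: "mild_equation lam m10 (Z1 \<omega>) m1 m2 \<longleftrightarrow> (\<forall>p. ext m1 p = (heat (max (snd p) 0) m10 (fst p) + ext (Z1 \<omega>) p) -
      duhamel 0 (\<lambda>p. V' (ext m1 p) + lam * (ext m1 p - ext m2 p)) p)"
    by (rule mild_equation_iff) (use assms in auto)
  have 2: "mild_equation lam m20 (Z2 \<omega>) m2 m1 \<longleftrightarrow> (\<forall>p. ext m2 p = (heat (max (snd p) 0) m20 (fst p) + ext (Z2 \<omega>) p) -
      duhamel 0 (\<lambda>p. V' (ext m2 p) + lam * (ext m2 p - ext m1 p)) p)"
    by (rule mild_equation_iff) (use assms in auto)
  show ?thesis
    unfolding 1 2 solves_def all_bool_eq drift_def[abs_def] forcing_def by (simp add: conj_commute)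
qed

theorem theorem1p1:
  fixes M :: "'w measure"
    and W1 W2 :: "(real \<times> real \<Rightarrow> real) \<Rightarrow> 'w \<Rightarrow> real"
    and Z1 Z2 :: "'w \<Rightarrow> real \<times> real \<Rightarrow> real"
    and lam :: real
    and m10 m20 :: "real \<Rightarrow> real"
  assumes "prob_space M"
    and "white_noise M W1" and "white_noise M W2"
    and "independent_noises M W1 W2"
    and "continuous_stochastic_convolution M W1 Z1"
    and "continuous_stochastic_convolution M W2 Z2"
    and "lam > 0"
    and "\<forall>\<alpha>>0. m10 \<in> C_space \<alpha> \<and> m20 \<in> C_space \<alpha>"
  shows "(\<exists>m1 m2. is_solution M lam m10 m20 Z1 Z2 m1 m2) \<and>
    (\<forall>m1 m2 n1 n2.
       is_solution M lam m10 m20 Z1 Z2 m1 m2 \<and> is_solution M lam m10 m20 Z1 Z2 n1 n2 \<longrightarrow>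
       (AE \<omega> in M. \<forall>t\<ge>0. \<forall>x. m1 \<omega> (x, t) = n1 \<omega> (x, t) \<and> m2 \<omega> (x, t) = n2 \<omega> (x, t)))"
proof -
  let ?g = "forcing m10 m20 Z1 Z2" and ?\<F> = "noise_filtration M Z1 Z2"
  have lam: "0 \<le> lam" using assms(7) by simp
  have m0: "m10 \<in> C_space \<alpha>" "m20 \<in> C_space \<alpha>" if "0 < \<alpha>" for \<alpha> using assms(8) that by auto
  have m0_if: "(if i then m10 else m20) \<in> C_space \<alpha>" if "0 < \<alpha>" for \<alpha> i using m0[OF that] by simp
  have m0c: "continuous_on UNIV m10" "continuous_on UNIV m20" using m0[of 1] by (auto simp: C_space_def)
  have Zc: "continuous_on UNIV (ext ((if i then Z1 else Z2) \<omega>))" if "\<omega> \<in> space M" for i \<omega>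
    using stochastic_convolution_continuous[OF assms(5) that] stochastic_convolution_continuous[OF assms(6) that] by simp
  have gc: "continuous_on UNIV (?g \<omega> i)" if "\<omega> \<in> space M" for \<omega> i
    unfolding forcing_def by (intro continuous_on_add heat_initial_datum(1) m0_if Zc that)
  have gs: "AE \<omega> in M. \<forall>i. subexp (?g \<omega> i)"
    using stochastic_convolution_subexp[OF assms(2,5)] stochastic_convolution_subexp[OF assms(3,6)]
  proof eventually_elim
    fix \<omega> assume Z: "subexp (ext (Z1 \<omega>))" "subexp (ext (Z2 \<omega>))"
    have "subexp (?g \<omega> i)" for i
      unfolding forcing_def by (intro subexp_add heat_initial_datum(2) m0_if) (simp_all add: Z)
    then show "\<forall>i. subexp (?g \<omega> i)" ..
  qed
  have prog: "progressive ?\<F> (\<lambda>\<omega>. ?g \<omega> i)" for i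
    unfolding forcing_def
  proof (intro progressive_add progressive_deterministic heat_initial_datum(1) m0_if progressive_continuous)
    fix t \<omega> assume "\<omega> \<in> space (?\<F> t)"
    then have "\<omega> \<in> space M" by (simp add: noise_filtration_def space_measure_of_conv)
    then show "continuous_on UNIV (ext ((if i then Z1 else Z2) \<omega>))" by (rule Zc)
  next
    fix x s t :: real assume "0 \<le> s" "s \<le> t"
    then show "(\<lambda>\<omega>. (if i then Z1 else Z2) \<omega> (x, s)) \<in> borel_measurable (?\<F> t)"
      by (intro noise_filtration_measurable) auto
  qed
  have "is_solution M lam m10 m20 Z1 Z2 (\<lambda>\<omega>. solution lam (?g \<omega>) True) (\<lambda>\<omega>. solution lam (?g \<omega>) False)"
    unfolding is_solution_def
  proof (intro conjI)
    show "adapted ?\<F> (\<lambda>\<omega>. solution lam (?g \<omega>) True)" "adapted ?\<F> (\<lambda>\<omega>. solution lam (?g \<omega>) False)"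
      by (intro progressive_adapted progressive_solution prog)+
    show "AE \<omega> in M. (\<forall>\<alpha>>0. solution lam (?g \<omega>) True \<in> C_spacetime \<alpha> \<and> solution lam (?g \<omega>) False \<in> C_spacetime \<alpha>) \<and>
        mild_equation lam m10 (Z1 \<omega>) (solution lam (?g \<omega>) True) (solution lam (?g \<omega>) False) \<and>
        mild_equation lam m20 (Z2 \<omega>) (solution lam (?g \<omega>) False) (solution lam (?g \<omega>) True)"
      using gs AE_space
    proof eventually_elim
      fix \<omega> assume s: "\<forall>i. subexp (?g \<omega> i)" and \<omega>: "\<omega> \<in> space M"
      let ?m = "solution lam (?g \<omega>)"
      note hyps = lam gc[OF \<omega>] spec[OF s]
      have C: "?m i \<in> C_spacetime \<alpha>" if "0 < \<alpha>" for \<alpha> i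
        by (rule subexp_C_spacetime[OF solution_continuous[OF hyps] solution_subexp[OF hyps] that])
      have sol: "solves lam V' (?g \<omega>) ?m" by (rule solution_solves[OF hyps])
      have "ext (?m i) p = ?m i p" for i p
        using solvesD[OF sol, of i "(fst p, max (snd p) 0)"] solvesD[OF sol, of i p]
        by (cases p) (simp add: ext_def forcing_def duhamel_def lookback_def)
      then have "(\<lambda>i. ext (if i then ?m True else ?m False)) = ?m"
        by (auto simp: fun_eq_iff)
      with sol have "mild_equation lam m10 (Z1 \<omega>) (?m True) (?m False) \<and> mild_equation lam m20 (Z2 \<omega>) (?m False) (?m True)"
        using solves_iff_mild_equations[OF m0c C[of _ True] C[of _ False], of lam Z1 Z2 \<omega>] by simp
      with C show "(\<forall>\<alpha>>0. ?m True \<in> C_spacetime \<alpha> \<and> ?m False \<in> C_spacetime \<alpha>) \<and>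
        mild_equation lam m10 (Z1 \<omega>) (?m True) (?m False) \<and> mild_equation lam m20 (Z2 \<omega>) (?m False) (?m True)" by blast
    qed
  qed
  moreover have "AE \<omega> in M. \<forall>t\<ge>0. \<forall>x. m1 \<omega> (x, t) = n1 \<omega> (x, t) \<and> m2 \<omega> (x, t) = n2 \<omega> (x, t)"
    if sol: "is_solution M lam m10 m20 Z1 Z2 m1 m2" "is_solution M lam m10 m20 Z1 Z2 n1 n2" for m1 m2 n1 n2
  proof -
    have eq: "AE \<omega> in M. \<forall>i p. ext (if i then u1 \<omega> else u2 \<omega>) p = solution lam (?g \<omega>) i p"
      if u: "is_solution M lam m10 m20 Z1 Z2 u1 u2" for u1 u2
    proof -
      from u have "AE \<omega> in M. (\<forall>\<alpha>>0. u1 \<omega> \<in> C_spacetime \<alpha> \<and> u2 \<omega> \<in> C_spacetime \<alpha>) \<and>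
        mild_equation lam m10 (Z1 \<omega>) (u1 \<omega>) (u2 \<omega>) \<and> mild_equation lam m20 (Z2 \<omega>) (u2 \<omega>) (u1 \<omega>)"
        by (simp add: is_solution_def)
      then show ?thesis
        using gs AE_space
      proof eventually_elim
        fix \<omega> assume u: "(\<forall>\<alpha>>0. u1 \<omega> \<in> C_spacetime \<alpha> \<and> u2 \<omega> \<in> C_spacetime \<alpha>) \<and>
          mild_equation lam m10 (Z1 \<omega>) (u1 \<omega>) (u2 \<omega>) \<and> mild_equation lam m20 (Z2 \<omega>) (u2 \<omega>) (u1 \<omega>)"
          and s: "\<forall>i. subexp (?g \<omega> i)" and \<omega>: "\<omega> \<in> space M"
        have C: "u1 \<omega> \<in> C_spacetime \<alpha>" "u2 \<omega> \<in> C_spacetime \<alpha>" if "0 < \<alpha>" for \<alpha> using u that by auto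
        have C': "(if i then u1 \<omega> else u2 \<omega>) \<in> C_spacetime \<alpha>" if "0 < \<alpha>" for \<alpha> i using C[OF that] by simp
        have "solves lam V' (?g \<omega>) (\<lambda>i. ext (if i then u1 \<omega> else u2 \<omega>)) \<longleftrightarrow>
            mild_equation lam m10 (Z1 \<omega>) (u1 \<omega>) (u2 \<omega>) \<and> mild_equation lam m20 (Z2 \<omega>) (u2 \<omega>) (u1 \<omega>)"
          by (rule solves_iff_mild_equations) (use m0c C in auto)
        with u have solves: "solves lam V' (?g \<omega>) (\<lambda>i. ext (if i then u1 \<omega> else u2 \<omega>))" by simp
        have cont: "continuous_on UNIV (ext (if i then u1 \<omega> else u2 \<omega>))" for i
          using C'[of 1 i] by (intro ext_continuous) (simp add: C_spacetime_def)
        have "subexp (ext (if i then u1 \<omega> else u2 \<omega>))" for i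
          by (rule C_spacetime_subexp) (rule C')
        from solution_unique[OF lam gc[OF \<omega>] spec[OF s] solves cont this]
        show "\<forall>i p. ext (if i then u1 \<omega> else u2 \<omega>) p = solution lam (?g \<omega>) i p" by simp
      qed
    qed
    show ?thesis
      using eq[OF sol(1)] eq[OF sol(2)]
    proof eventually_elim
      fix \<omega>
      assume m: "\<forall>i p. ext (if i then m1 \<omega> else m2 \<omega>) p = solution lam (?g \<omega>) i p"
        and n: "\<forall>i p. ext (if i then n1 \<omega> else n2 \<omega>) p = solution lam (?g \<omega>) i p"
      have "ext (m1 \<omega>) p = ext (n1 \<omega>) p" "ext (m2 \<omega>) p = ext (n2 \<omega>) p" for p
        using m[rule_format, of True p] n[rule_format, of True p] m[rule_format, of False p] n[rule_format, of False p] by simp_all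
      then show "\<forall>t\<ge>0. \<forall>x. m1 \<omega> (x, t) = n1 \<omega> (x, t) \<and> m2 \<omega> (x, t) = n2 \<omega> (x, t)"
        by (metis ext_def fst_conv snd_conv max.absorb1)
    qed
  qed
  ultimately show ?thesis by blast
qed

end
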